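(* Let $(X,\|\cdot\|,\tau)$ be a Saks space with mixed topology $\gamma$ and submixed topology $\gamma_{\mathrm s}$, and let $(S(t))_{t\ge0}$ be a semigroup or a cosine family on $X$. Consider the following assertions. (a) $(S(t))_{t\ge0}$ is locally $\tau$-bi-continuous. (b) $(S(t))_{t\ge0}$ is locally $\tau$-bi-continuous and exponentially bounded. (c) $(S(t))_{t\ge0}$ is $\gamma$-strongly continuous and locally $\gamma$-equicontinuous. (d) $(S(t))_{t\ge0}$ is $\gamma$-strongly continuous and exponentially $\gamma$-equicontinuous. (e) $(S(t))_{t\ge0}$ is $\gamma$-strongly continuous, locally $(\|\cdot\|,\tau)$-equitight and in $\mathcal L(X)$. (f) $(S(t))_{t\ge0}$ is $\gamma$-strongly continuous, exponentially $(\|\cdot\|,\tau)$-equitight and in $\mathcal L(X)$. (g) $(S(t))_{t\ge0}$ is $\gamma$-strongly continuous and in $\mathcal L(X,\gamma)$. (h) $(S(t))_{t\ge0}$ is $\gamma$-strongly continuous and integrable on $\langle X,(X,\gamma)'\rangle$. Then the following holds. (i) If $(X,\|\cdot\|)$ is a Banach space and $(X,\gamma)$ is C-sequential, then (a)$\Leftrightarrow$(b)$\Leftrightarrow$(c)$\Leftrightarrow$(d). (ii) If $\mathcal N_\gamma$ is countably quasi-convex, then (c)$\Leftrightarrow$(d). In particular, this holds if $(X,\gamma)$ is a Mackey space. (iii) If $\gamma=\gamma_{\mathrm s}$, then (c)$\Rightarrow$(e) and (d)$\Rightarrow$(f). If $(X,\|\cdot\|)$ is a Banach space, then (e)$\Rightarrow$(c)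 and (f)$\Rightarrow$(d). (iv) If $(X,\gamma)$ is sequentially complete, then (d)$\Rightarrow$(h). (v) If $(X,\|\cdot\|)$ is a Banach space and $(X,\gamma)$ is a Mackey space, then (h)$\Rightarrow$(g). (vi) If $(X,\gamma)$ is a strong Mackey space, then (c)$\Leftrightarrow$(d)$\Leftrightarrow$(g). If $(X,\gamma)$ is in addition sequentially complete, then (c)$\Leftrightarrow$(d)$\Leftrightarrow$(g)$\Leftrightarrow$(h). (vii) If $(X,\|\cdot\|)$ is a Banach space and $(X,\gamma)$ is a strong Mackey space and a Mazur space, then (a)$\Leftrightarrow$(b)$\Leftrightarrow$(c)$\Leftrightarrow$(d)$\Leftrightarrow$(g). If $(X,\gamma)$ is a sequentially complete Mackey space that is also a Mazur space, then (a)$\Leftrightarrow$(b)$\Leftrightarrow$(c)$\Leftrightarrow$(d)$\Leftrightarrow$(g)$\Leftrightarrow$(h).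
   Context: Linear spaces are over $\mathbb R$ or $\mathbb C$. For a Hausdorff locally convex space $(X,\tau)$, $\mathcal P_\tau$ denotes a directed system of seminorms generating $\tau$, $\mathcal L(X,\tau)$ the continuous linear maps $X\to X$, and $(X,\tau)'$ the topological dual. For a normed space $(X,\|\cdot\|)$, $\tau_{\|\cdot\|}$ is the norm topology and $\mathcal L(X)$ the bounded linear operators with the operator norm. Semigroup on $X$: linear maps $S(t)\colon X\to X$, $t\ge0$, with $S(0)=\mathrm{id}$ and $S(t)S(s)=S(t+s)$ for $t,s\ge0$. Cosine family on $X$: linear maps $S(t)\colon X\to X$, $t\ge0$, with $S(0)=\mathrm{id}$ and $2S(t)S(s)=S(t+s)+S(t-s)$ for $t\ge s\ge0$. Saks space: a triple $(X,\|\cdot\|,\tau)$ where $(X,\|\cdot\|)$ is a normed space and $\tau\subseteq\tau_{\|\cdot\|}$ is a Hausdorff locally convex topology on $X$ such that there is a directed system of seminorms $\mathcal P_\tau$ generating $\tau$ with $\|x\|=\sup_{p\in\mathcal P_\tau}p(x)$ for all $x\in X$ (fix such $\mathcal P_\tau$). Mixed topology $\gamma=\gamma(\|\cdot\|,\tau)$: the finest linear topology on $X$ that coincides with $\tau$ on $\|\cdot\|$-bounded sets and satisfies $\tau\subseteq\gamma\subseteq\tau_{\|\cdot\|}$; it is Hausdorff locally convex. Submixed topology $\gamma_{\mathrm s}$: the Hausdorff locally convex topology generated by the seminorms $x\mapsto\sup_{n\in\mathbb N}p_n(x)a_n$, where $(p_n)_{n\in\mathbb N}$ runs through the sequences in $\mathcal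 P_\tau$ and $(a_n)_{n\in\mathbb N}$ through the non-negative real null sequences. A family $(S(t))_{t\in J}$ of linear maps $X\to X$ is: $\sigma$-strongly continuous (for a topology $\sigma$ on $X$ and $J$ a Hausdorff topological space) if $t\mapsto S(t)x\in(X,\sigma)$ is continuous for every $x\in X$; $\gamma$-equicontinuous if for every $p\in\mathcal P_\gamma$ there are $q\in\mathcal P_\gamma$, $K\ge0$ with $\sup_{t\in J}p(S(t)x)\le Kq(x)$ for all $x\in X$; bounded (for a family in $\mathcal L(X)$) if $\sup_{t\in J}\|S(t)\|_{\mathcal L(X)}<\infty$; bi-equicontinuous if for every $\|\cdot\|$-bounded sequence $(x_n)$ in $X$ and $x\in X$ with $x_n\to x$ w.r.t. $\tau$ one has $\tau$-$\lim_{n\to\infty}S(t)(x_n-x)=0$ uniformly for $t\in J$; $(\|\cdot\|,\tau)$-equitight if for all $\varepsilon>0$, $p\in\mathcal P_\tau$ there are $q\in\mathcal P_\tau$, $K\ge0$ such that $p(S(t)x)\le Kq(x)+\varepsilon\|x\|$ for all $t\in J$, $x\in X$. For families indexed by $[0,\infty)$: "locally (property)" means that $(S(t))_{t\in M}$ has the property for every compact $M\subseteq[0,\infty)$; "exponentially (property)" means that there is $\alpha\in\mathbb R$ such that $(e^{\alpha t}S(t))_{t\ge0}$ has the property (exponentially bounded presupposes $S(t)\in\mathcal L(X)$). $(S(t))_{t\ge0}$ is locally $\tau$-bi-continuous if it is a family in $\mathcal L(X)$ that is $\tau$-strongly continuous, locally bounded and locally bi-equicontinuous. $\mathcal N_\gamma$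 is the set of all $\gamma$-continuous seminorms $p$ on $X$ with $p\le\|\cdot\|$. It is countably quasi-convex if for every sequence $(p_n)_{n\in\mathbb N}$ in $\mathcal N_\gamma$ and every non-negative sequence $(a_n)_{n\in\mathbb N}$ with $\sum_{n=1}^\infty a_n=1$ there is $p\in\mathcal N_\gamma$ with $\sup_{n}a_np_n\le p$. Integrability: if $(X,\|\cdot\|)$ is a Banach space, then $Y:=(X,\gamma)'$ is a norm-closed subspace of $(X,\|\cdot\|)'$ and $\langle X,Y\rangle$ is a (norming) dual pair of Banach spaces. A family $(S(t))_{t\ge0}$ in $\mathcal L(X,\sigma(X,Y))$ is an integrable semigroup on $\langle X,Y\rangle$ if it is an exponentially bounded semigroup and there is $\omega\in\mathbb R$ such that for all $\lambda\in\mathbb C$ with $\mathrm{Re}\,\lambda>\omega$ there is $R(\lambda)\in\mathcal L(X,\sigma(X,Y))$ with $\langle R(\lambda)x,y\rangle=\int_0^\infty e^{-\lambda t}\langle S(t)x,y\rangle\,dt$ for all $x\in X$, $y\in Y$ (existence of the integrals being part of the requirement). It is an integrable cosine family on $\langle X,Y\rangle$ if it is an exponentially bounded cosine family in $\mathcal L(X,\sigma(X,Y))$ and there is $\omega\ge0$ such that for all $\lambda\in\mathbb C$ with $\mathrm{Re}\,\lambda>\omega$ there is $R(\lambda^2)\in\mathcal L(X,\sigma(X,Y))$ with $\langle\lambda R(\lambda^2)x,y\rangle=\int_0^\infty e^{-\lambda t}\langle S(t)x,y\rangle\,dt$ for all $x\in X$, $y\in Y$ (again including existence). (If $(X,\gamma)$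 is sequentially complete, then $(X,\|\cdot\|)$ is automatically Banach.) A Hausdorff locally convex space is C-sequential if every convex sequentially open subset is open ($U$ is sequentially open if every sequence converging to a point of $U$ is eventually in $U$). A Hausdorff locally convex space $(X,\sigma)$ with dual $X'$ is a Mackey space if $\sigma$ is the Mackey topology $\mu(X,X')$; a strong Mackey space if every $\sigma(X',X)$-compact subset of $X'$ is equicontinuous; a Mazur space if every sequentially continuous linear functional on it is continuous. *)

theory Defs
  imports "HOL-Analysis.Analysis"
begin

section \<open>Scalars\<close>

text \<open>
  The scalar fields \<open>\<real>\<close> and \<open>\<complex>\<close>: the image of \<open>to_complex\<close> is a subfield of \<open>\<complex>\<close> that is also a
  real subspace containing \<open>1\<close>, hence it is \<open>\<real>\<close> or \<open>\<complex>\<close>, and \<open>to_complex\<close> is an isometric field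
  isomorphism onto it.  The scalar field is \<open>\<complex>\<close> iff \<open>to_complex\<close> is surjective.
\<close>

class real_or_complex = real_normed_field +
  fixes to_complex :: "'a \<Rightarrow> complex"
  assumes to_complex_add: "to_complex (a + b) = to_complex a + to_complex b"
    and to_complex_mult: "to_complex (a * b) = to_complex a * to_complex b"
    and to_complex_scaleR: "to_complex (r *\<^sub>R a) = r *\<^sub>R to_complex a"
    and to_complex_one: "to_complex 1 = 1"
    and norm_to_complex: "cmod (to_complex a) = norm a"

instantiation real :: real_or_complex
begin
definition to_complex_real :: "real \<Rightarrow> complex" where "to_complex_real = complex_of_real"
instance by standard (simp_all add: to_complex_real_def scaleR_conv_of_real)
end

instantiation complex :: real_or_complex
begin
definition to_complex_complex :: "complex \<Rightarrow> complex" where "to_complex_complex = id"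
instance by standard (simp_all add: to_complex_complex_def)
end


section \<open>Linear topologies, seminorms and duals\<close>

text \<open>
  Topologies on \<open>X\<close> are values of type \<open>'a topology\<close> with \<open>topspace = UNIV\<close>; the norm topology is
  \<open>euclidean\<close>.  The scalar multiplication of \<open>X\<close> is an explicit argument \<open>smul\<close>.
\<close>

definition finer_top :: "'a topology \<Rightarrow> 'a topology \<Rightarrow> bool" where
  "finer_top \<sigma> \<rho> \<longleftrightarrow> (\<forall>U. openin \<rho> U \<longrightarrow> openin \<sigma> U)"

definition linear_topology ::
    "('k::real_or_complex \<Rightarrow> 'a::ab_group_add \<Rightarrow> 'a) \<Rightarrow> 'a topology \<Rightarrow> bool" where
  "linear_topology smul \<sigma> \<longleftrightarrow>
     topspace \<sigma> = UNIV \<and>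
     continuous_map (prod_topology \<sigma> \<sigma>) \<sigma> (\<lambda>(x, y). x + y) \<and>
     continuous_map (prod_topology euclidean \<sigma>) \<sigma> (\<lambda>(c, x). smul c x)"

definition seminorm ::
    "('k::real_or_complex \<Rightarrow> 'a::ab_group_add \<Rightarrow> 'a) \<Rightarrow> ('a \<Rightarrow> real) \<Rightarrow> bool" where
  "seminorm smul p \<longleftrightarrow>
     (\<forall>x y. p (x + y) \<le> p x + p y) \<and> (\<forall>c x. p (smul c x) = norm c * p x)"

text \<open>The constant \<open>C\<close> makes this the weaker of the two usual notions of directedness
  (\<open>C = 1\<close> is directedness for the pointwise order).\<close>

definition directed_seminorms :: "('a \<Rightarrow> real) set \<Rightarrow> bool" where
  "directed_seminorms P \<longleftrightarrow> P \<noteq> {} \<and>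
     (\<forall>p\<in>P. \<forall>q\<in>P. \<exists>r\<in>P. \<exists>C\<ge>0. \<forall>x. max (p x) (q x) \<le> C * r x)"

definition seminorm_topology :: "('a::ab_group_add \<Rightarrow> real) set \<Rightarrow> 'a topology" where
  "seminorm_topology P =
     topology_generated_by {{y. p (y - x) < r} | p x r. p \<in> P \<and> 0 < r}"

text \<open>The largest (directed) system of seminorms generating a locally convex topology.\<close>

definition continuous_seminorms ::
    "('k::real_or_complex \<Rightarrow> 'a::ab_group_add \<Rightarrow> 'a) \<Rightarrow> 'a topology \<Rightarrow> ('a \<Rightarrow> real) set" where
  "continuous_seminorms smul \<sigma> =
     {p. seminorm smul p \<and> continuous_map \<sigma> euclideanreal p}"

definition top_dual ::
    "('k::real_or_complex \<Rightarrow> 'a::ab_group_add \<Rightarrow> 'a) \<Rightarrow> 'a topology \<Rightarrow> ('a \<Rightarrow> 'k) set" where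
  "top_dual smul \<sigma> =
     {f. Vector_Spaces.linear smul (*) f \<and> continuous_map \<sigma> euclidean f}"

text \<open>\<open>\<sigma>(X, Y)\<close>\<close>

definition weak_topology :: "('a \<Rightarrow> 'k::topological_space) set \<Rightarrow> 'a topology" where
  "weak_topology Y = topology_generated_by {f -` U | f U. f \<in> Y \<and> open U}"

text \<open>\<open>\<sigma>(Y, X)\<close>\<close>

definition weak_star_topology :: "('a \<Rightarrow> 'k::topological_space) set \<Rightarrow> ('a \<Rightarrow> 'k) topology" where
  "weak_star_topology Y = subtopology (product_topology (\<lambda>_. euclidean) UNIV) Y"

definition absolutely_convex_functionals :: "('a \<Rightarrow> 'k::real_or_complex) set \<Rightarrow> bool" where
  "absolutely_convex_functionals H \<longleftrightarrow>
     (\<forall>f\<in>H. \<forall>g\<in>H. \<forall>a b. norm a + norm b \<le> 1 \<longrightarrow> (\<lambda>x. a * f x + b * g x) \<in> H)"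

text \<open>\<open>\<mu>(X, Y)\<close>, the topology of uniform convergence on the absolutely convex
  \<open>\<sigma>(Y, X)\<close>-compact subsets of \<open>Y\<close>.\<close>

definition mackey_topology :: "('a::ab_group_add \<Rightarrow> 'k::real_or_complex) set \<Rightarrow> 'a topology" where
  "mackey_topology Y = seminorm_topology
     {(\<lambda>x. SUP f\<in>H. norm (f x)) | H.
        H \<noteq> {} \<and> compactin (weak_star_topology Y) H \<and> absolutely_convex_functionals H}"

definition equicontinuous_functionals ::
    "'a::zero topology \<Rightarrow> ('a \<Rightarrow> 'k::real_normed_vector) set \<Rightarrow> bool" where
  "equicontinuous_functionals \<sigma> H \<longleftrightarrow>
     (\<forall>\<epsilon>>0. \<exists>U. openin \<sigma> U \<and> 0 \<in> U \<and> (\<forall>f\<in>H. \<forall>x\<in>U. norm (f x) < \<epsilon>))"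

definition mackey_space ::
    "('k::real_or_complex \<Rightarrow> 'a::ab_group_add \<Rightarrow> 'a) \<Rightarrow> 'a topology \<Rightarrow> bool" where
  "mackey_space smul \<sigma> \<longleftrightarrow> \<sigma> = mackey_topology (top_dual smul \<sigma>)"

definition strong_mackey_space ::
    "('k::real_or_complex \<Rightarrow> 'a::ab_group_add \<Rightarrow> 'a) \<Rightarrow> 'a topology \<Rightarrow> bool" where
  "strong_mackey_space smul \<sigma> \<longleftrightarrow>
     (\<forall>H. compactin (weak_star_topology (top_dual smul \<sigma>)) H \<longrightarrow> equicontinuous_functionals \<sigma> H)"

definition mazur_space ::
    "('k::real_or_complex \<Rightarrow> 'a::ab_group_add \<Rightarrow> 'a) \<Rightarrow> 'a topology \<Rightarrow> bool" where
  "mazur_space smul \<sigma> \<longleftrightarrow>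
     (\<forall>f::'a \<Rightarrow> 'k. Vector_Spaces.linear smul (*) f \<and>
        (\<forall>xs x. limitin \<sigma> xs x sequentially \<longrightarrow> (\<lambda>n. f (xs n)) \<longlonglongrightarrow> f x)
        \<longrightarrow> continuous_map \<sigma> euclidean f)"

definition sequentially_open :: "'a topology \<Rightarrow> 'a set \<Rightarrow> bool" where
  "sequentially_open \<sigma> U \<longleftrightarrow>
     (\<forall>xs x. x \<in> U \<and> limitin \<sigma> xs x sequentially \<longrightarrow> (\<forall>\<^sub>F n in sequentially. xs n \<in> U))"

definition C_sequential :: "'a::real_vector topology \<Rightarrow> bool" where
  "C_sequential \<sigma> \<longleftrightarrow> (\<forall>U. convex U \<and> sequentially_open \<sigma> U \<longrightarrow> openin \<sigma> U)"

definition sequentially_complete :: "'a::ab_group_add topology \<Rightarrow> bool" where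
  "sequentially_complete \<sigma> \<longleftrightarrow>
     (\<forall>xs. (\<forall>U. openin \<sigma> U \<and> 0 \<in> U \<longrightarrow> (\<exists>N::nat. \<forall>m\<ge>N. \<forall>n\<ge>N. xs m - xs n \<in> U))
        \<longrightarrow> (\<exists>x. limitin \<sigma> xs x sequentially))"


section \<open>Saks spaces, mixed and submixed topology\<close>

text \<open>A normed space over the scalar field \<open>'k\<close>; the norm is that of the type \<open>'a\<close>, whose real
  scalar multiplication has to be the restriction of \<open>smul\<close>.\<close>

definition normed_space_over :: "('k::real_or_complex \<Rightarrow> 'a::real_normed_vector \<Rightarrow> 'a) \<Rightarrow> bool" where
  "normed_space_over smul \<longleftrightarrow> vector_space smul \<and>
     (\<forall>r x. smul (of_real r) x = r *\<^sub>R x) \<and> (\<forall>c x. norm (smul c x) = norm c * norm x)"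

text \<open>The system \<open>P\<close> of seminorms is the one fixed for the Saks space.\<close>

definition saks_space ::
    "('k::real_or_complex \<Rightarrow> 'a::real_normed_vector \<Rightarrow> 'a) \<Rightarrow> 'a topology \<Rightarrow> ('a \<Rightarrow> real) set \<Rightarrow> bool"
  where
  "saks_space smul \<tau> P \<longleftrightarrow>
     normed_space_over smul \<and>
     (\<forall>p\<in>P. seminorm smul p) \<and> directed_seminorms P \<and> \<tau> = seminorm_topology P \<and>
     Hausdorff_space \<tau> \<and> finer_top euclidean \<tau> \<and>
     (\<forall>x. bdd_above ((\<lambda>p. p x) ` P) \<and> norm x = (SUP p\<in>P. p x))"

definition mixed_candidate ::
    "('k::real_or_complex \<Rightarrow> 'a::real_normed_vector \<Rightarrow> 'a) \<Rightarrow> 'a topology \<Rightarrow> 'a topology \<Rightarrow> bool" where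
  "mixed_candidate smul \<tau> \<sigma> \<longleftrightarrow>
     linear_topology smul \<sigma> \<and>
     (\<forall>B. bounded B \<longrightarrow> subtopology \<sigma> B = subtopology \<tau> B) \<and>
     finer_top \<sigma> \<tau> \<and> finer_top euclidean \<sigma>"

definition is_mixed_topology ::
    "('k::real_or_complex \<Rightarrow> 'a::real_normed_vector \<Rightarrow> 'a) \<Rightarrow> 'a topology \<Rightarrow> 'a topology \<Rightarrow> bool" where
  "is_mixed_topology smul \<tau> \<gamma> \<longleftrightarrow>
     mixed_candidate smul \<tau> \<gamma> \<and> (\<forall>\<sigma>. mixed_candidate smul \<tau> \<sigma> \<longrightarrow> finer_top \<gamma> \<sigma>)"

lemma finer_top_continuous_map_dom:
  assumes "finer_top s r" "topspace s = topspace r" "continuous_map r q f"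
  shows "continuous_map s q f"
  using assms unfolding finer_top_def continuous_map_def by auto

lemma finer_top_prod:
  assumes "finer_top s s'" "finer_top r r'"
  shows "finer_top (prod_topology s r) (prod_topology s' r')"
  using assms unfolding finer_top_def openin_prod_topology_alt by meson

lemma linear_topology_seminorm_topology:
  fixes smul :: "'k::real_or_complex \<Rightarrow> 'a::ab_group_add \<Rightarrow> 'a"
  assumes "vector_space smul" "P \<noteq> {}" and P: "\<And>p. p \<in> P \<Longrightarrow> seminorm smul p"
  shows "linear_topology smul (seminorm_topology P)"
proof -
  interpret vector_space smul by fact
  let ?T = "seminorm_topology P"
  have op: "openin ?T {y. p (y - x) < r}" if "p \<in> P" "0 < r" for p x r
    unfolding seminorm_topology_def by (rule topology_generated_by_Basis) (use that in blast)
  have p0: "p 0 = 0" if "p \<in> P" for p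
    using P[OF that] unfolding seminorm_def by (metis norm_zero mult_zero_left scale_zero_left)
  have padd: "p (x + y) \<le> p x + p y" if "p \<in> P" for p x y
    using P[OF that] unfolding seminorm_def by blast
  have psc: "p (smul c y) = norm c * p y" if "p \<in> P" for p c y
    using P[OF that] unfolding seminorm_def by blast
  have pge: "0 \<le> p x" if "p \<in> P" for p x
    using padd[OF that, of x "smul (-1) x"] psc[OF that, of "-1" x] p0[OF that] by simp
  have un: "(\<Union>{{y. p (y - x) < r} | p x r. p \<in> P \<and> 0 < r}) = UNIV"
  proof -
    obtain p where p: "p \<in> P" using assms(2) by blast
    have "y \<in> (\<Union>{{y. p (y - x) < r} | p x r. p \<in> P \<and> 0 < r})" for y
      by (rule UnionI[of "{z. p (z - y) < 1}"]) (use p p0[OF p] zero_less_one in \<open>simp, blast\<close>, simp add: p0[OF p])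
    then show ?thesis by blast
  qed
  have top: "topspace ?T = UNIV"
    unfolding seminorm_topology_def topology_generated_by_topspace un ..
  have add: "continuous_map (prod_topology ?T ?T) ?T (\<lambda>(x, y). x + y)"
    unfolding seminorm_topology_def[of P, THEN arg_cong[of _ _ "\<lambda>t. continuous_map _ t _"]]
  proof (rule continuous_on_generated_topo)
    fix U assume "U \<in> {{y. p (y - x) < r} | p x r. p \<in> P \<and> 0 < r}"
    then obtain p a r where p: "p \<in> P" "0 < r" and U: "U = {y. p (y - a) < r}" by blast
    show "openin (prod_topology ?T ?T) ((\<lambda>(x, y). x + y) -` U \<inter> topspace (prod_topology ?T ?T))"
      unfolding openin_prod_topology_alt
    proof (intro allI impI)
      fix x y assume "(x, y) \<in> (\<lambda>(x, y). x + y) -` U \<inter> topspace (prod_topology ?T ?T)"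
      then have lt: "p (x + y - a) < r" by (simp add: U)
      define e where "e = (r - p (x + y - a)) / 2"
      have e: "0 < e" using lt by (simp add: e_def)
      have "x' + y' \<in> U" if "p (x' - x) < e" "p (y' - y) < e" for x' y'
      proof -
        have eq: "x' + y' - a = (x + y - a) + ((x' - x) + (y' - y))" by (simp add: algebra_simps)
        have "p (x' + y' - a) \<le> p (x + y - a) + (p (x' - x) + p (y' - y))"
          unfolding eq using padd[OF p(1), of "x + y - a" "(x' - x) + (y' - y)"]
            padd[OF p(1), of "x' - x" "y' - y"] by linarith
        also have "\<dots> < r" using that by (simp add: e_def)
        finally show ?thesis by (simp add: U)
      qed
      then show "\<exists>V W. openin ?T V \<and> openin ?T W \<and> x \<in> V \<and> y \<in> W \<and>
          V \<times> W \<subseteq> (\<lambda>(x, y). x + y) -` U \<inter> topspace (prod_topology ?T ?T)"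
        using op[OF p(1) e] p0[OF p(1)] e
        by (intro exI[of _ "{z. p (z - x) < e}"] exI[of _ "{z. p (z - y) < e}"]) (auto simp: top)
    qed
  qed (unfold un, simp)
  have sc: "continuous_map (prod_topology euclidean ?T) ?T (\<lambda>(c, x). smul c x)"
    unfolding seminorm_topology_def[of P, THEN arg_cong[of _ _ "\<lambda>t. continuous_map _ t _"]]
  proof (rule continuous_on_generated_topo)
    fix U assume "U \<in> {{y. p (y - x) < r} | p x r. p \<in> P \<and> 0 < r}"
    then obtain p a r where p: "p \<in> P" "0 < r" and U: "U = {y. p (y - a) < r}" by blast
    show "openin (prod_topology euclidean ?T)
        ((\<lambda>(c, x). smul c x) -` U \<inter> topspace (prod_topology euclidean ?T))"
      unfolding openin_prod_topology_alt
    proof (intro allI impI)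
      fix c x assume "(c, x) \<in> (\<lambda>(c, x). smul c x) -` U \<inter> topspace (prod_topology euclidean ?T)"
      then have lt: "p (smul c x - a) < r" by (simp add: U)
      define e where "e = (r - p (smul c x - a)) / 2"
      have e: "0 < e" using lt by (simp add: e_def)
      define d where "d = min 1 (e / (p x + 1))"
      define d' where "d' = e / (norm c + 1)"
      have d: "0 < d" "d \<le> 1" using e pge[OF p(1), of x] by (auto simp: d_def)
      have d': "0 < d'" using e by (simp add: d'_def add_nonneg_pos)
      have 1: "d * p x < e"
      proof -
        have "d * p x \<le> e / (p x + 1) * p x" using pge[OF p(1)] by (intro mult_right_mono) (auto simp: d_def)
        also have "\<dots> < e" using e pge[OF p(1), of x] by (simp add: field_simps)
        finally show ?thesis .
      qed
      have "smul c' x' \<in> U" if "norm (c' - c) < d" "p (x' - x) < d'" for c' x'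
      proof -
        have eq: "smul c' x' - a = (smul c x - a) + (smul (c' - c) x + smul c' (x' - x))"
          by (simp add: scale_left_diff_distrib scale_right_diff_distrib)
        have "p (smul c' x' - a) \<le> p (smul c x - a) + (norm (c' - c) * p x + norm c' * p (x' - x))"
          unfolding eq using padd[OF p(1), of "smul c x - a" "smul (c' - c) x + smul c' (x' - x)"]
            padd[OF p(1), of "smul (c' - c) x" "smul c' (x' - x)"]
          by (simp add: psc[OF p(1)])
        also have "norm (c' - c) * p x \<le> d * p x" using that pge[OF p(1)] by (intro mult_right_mono) auto
        also have "norm c' * p (x' - x) \<le> (norm c + 1) * d'"
        proof (rule mult_mono)
          show "norm c' \<le> norm c + 1"
            using that(1) d norm_triangle_ineq[of "c' - c" c] by simp
        qed (use that pge[OF p(1)] in auto)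
        also have "(norm c + 1) * d' = e" using norm_ge_zero[of c] by (simp add: d'_def add_nonneg_eq_0_iff)
        also have "p (smul c x - a) + (d * p x + e) < r" using 1 by (simp add: e_def field_simps)
        finally show ?thesis by (simp add: U)
      qed
      then show "\<exists>V W. openin euclidean V \<and> openin ?T W \<and> c \<in> V \<and> x \<in> W \<and>
          V \<times> W \<subseteq> (\<lambda>(c, x). smul c x) -` U \<inter> topspace (prod_topology euclidean ?T)"
        using op[OF p(1) d'] p0[OF p(1)] d d'
        by (intro exI[of _ "ball c d"] exI[of _ "{z. p (z - x) < d'}"])
          (auto simp: top dist_norm norm_minus_commute)
    qed
  qed (unfold un, simp)
  show ?thesis unfolding linear_topology_def using top add sc by blast
qed

text \<open>The supremum of all candidates is again a candidate, so the mixed topology of a Saks space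
  exists and is unique.\<close>

lemma ex1_mixed_topology:
  assumes "saks_space smul \<tau> P"
  shows "\<exists>!\<gamma>. is_mixed_topology smul \<tau> \<gamma>"
proof (rule ex_ex1I)
  have "mixed_candidate smul \<tau> \<tau>"
    using assms linear_topology_seminorm_topology[of smul P]
    unfolding mixed_candidate_def saks_space_def normed_space_over_def directed_seminorms_def
    by (auto simp: finer_top_def)
  define G where "G = {U. \<exists>\<sigma>. mixed_candidate smul \<tau> \<sigma> \<and> openin \<sigma> U}"
  let ?T = "topology_generated_by G"
  have fin: "finer_top ?T \<sigma>" if "mixed_candidate smul \<tau> \<sigma>" for \<sigma>
    unfolding finer_top_def using that topology_generated_by_Basis[of _ G] by (auto simp: G_def)
  have tT: "topspace ?T = UNIV"
    using \<open>mixed_candidate smul \<tau> \<tau>\<close> unfolding topology_generated_by_topspace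
    by (auto simp: G_def mixed_candidate_def linear_topology_def)
  have UG: "\<Union> G = UNIV" using tT by simp
  have "mixed_candidate smul \<tau> ?T"
    unfolding mixed_candidate_def
  proof (intro conjI allI impI)
    show "finer_top ?T \<tau>" by (rule fin) fact
    show "finer_top euclidean ?T"
      unfolding finer_top_def
    proof (intro allI impI)
      fix U assume "openin ?T U"
      then have "generate_topology_on G U" by (rule openin_topology_generated_by)
      then have "open U"
        by induct (auto simp: G_def mixed_candidate_def finer_top_def)
      then show "openin euclidean U" by simp
    qed
    show "linear_topology smul ?T"
      unfolding linear_topology_def
    proof (intro conjI)
      show "topspace ?T = UNIV" by fact
      show "continuous_map (prod_topology ?T ?T) ?T (\<lambda>(x, y). x + y)"
      proof (rule continuous_on_generated_topo)
        fix U assume "U \<in> G"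
        then obtain \<sigma> where s: "mixed_candidate smul \<tau> \<sigma>" "openin \<sigma> U" by (auto simp: G_def)
        then have l: "linear_topology smul \<sigma>" by (simp add: mixed_candidate_def)
        have "openin (prod_topology \<sigma> \<sigma>) {z \<in> topspace (prod_topology \<sigma> \<sigma>). (\<lambda>(x, y). x + y) z \<in> U}"
          using l s(2) unfolding linear_topology_def continuous_map_def by blast
        moreover have "{z \<in> topspace (prod_topology \<sigma> \<sigma>). (\<lambda>(x, y). x + y) z \<in> U} =
            (\<lambda>(x, y). x + y) -` U \<inter> topspace (prod_topology ?T ?T)"
          using l tT unfolding linear_topology_def by auto
        ultimately show "openin (prod_topology ?T ?T)
            ((\<lambda>(x, y). x + y) -` U \<inter> topspace (prod_topology ?T ?T))"
          using finer_top_prod[OF fin[OF s(1)] fin[OF s(1)]] unfolding finer_top_def by metis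
      qed (simp add: UG)
      show "continuous_map (prod_topology euclidean ?T) ?T (\<lambda>(c, x). smul c x)"
      proof (rule continuous_on_generated_topo)
        fix U assume "U \<in> G"
        then obtain \<sigma> where s: "mixed_candidate smul \<tau> \<sigma>" "openin \<sigma> U" by (auto simp: G_def)
        then have l: "linear_topology smul \<sigma>" by (simp add: mixed_candidate_def)
        have "openin (prod_topology euclidean \<sigma>)
            {z \<in> topspace (prod_topology euclidean \<sigma>). (\<lambda>(c, x). smul c x) z \<in> U}"
          using l s(2) unfolding linear_topology_def continuous_map_def by blast
        moreover have "{z \<in> topspace (prod_topology euclidean \<sigma>). (\<lambda>(c, x). smul c x) z \<in> U} =
            (\<lambda>(c, x). smul c x) -` U \<inter> topspace (prod_topology euclidean ?T)"
          using l tT unfolding linear_topology_def by auto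
        ultimately show "openin (prod_topology euclidean ?T)
            ((\<lambda>(c, x). smul c x) -` U \<inter> topspace (prod_topology euclidean ?T))"
          using finer_top_prod[OF _ fin[OF s(1)], of euclidean euclidean]
          unfolding finer_top_def by metis
      qed (simp add: UG)
    qed
    fix B :: "'b set" assume B: "bounded B"
    show "subtopology ?T B = subtopology \<tau> B"
      unfolding topology_eq
    proof (intro allI iffI)
      fix V assume "openin (subtopology \<tau> B) V"
      then show "openin (subtopology ?T B) V"
        using \<open>finer_top ?T \<tau>\<close> unfolding finer_top_def openin_subtopology by blast
    next
      fix V assume "openin (subtopology ?T B) V"
      then obtain U where U: "openin ?T U" "V = U \<inter> B" by (auto simp: openin_subtopology)
      from U(1) have "generate_topology_on G U" by (rule openin_topology_generated_by)
      then have "openin (subtopology \<tau> B) (U \<inter> B)"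
      proof induct
        case Empty then show ?case by simp
      next
        case (Int a b)
        then have "openin (subtopology \<tau> B) ((a \<inter> B) \<inter> (b \<inter> B))" by blast
        then show ?case by (simp add: Int_ac)
      next
        case (UN K)
        then have "openin (subtopology \<tau> B) (\<Union>k\<in>K. k \<inter> B)" by (intro openin_Union) auto
        moreover have "(\<Union>k\<in>K. k \<inter> B) = \<Union>K \<inter> B" by blast
        ultimately show ?case by simp
      next
        case (Basis s)
        then obtain \<sigma> where s: "mixed_candidate smul \<tau> \<sigma>" "openin \<sigma> s" by (auto simp: G_def)
        then show ?case using B unfolding mixed_candidate_def by (metis openin_subtopology)
      qed
      then show "openin (subtopology \<tau> B) V" using U by simp
    qed
  qed
  then show "\<exists>\<gamma>. is_mixed_topology smul \<tau> \<gamma>"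
    unfolding is_mixed_topology_def using fin by blast
next
  fix \<gamma> \<gamma>' assume "is_mixed_topology smul \<tau> \<gamma>" "is_mixed_topology smul \<tau> \<gamma>'"
  then show "\<gamma> = \<gamma>'"
    unfolding is_mixed_topology_def finer_top_def topology_eq by blast
qed

definition submixed_topology :: "('a::ab_group_add \<Rightarrow> real) set \<Rightarrow> 'a topology" where
  "submixed_topology P = seminorm_topology
     {(\<lambda>x. SUP n. p n x * a n) | p (a :: nat \<Rightarrow> real).
        (\<forall>n. p n \<in> P) \<and> (\<forall>n. 0 \<le> a n) \<and> a \<longlonglongrightarrow> 0}"

text \<open>\<open>\<N>\<^sub>\<gamma>\<close>\<close>

definition mixed_seminorms ::
    "('k::real_or_complex \<Rightarrow> 'a::real_normed_vector \<Rightarrow> 'a) \<Rightarrow> 'a topology \<Rightarrow> ('a \<Rightarrow> real) set" where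
  "mixed_seminorms smul \<gamma> = {p \<in> continuous_seminorms smul \<gamma>. \<forall>x. p x \<le> norm x}"

definition countably_quasi_convex :: "('a \<Rightarrow> real) set \<Rightarrow> bool" where
  "countably_quasi_convex N \<longleftrightarrow>
     (\<forall>(p :: nat \<Rightarrow> 'a \<Rightarrow> real) (a :: nat \<Rightarrow> real).
        (\<forall>n. p n \<in> N) \<and> (\<forall>n. 0 \<le> a n) \<and> a sums 1 \<longrightarrow>
        (\<exists>q\<in>N. \<forall>n x. a n * p n x \<le> q x))"


section \<open>Operator families\<close>

text \<open>Families are functions on all of \<open>real\<close>, of which only the values on the index set
  (\<open>{0..}\<close> or some \<open>J \<subseteq> {0..}\<close>) are relevant.\<close>

definition continuous_operators ::
    "('k::real_or_complex \<Rightarrow> 'a::ab_group_add \<Rightarrow> 'a) \<Rightarrow> 'a topology \<Rightarrow> ('a \<Rightarrow> 'a) set" where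
  "continuous_operators smul \<sigma> =
     {T. Vector_Spaces.linear smul smul T \<and> continuous_map \<sigma> \<sigma> T}"

definition bounded_operators ::
    "('k::real_or_complex \<Rightarrow> 'a::real_normed_vector \<Rightarrow> 'a) \<Rightarrow> ('a \<Rightarrow> 'a) set" where
  "bounded_operators smul = {T. Vector_Spaces.linear smul smul T \<and> bounded_linear T}"

definition family_in :: "('a \<Rightarrow> 'a) set \<Rightarrow> real set \<Rightarrow> (real \<Rightarrow> 'a \<Rightarrow> 'a) \<Rightarrow> bool" where
  "family_in L J S \<longleftrightarrow> (\<forall>t\<in>J. S t \<in> L)"

definition semigroup_on ::
    "('k::real_or_complex \<Rightarrow> 'a::ab_group_add \<Rightarrow> 'a) \<Rightarrow> (real \<Rightarrow> 'a \<Rightarrow> 'a) \<Rightarrow> bool" where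
  "semigroup_on smul S \<longleftrightarrow>
     (\<forall>t\<ge>0. Vector_Spaces.linear smul smul (S t)) \<and> S 0 = id \<and>
     (\<forall>t\<ge>0. \<forall>s\<ge>0. S t \<circ> S s = S (t + s))"

definition cosine_family_on ::
    "('k::real_or_complex \<Rightarrow> 'a::ab_group_add \<Rightarrow> 'a) \<Rightarrow> (real \<Rightarrow> 'a \<Rightarrow> 'a) \<Rightarrow> bool" where
  "cosine_family_on smul S \<longleftrightarrow>
     (\<forall>t\<ge>0. Vector_Spaces.linear smul smul (S t)) \<and> S 0 = id \<and>
     (\<forall>s\<ge>0. \<forall>t\<ge>s. \<forall>x. smul 2 (S t (S s x)) = S (t + s) x + S (t - s) x)"

definition strongly_continuous :: "'a topology \<Rightarrow> real set \<Rightarrow> (real \<Rightarrow> 'a \<Rightarrow> 'a) \<Rightarrow> bool" where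
  "strongly_continuous \<sigma> J S \<longleftrightarrow> (\<forall>x. continuous_map (top_of_set J) \<sigma> (\<lambda>t. S t x))"

definition equicontinuous_family ::
    "('k::real_or_complex \<Rightarrow> 'a::ab_group_add \<Rightarrow> 'a) \<Rightarrow> 'a topology \<Rightarrow>
     real set \<Rightarrow> (real \<Rightarrow> 'a \<Rightarrow> 'a) \<Rightarrow> bool" where
  "equicontinuous_family smul \<sigma> J S \<longleftrightarrow>
     (\<forall>p\<in>continuous_seminorms smul \<sigma>. \<exists>q\<in>continuous_seminorms smul \<sigma>. \<exists>K\<ge>0.
        \<forall>t\<in>J. \<forall>x. p (S t x) \<le> K * q x)"

definition bounded_family ::
    "('k::real_or_complex \<Rightarrow> 'a::real_normed_vector \<Rightarrow> 'a) \<Rightarrow>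
     real set \<Rightarrow> (real \<Rightarrow> 'a \<Rightarrow> 'a) \<Rightarrow> bool" where
  "bounded_family smul J S \<longleftrightarrow>
     family_in (bounded_operators smul) J S \<and> bdd_above ((\<lambda>t. onorm (S t)) ` J)"

text \<open>Uniform convergence to \<open>0\<close> is expressed by means of the open \<open>0\<close>-neighbourhoods.\<close>

definition bi_equicontinuous_family ::
    "'a::real_normed_vector topology \<Rightarrow> real set \<Rightarrow> (real \<Rightarrow> 'a \<Rightarrow> 'a) \<Rightarrow> bool" where
  "bi_equicontinuous_family \<tau> J S \<longleftrightarrow>
     (\<forall>(xs :: nat \<Rightarrow> 'a) x. bounded (range xs) \<and> limitin \<tau> xs x sequentially \<longrightarrow>
        (\<forall>U. openin \<tau> U \<and> 0 \<in> U \<longrightarrow>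
           (\<forall>\<^sub>F n in sequentially. \<forall>t\<in>J. S t (xs n - x) \<in> U)))"

definition equitight_family ::
    "('a::real_normed_vector \<Rightarrow> real) set \<Rightarrow> real set \<Rightarrow> (real \<Rightarrow> 'a \<Rightarrow> 'a) \<Rightarrow> bool" where
  "equitight_family P J S \<longleftrightarrow>
     (\<forall>\<epsilon>>0. \<forall>p\<in>P. \<exists>q\<in>P. \<exists>K\<ge>0. \<forall>t\<in>J. \<forall>x. p (S t x) \<le> K * q x + \<epsilon> * norm x)"

definition locally_family ::
    "(real set \<Rightarrow> (real \<Rightarrow> 'a \<Rightarrow> 'a) \<Rightarrow> bool) \<Rightarrow> (real \<Rightarrow> 'a \<Rightarrow> 'a) \<Rightarrow> bool" where
  "locally_family Q S \<longleftrightarrow> (\<forall>M. compact M \<and> M \<subseteq> {0..} \<longrightarrow> Q M S)"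

definition exponentially_family ::
    "(real set \<Rightarrow> (real \<Rightarrow> 'a \<Rightarrow> 'a) \<Rightarrow> bool) \<Rightarrow> (real \<Rightarrow> 'a::real_vector \<Rightarrow> 'a) \<Rightarrow> bool" where
  "exponentially_family Q S \<longleftrightarrow> (\<exists>\<alpha>::real. Q {0..} (\<lambda>t x. exp (\<alpha> * t) *\<^sub>R S t x))"

definition locally_bi_continuous ::
    "('k::real_or_complex \<Rightarrow> 'a::real_normed_vector \<Rightarrow> 'a) \<Rightarrow> 'a topology \<Rightarrow>
     (real \<Rightarrow> 'a \<Rightarrow> 'a) \<Rightarrow> bool" where
  "locally_bi_continuous smul \<tau> S \<longleftrightarrow>
     family_in (bounded_operators smul) {0..} S \<and>
     strongly_continuous \<tau> {0..} S \<and>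
     locally_family (bounded_family smul) S \<and>
     locally_family (bi_equicontinuous_family \<tau>) S"


section \<open>Integrability\<close>

definition has_laplace_transform :: "(real \<Rightarrow> complex) \<Rightarrow> complex \<Rightarrow> complex \<Rightarrow> bool" where
  "has_laplace_transform f z v \<longleftrightarrow>
     set_integrable lborel {0..} (\<lambda>t. exp (- z * of_real t) * f t) \<and>
     (LINT t:{0..}|lborel. exp (- z * of_real t) * f t) = v"

text \<open>
  There is a \<open>\<sigma>(X, Y)\<close>-continuous linear operator \<open>R\<close> with
  \<open>\<langle>c R x, y\<rangle> = \<integral>\<^sub>0\<^sup>\<infinity> e\<^sup>-\<^sup>z\<^sup>t \<langle>S(t) x, y\<rangle> dt\<close> for all \<open>x \<in> X\<close> and \<open>y \<in> Y\<close>.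
  Over \<open>\<real>\<close>, the right-hand side is in general not real for complex \<open>z\<close>, and \<open>R\<close> is a continuous
  linear operator on the complexification \<open>X + \<i> X\<close>.  It is then determined by its restriction to
  \<open>X\<close>, which is of the form \<open>R x = A x + \<i> B x\<close> with operators \<open>A\<close>, \<open>B\<close> on \<open>X\<close>.
\<close>

definition laplace_operator_exists ::
    "('k::real_or_complex \<Rightarrow> 'a::ab_group_add \<Rightarrow> 'a) \<Rightarrow> ('a \<Rightarrow> 'k) set \<Rightarrow>
     (real \<Rightarrow> 'a \<Rightarrow> 'a) \<Rightarrow> complex \<Rightarrow> complex \<Rightarrow> bool" where
  "laplace_operator_exists smul Y S z c \<longleftrightarrow>
     (if surj (to_complex :: 'k \<Rightarrow> complex)
      then \<exists>R\<in>continuous_operators smul (weak_topology Y). \<forall>x. \<forall>y\<in>Y.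
             has_laplace_transform (\<lambda>t. to_complex (y (S t x))) z (c * to_complex (y (R x)))
      else \<exists>A\<in>continuous_operators smul (weak_topology Y).
           \<exists>B\<in>continuous_operators smul (weak_topology Y). \<forall>x. \<forall>y\<in>Y.
             has_laplace_transform (\<lambda>t. to_complex (y (S t x))) z
               (c * (to_complex (y (A x)) + \<i> * to_complex (y (B x)))))"

definition integrable_semigroup ::
    "('k::real_or_complex \<Rightarrow> 'a::real_normed_vector \<Rightarrow> 'a) \<Rightarrow> ('a \<Rightarrow> 'k) set \<Rightarrow>
     (real \<Rightarrow> 'a \<Rightarrow> 'a) \<Rightarrow> bool" where
  "integrable_semigroup smul Y S \<longleftrightarrow>
     semigroup_on smul S \<and>
     family_in (continuous_operators smul (weak_topology Y)) {0..} S \<and>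
     exponentially_family (bounded_family smul) S \<and>
     (\<exists>\<omega>::real. \<forall>z::complex. Re z > \<omega> \<longrightarrow> laplace_operator_exists smul Y S z 1)"

text \<open>As \<open>z \<mapsto> z\<^sup>2\<close> is injective on \<open>Re z > \<omega> \<ge> 0\<close>, the operator \<open>R(z\<^sup>2)\<close> may be chosen for each \<open>z\<close>.\<close>

definition integrable_cosine_family ::
    "('k::real_or_complex \<Rightarrow> 'a::real_normed_vector \<Rightarrow> 'a) \<Rightarrow> ('a \<Rightarrow> 'k) set \<Rightarrow>
     (real \<Rightarrow> 'a \<Rightarrow> 'a) \<Rightarrow> bool" where
  "integrable_cosine_family smul Y S \<longleftrightarrow>
     cosine_family_on smul S \<and>
     family_in (continuous_operators smul (weak_topology Y)) {0..} S \<and>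
     exponentially_family (bounded_family smul) S \<and>
     (\<exists>\<omega>\<ge>0. \<forall>z::complex. Re z > \<omega> \<longrightarrow> laplace_operator_exists smul Y S z z)"

text \<open>A family that is both a semigroup and a cosine family is constantly the identity, so the
  disjunction never mixes the two notions.\<close>

definition integrable_family ::
    "('k::real_or_complex \<Rightarrow> 'a::real_normed_vector \<Rightarrow> 'a) \<Rightarrow> ('a \<Rightarrow> 'k) set \<Rightarrow>
     (real \<Rightarrow> 'a \<Rightarrow> 'a) \<Rightarrow> bool" where
  "integrable_family smul Y S \<longleftrightarrow>
     integrable_semigroup smul Y S \<or> integrable_cosine_family smul Y S"

end

theory Submission
  imports Defs
begin

text \<open>
  A seminorm \<open>p\<close> is \<open>\<gamma>\<close>-continuous iff for every \<open>\<epsilon> > 0\<close> there are \<open>q \<in> P\<close> and \<open>K\<close> with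
  \<open>p \<le> K q + \<epsilon> \<parallel>\<cdot>\<parallel>\<close>: adjoining such a seminorm to \<open>P\<close> gives a competitor in the definition of the
  mixed topology.  These seminorms generate \<open>\<gamma>\<close>.  Hence \<open>\<N>\<^sub>\<gamma>\<close> is always countably quasi-convex,
  equitightness and equicontinuity agree for uniformly bounded families, and a locally
  equicontinuous family, being exponentially bounded, becomes equicontinuous after rescaling,
  because the weighted orbits are small in norm for large times.

  The Laplace transform is a \<open>\<gamma>\<close>-limit of Riemann sums.  For a strong Mackey space, the functionals
  \<open>y \<circ> S t\<close> with \<open>t\<close> in a compact set and \<open>y\<close> in a polar form a weak-star compact set, which is
  therefore equicontinuous.  A Mackey and Mazur space with complete norm is strong Mackey: the
  functionals dominated by finitely additive measures on a weak-star compact set \<open>H\<close> form an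
  absolutely convex compact set containing \<open>H\<close>, and they are sequentially continuous by a
  finite intersection argument in place of dominated convergence, hence belong to the dual.
\<close>


section \<open>The Hahn--Banach and Banach--Steinhaus theorems\<close>

text \<open>The first obstacle is that \<gamma> is given only as the finest linear topology agreeing
  with \<tau> on bounded sets: neither local convexity nor a description of its neighbourhoods comes
  with it. The seminorms of the overview are called \<open>tight\<close>, and all later arguments
  are phrased through them. Two facts drive most implications. Since the norm is the supremum of
  \<open>P\<close>, a set on which every tight seminorm is bounded is norm bounded; hence
  equicontinuity yields uniform operator bounds, and \<gamma>-convergent sequences are the
  norm-bounded \<tau>-convergent ones, which is how bi-equicontinuity enters. Moreover, tightness
  tolerates errors \<epsilon> times the norm, so that suprema over t, tails in time and null
  sequences of weights are absorbed. Completeness of the norm enters through uniform boundedness,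
  for orbits and for weak-star compact sets. Elements of a closed hull would ordinarily be
  represented by Radon measures; the finitely additive substitute keeps only the estimate obtained
  by splitting an integral of |h x| at a level \<delta>, which survives pointwise limits.\<close>

definition sublinear :: "('a::real_vector \<Rightarrow> real) \<Rightarrow> bool" where
  "sublinear q \<longleftrightarrow> (\<forall>x y. q (x + y) \<le> q x + q y) \<and> (\<forall>r\<ge>0. \<forall>x. q (r *\<^sub>R x) = r * q x)"

text \<open>The scaling inequality used with \<open>1 / r\<close> gives the reverse one. The
  functionals constructed below are infima, for which one direction is immediate.\<close>

lemma sublinearI:
  assumes "\<And>x y. q (x + y) \<le> q x + q y" and le: "\<And>r x. r > 0 \<Longrightarrow> q (r *\<^sub>R x) \<le> r * q x"
    and "q 0 = 0"
  shows "sublinear q"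
  unfolding sublinear_def
proof (intro conjI allI impI)
  fix r :: real and x assume "r \<ge> 0"
  show "q (r *\<^sub>R x) = r * q x"
  proof (cases "r = 0")
    case False
    then have r: "r > 0" using \<open>r \<ge> 0\<close> by simp
    have "q ((1 / r) *\<^sub>R (r *\<^sub>R x)) \<le> (1 / r) * q (r *\<^sub>R x)" using r by (intro le) simp
    then have "r * q x \<le> q (r *\<^sub>R x)" using r by (simp add: field_simps)
    then show ?thesis using le[OF r, of x] by simp
  qed (use assms in simp)
qed (use assms in auto)

lemma sublinear_zero: "sublinear q \<Longrightarrow> q 0 = 0"
  unfolding sublinear_def by (metis mult_zero_left order_refl scaleR_zero_left)

lemma sublinear_neg_le:
  assumes "sublinear q" shows "- q (- x) \<le> q x"
proof -
  have "q (x + - x) \<le> q x + q (- x)" using assms unfolding sublinear_def by blast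
  then show ?thesis using sublinear_zero[OF assms] by simp
qed

text \<open>The infimum over \<open>t \<ge> 0\<close> of \<open>q (x + t y) - t q y\<close> is the
  largest sublinear minorant \<open>r\<close> of \<open>q\<close> with
  \<open>r (- y) \<le> - q y\<close>. It serves twice: it makes a minimal functional odd, and it
  fixes the value of a dominated linear functional at one given vector.\<close>

lemma sublinear_descent:
  fixes q :: "'a::real_vector \<Rightarrow> real"
  assumes q: "sublinear q"
  obtains r where "sublinear r" "\<And>x. r x \<le> q x" "r (- y) \<le> - q y"
proof -
  have sub: "q (x + z) \<le> q x + q z" for x z using q by (simp add: sublinear_def)
  have hom: "c \<ge> 0 \<Longrightarrow> q (c *\<^sub>R x) = c * q x" for c x using q by (simp add: sublinear_def)
  define g where "g = (\<lambda>x t. q (x + t *\<^sub>R y) - t * q y)"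
  define r where "r = (\<lambda>x. INF t\<in>{0..}. g x t)"
  have lower: "- q (- x) \<le> g x t" if "t \<ge> 0" for x t
    using sub[of "x + t *\<^sub>R y" "- x"] hom[OF that, of y] by (simp add: g_def)
  have bdd: "bdd_below (g x ` {0..})" for x by (rule bdd_belowI2[where m = "- q (- x)"]) (use lower in auto)
  have r_le: "r x \<le> g x t" if "t \<ge> 0" for x t
    unfolding r_def by (rule cINF_lower[OF bdd]) (use that in auto)
  have le_r: "c \<le> r x" if "\<And>t. t \<ge> 0 \<Longrightarrow> c \<le> g x t" for c x
    unfolding r_def by (rule cINF_greatest) (use that in auto)
  show ?thesis
  proof (rule that[of r])
    show "sublinear r"
    proof (rule sublinearI)
      fix x z
      have "r (x + z) \<le> g x s + g z t" if "s \<ge> 0" "t \<ge> 0" for s t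
      proof -
        have "r (x + z) \<le> g (x + z) (s + t)" using that by (intro r_le) simp
        also have "\<dots> \<le> g x s + g z t"
          using sub[of "x + s *\<^sub>R y" "z + t *\<^sub>R y"] by (simp add: g_def algebra_simps)
        finally show ?thesis .
      qed
      then have "r (x + z) - g z t \<le> r x" if "t \<ge> 0" for t
        using that by (intro le_r) (simp add: algebra_simps)
      then have "r (x + z) - r x \<le> r z" by (intro le_r) (simp add: algebra_simps)
      then show "r (x + z) \<le> r x + r z" by simp
    next
      fix c :: real and x assume c: "c > 0"
      have "r (c *\<^sub>R x) / c \<le> g x t" if "t \<ge> 0" for t
      proof -
        have "r (c *\<^sub>R x) \<le> g (c *\<^sub>R x) (c * t)" using that c by (intro r_le) simp
        also have "\<dots> = c * g x t"
          using hom[of c "x + t *\<^sub>R y"] c by (simp add: g_def algebra_simps)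
        finally show ?thesis using c by (simp add: field_simps)
      qed
      then have "r (c *\<^sub>R x) / c \<le> r x" by (rule le_r)
      then show "r (c *\<^sub>R x) \<le> c * r x" using c by (simp add: field_simps)
    next
      have "g 0 t = 0" if "t \<ge> 0" for t using hom[OF that, of y] by (simp add: g_def)
      then show "r 0 = 0" using r_le[of 0 0] le_r[of 0 0] by fastforce
    qed
    show "r x \<le> q x" for x using r_le[of 0 x] by (simp add: g_def)
    show "r (- y) \<le> - q y" using r_le[of 1 "- y"] sublinear_zero[OF q] by (simp add: g_def)
  qed
qed

text \<open>A minimal sublinear functional is linear; this replaces the usual extension argument.\<close>

lemma sublinear_dominates_linear:
  fixes p :: "'a::real_vector \<Rightarrow> real"
  assumes p: "sublinear p"
  obtains u where "linear u" "\<And>x. u x \<le> p x"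
proof -
  define Q where "Q = {q. sublinear q \<and> (\<forall>x. q x \<le> p x)}"
  \<comment> \<open>The order is reversed, so that a maximal element in the sense of Zorn's lemma is
    pointwise minimal.\<close>
  define R where "R = (\<lambda>q r :: 'a \<Rightarrow> real. \<forall>x. r x \<le> q x)"
  have "\<exists>m\<in>Q. \<forall>a\<in>Q. R m a \<longrightarrow> a = m"
  proof (rule predicate_Zorn)
    show "partial_order_on Q (relation_of R Q)"
      unfolding partial_order_on_def preorder_on_def refl_on_def trans_def antisym_def relation_of_def
      by (auto simp: R_def le_fun_def[symmetric])
  next
    fix C assume C: "C \<in> Chains (relation_of R Q)"
    then have CQ: "C \<subseteq> Q" and tot: "\<And>q r. q \<in> C \<Longrightarrow> r \<in> C \<Longrightarrow> R q r \<or> R r q"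
      unfolding Chains_def relation_of_def by auto
    show "\<exists>u\<in>Q. \<forall>a\<in>C. R a u"
    proof (cases "C = {}")
      case True
      then show ?thesis using p by (auto simp: Q_def)
    next
      case False
      define u where "u = (\<lambda>x. INF q\<in>C. q x)"
      have sl: "sublinear q" "\<And>x. q x \<le> p x" if "q \<in> C" for q using CQ that by (auto simp: Q_def)
      have bdd: "bdd_below ((\<lambda>q. q x) ` C)" for x
      proof (rule bdd_belowI2[where m = "- p (- x)"])
        fix q assume "q \<in> C"
        then show "- p (- x) \<le> q x" using sublinear_neg_le[of q x] sl(1)[of q] sl(2)[of q "- x"] by linarith
      qed
      have u_le: "u x \<le> q x" if "q \<in> C" for q x unfolding u_def by (rule cINF_lower[OF bdd that])
      have le_u: "c \<le> u x" if "\<And>q. q \<in> C \<Longrightarrow> c \<le> q x" for c x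
        unfolding u_def by (rule cINF_greatest) (use False that in auto)
      have "sublinear u"
      proof (rule sublinearI)
        fix x y
        have "u (x + y) \<le> q x + r y" if "q \<in> C" "r \<in> C" for q r
        proof -
          have *: "\<exists>s\<in>C. s x \<le> q x \<and> s y \<le> r y"
            using tot[OF that] that by (force simp: R_def)
          then obtain s where s: "s \<in> C" "s x \<le> q x" "s y \<le> r y" by blast
          have "u (x + y) \<le> s (x + y)" by (rule u_le) fact
          also have "\<dots> \<le> s x + s y" using sl(1)[OF s(1)] by (simp add: sublinear_def)
          finally show ?thesis using s by simp
        qed
        then have "u (x + y) - r y \<le> u x" if "r \<in> C" for r
          using that by (intro le_u) (simp add: algebra_simps)
        then have "u (x + y) - u x \<le> u y" by (intro le_u) (simp add: algebra_simps)
        then show "u (x + y) \<le> u x + u y" by simp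
      next
        fix c :: real and x assume c: "c > 0"
        have "u (c *\<^sub>R x) / c \<le> q x" if "q \<in> C" for q
          using u_le[OF that, of "c *\<^sub>R x"] sl(1)[OF that] c by (simp add: sublinear_def field_simps)
        then have "u (c *\<^sub>R x) / c \<le> u x" by (rule le_u)
        then show "u (c *\<^sub>R x) \<le> c * u x" using c by (simp add: field_simps)
      next
        have "q 0 = 0" if "q \<in> C" for q by (rule sublinear_zero[OF sl(1)[OF that]])
        then show "u 0 = 0" using False u_le[of _ 0] le_u[of 0 0] by fastforce
      qed
      moreover have "u x \<le> p x" for x
        using False u_le sl(2) order_trans by blast
      ultimately have "u \<in> Q" by (simp add: Q_def)
      then show ?thesis using u_le by (auto simp: R_def)
    qed
  qed
  then obtain m where m: "m \<in> Q" and min: "\<And>a. a \<in> Q \<Longrightarrow> R m a \<Longrightarrow> a = m" by blast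
  have sm: "sublinear m" and mp: "\<And>x. m x \<le> p x" using m by (auto simp: Q_def)
  have neg: "m (- y) = - m y" for y
  proof -
    \<comment> \<open>Minimality forces the descended functional to be \<open>m\<close> itself,
      hence \<open>m (- y) \<le> - m y\<close>; the opposite inequality holds for every sublinear
      functional.\<close>
    obtain r where r: "sublinear r" "\<And>x. r x \<le> m x" "r (- y) \<le> - m y"
      by (rule sublinear_descent[OF sm]) blast
    then have "r = m" using mp by (intro min) (auto simp: Q_def R_def intro: order_trans)
    then show ?thesis using r(3) sublinear_neg_le[OF sm, of "y"] by simp
  qed
  have "linear m"
  proof (rule linearI)
    fix x y
    have "m (x + y) \<le> m x + m y" "m (- x + - y) \<le> m (- x) + m (- y)"
      using sm unfolding sublinear_def by blast+
    moreover have "m (- x + - y) = - m (x + y)" using neg[of "x + y"] by (simp add: algebra_simps)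
    ultimately show "m (x + y) = m x + m y" by (simp add: neg)
  next
    fix r x
    show "m (r *\<^sub>R x) = r *\<^sub>R m x"
    proof (cases "r \<ge> 0")
      case True
      then show ?thesis using sm by (simp add: sublinear_def)
    next
      case False
      then have "m ((- r) *\<^sub>R x) = - r * m x" using sm unfolding sublinear_def by (meson le_cases neg_0_le_iff_le)
      then show ?thesis using neg[of "r *\<^sub>R x"] by simp
    qed
  qed
  then show ?thesis using mp that by blast
qed

lemma Hahn_Banach_sublinear:
  fixes p :: "'a::real_vector \<Rightarrow> real"
  assumes p: "sublinear p"
  obtains u where "linear u" "\<And>x. u x \<le> p x" "u a = p a"
proof -
  obtain q where q: "sublinear q" "\<And>x. q x \<le> p x" "q (- a) \<le> - p a"
    by (rule sublinear_descent[OF p, of a]) blast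
  obtain u where u: "linear u" "\<And>x. u x \<le> q x"
    by (rule sublinear_dominates_linear[OF q(1)]) blast
  have "u (- a) \<le> - p a" using u(2) q(3) by (rule order_trans)
  then have "u a = p a" using linear_neg[OF u(1), of a] u(2)[of a] q(2)[of a] by simp
  then show ?thesis using that u q(2) order_trans by blast
qed

section \<open>Scalars of either kind, Hahn--Banach for seminorms, uniform boundedness\<close>

lemma to_complex_0 [simp]: "to_complex 0 = 0"
  by (metis norm_to_complex norm_eq_zero)

lemma to_complex_minus: "to_complex (- a) = - to_complex a"
  using to_complex_add[of a "- a"] by (simp add: add_eq_0_iff)

lemma to_complex_diff: "to_complex (a - b) = to_complex a - to_complex b"
  using to_complex_add[of a "- b"] by (simp add: to_complex_minus)

lemma to_complex_of_real [simp]: "to_complex (of_real r :: 'k::real_or_complex) = of_real r"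
  by (metis of_real_def to_complex_one to_complex_scaleR)

lemma linear_to_complex: "linear to_complex"
  by (rule linearI) (simp_all add: to_complex_add to_complex_scaleR)

lemma inj_to_complex: "inj to_complex"
  by (rule injI) (metis eq_iff_diff_eq_0 norm_eq_zero norm_to_complex to_complex_diff)

text \<open>A scalar with nonzero imaginary part would span, together with 1, all of the complex
  plane over the reals.\<close>

lemma to_complex_real_if_not_surj:
  assumes "\<not> surj (to_complex :: 'k::real_or_complex \<Rightarrow> complex)"
  shows "\<exists>r. (k :: 'k) = of_real r"
proof -
  have "Im (to_complex k) = 0"
  proof (rule ccontr)
    assume im: "Im (to_complex k) \<noteq> 0"
    have "z \<in> range (to_complex :: 'k \<Rightarrow> complex)" for z
    proof -
      define b where "b = Im z / Im (to_complex k)"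
      define a where "a = Re z - b * Re (to_complex k)"
      have "z = to_complex (of_real a + b *\<^sub>R k)"
        using im by (simp add: complex_eq_iff to_complex_add to_complex_scaleR a_def b_def del: of_real_diff of_real_mult of_real_divide)
      then show ?thesis by blast
    qed
    then show False using assms by blast
  qed
  then have "to_complex k = to_complex (of_real (Re (to_complex k)) :: 'k)"
    by (simp add: complex_eq_iff)
  then show ?thesis using inj_to_complex by (meson injD)
qed

text \<open>Compactness is pulled back from the complex plane: the range of
  \<open>to_complex\<close> is a real subspace, hence closed, and the inverse of the isometry
  \<open>to_complex\<close> is continuous on it.\<close>

lemma compact_cball_scalars: "compact (cball (0 :: 'k::real_or_complex) C)"
proof -
  let ?f = "to_complex :: 'k \<Rightarrow> complex"
  have "subspace (range ?f)" by (simp add: linear_to_complex subspace_UNIV linear_subspace_image)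
  then have cl: "closed (range ?f)" by (rule closed_subspace)
  have eq: "?f ` cball 0 C = range ?f \<inter> cball 0 C" by (auto simp: norm_to_complex)
  have "compact (?f ` cball 0 C)" unfolding eq using cl by (intro closed_Int_compact) auto
  moreover have "continuous_on (?f ` cball 0 C) (inv ?f)"
  proof (rule continuous_on_subset[of "range ?f"])
    have "dist (inv ?f x) (inv ?f y) \<le> dist x y" if "x \<in> range ?f" "y \<in> range ?f" for x y
      using that by (auto simp: dist_norm inv_f_f[OF inj_to_complex] to_complex_diff[symmetric] norm_to_complex)
    then have "1-lipschitz_on (range ?f) (inv ?f)" by (intro lipschitz_onI) auto
    then show "continuous_on (range ?f) (inv ?f)" by (rule lipschitz_on_continuous_on)
  qed auto
  ultimately have "compact (inv ?f ` ?f ` cball 0 C)" by (rule compact_continuous_image[rotated])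
  moreover have "inv ?f ` ?f ` cball 0 C = cball 0 C" by (simp add: image_inv_f_f[OF inj_to_complex])
  ultimately show ?thesis by simp
qed

lemma normed_space_overD:
  fixes smul :: "'k::real_or_complex \<Rightarrow> 'a::real_normed_vector \<Rightarrow> 'a"
  assumes "normed_space_over smul"
  shows "smul (of_real r) x = r *\<^sub>R x" "norm (smul c x) = norm c * norm x"
    "smul c (x + y) = smul c x + smul c y" "smul (c + d) x = smul c x + smul d x"
    "smul c (smul d x) = smul (c * d) x" "smul c (r *\<^sub>R x) = r *\<^sub>R smul c x"
proof -
  interpret vector_space smul using assms by (simp add: normed_space_over_def)
  show *: "smul (of_real r) x = r *\<^sub>R x" for r x using assms by (simp add: normed_space_over_def)
  show "norm (smul c x) = norm c * norm x" using assms by (simp add: normed_space_over_def)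
  show "smul c (x + y) = smul c x + smul c y" "smul (c + d) x = smul c x + smul d x"
    "smul c (smul d x) = smul (c * d) x"
    by (simp_all add: scale_right_distrib scale_left_distrib)
  show "smul c (r *\<^sub>R x) = r *\<^sub>R smul c x"
    by (simp add: *[symmetric] mult.commute)
qed

lemma seminormD:
  assumes "seminorm smul p"
  shows "p (x + y) \<le> p x + p y" "p (smul c x) = norm c * p x"
  using assms by (auto simp: seminorm_def)

lemma seminorm_normedD:
  fixes smul :: "'k::real_or_complex \<Rightarrow> 'a::real_normed_vector \<Rightarrow> 'a"
  assumes "normed_space_over smul" "seminorm smul p"
  shows "p (r *\<^sub>R x) = \<bar>r\<bar> * p x" "p 0 = 0" "p (- x) = p x" "0 \<le> p x" "p (x - y) \<le> p x + p y"
    "p (x - y) = p (y - x)" "\<bar>p x - p y\<bar> \<le> p (x - y)"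
proof -
  show hom: "p (r *\<^sub>R x) = \<bar>r\<bar> * p x" for r x
    using seminormD(2)[OF assms(2), of "of_real r" x] normed_space_overD(1)[OF assms(1)] by simp
  show zero: "p 0 = 0" using hom[of 0 0] by simp
  show neg: "p (- x) = p x" for x using hom[of "-1" x] by simp
  show "0 \<le> p x" using seminormD(1)[OF assms(2), of x "- x"] zero neg by simp
  show "p (x - y) \<le> p x + p y" using seminormD(1)[OF assms(2), of x "- y"] neg by simp
  show sym: "p (x - y) = p (y - x)" for x y using neg[of "x - y"] by simp
  show "\<bar>p x - p y\<bar> \<le> p (x - y)"
    using seminormD(1)[OF assms(2), of "x - y" y] seminormD(1)[OF assms(2), of "y - x" x] sym[of x y] by simp
qed

lemma Hahn_Banach_seminorm:
  fixes smul :: "'k::real_or_complex \<Rightarrow> 'a::real_normed_vector \<Rightarrow> 'a"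
  assumes ns: "normed_space_over smul" and p: "seminorm smul p"
  obtains f where "Vector_Spaces.linear smul (*) f" "\<And>x. norm (f x) \<le> p x" "norm (f a) = p a"
proof -
  note sn = seminormD[OF p] seminorm_normedD[OF ns p]
  have "sublinear p" using sn by (simp add: sublinear_def)
  then obtain u where u: "linear u" "\<And>x. u x \<le> p x" "u a = p a"
    by (rule Hahn_Banach_sublinear[of p a]) blast
  interpret vs: vector_space smul using ns by (simp add: normed_space_over_def)
  have vs': "vector_space ((*) :: 'k \<Rightarrow> 'k \<Rightarrow> 'k)" by unfold_locales (simp_all add: algebra_simps)
  have lin: "Vector_Spaces.linear smul (*) f" if "\<And>x y. f (x + y) = f x + f y" "\<And>c x. f (smul c x) = c * f x"
    for f :: "'a \<Rightarrow> 'k"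
    using that vs' vs.vector_space_axioms
    by (simp add: Vector_Spaces.linear_def module_hom_def module_hom_axioms_def vector_space_def module_def)
  show ?thesis
  proof (cases "surj (to_complex :: 'k \<Rightarrow> complex)")
    case False
    define f where "f = (\<lambda>x. of_real (u x) :: 'k)"
    have ab: "\<bar>u x\<bar> \<le> p x" for x
      using u(2)[of x] u(2)[of "- x"] linear_neg[OF u(1), of x] sn by simp
    have "f (smul c x) = c * f x" for c x
    proof -
      obtain r where "c = of_real r" using to_complex_real_if_not_surj[OF False] by blast
      then show ?thesis using normed_space_overD(1)[OF ns] linear_cmul[OF u(1)] by (simp add: f_def)
    qed
    then have "Vector_Spaces.linear smul (*) f"
      by (intro lin) (simp_all add: f_def linear_add[OF u(1)])
    then show ?thesis by (rule that) (use ab u(3) sn in \<open>auto simp: f_def\<close>)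
  next
    case True
    then obtain j :: 'k where j: "to_complex j = \<i>" by (metis surjD)
    have jj: "j * j = - 1"
      by (rule injD[OF inj_to_complex]) (simp add: to_complex_mult to_complex_minus to_complex_one j)
    \<comment> \<open>The usual complexification \<open>u x - i u (i x)\<close>, with
      \<open>j\<close> the imaginary unit of the scalar field; its real part is
      \<open>u\<close>.\<close>
    define f where "f = (\<lambda>x. of_real (u x) - j * of_real (u (smul j x)))"
    have tf: "to_complex (f x) = Complex (u x) (- u (smul j x))" for x
      by (simp add: f_def to_complex_diff to_complex_mult j complex_eq_iff)
    have dec: "\<exists>s t. c = of_real s + of_real t * j" for c :: 'k
    proof -
      have "to_complex c = to_complex (of_real (Re (to_complex c)) + of_real (Im (to_complex c)) * j)"
        by (simp add: to_complex_add to_complex_mult j complex_eq_iff)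
      then show ?thesis by (meson inj_to_complex injD)
    qed
    have add: "f (x + y) = f x + f y" for x y
      by (simp add: f_def normed_space_overD(3)[OF ns] linear_add[OF u(1)] algebra_simps)
    have scale: "f (smul c x) = c * f x" for c x
    proof -
      obtain s t where c: "c = of_real s + of_real t * j" using dec by blast
      have 1: "smul c x = s *\<^sub>R x + t *\<^sub>R smul j x"
        unfolding c normed_space_overD(4)[OF ns] by (metis normed_space_overD(1,5)[OF ns])
      have 2: "f (r *\<^sub>R x) = of_real r * f x" for r x
        by (simp add: f_def normed_space_overD(6)[OF ns] linear_cmul[OF u(1)] algebra_simps)
      have "smul j (smul j x) = - x"
        using normed_space_overD(5)[OF ns, of j j x] jj normed_space_overD(1)[OF ns, of "-1" x] by simp
      then have 3: "f (smul j x) = j * f x"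
        by (simp add: f_def linear_neg[OF u(1)] algebra_simps mult.assoc[symmetric] jj)
      show ?thesis unfolding 1 add 2 3 unfolding c by (simp add: algebra_simps)
    qed
    have bound: "norm (f x) \<le> p x" for x
    proof (cases "f x = 0")
      case False
      \<comment> \<open>Multiplication by this scalar of norm 1 rotates the value onto the positive
        real axis, where it equals its real part and the bound for \<open>u\<close> applies.\<close>
      define c where "c = of_real (norm (f x)) / f x"
      have "norm c = 1" using False by (simp add: c_def norm_divide)
      have "f (smul c x) = of_real (norm (f x))" using False by (simp add: scale c_def)
      then have "to_complex (f (smul c x)) = of_real (norm (f x))" by simp
      then have "u (smul c x) = norm (f x)" using tf[of "smul c x"] by (metis Re_complex_of_real complex.sel(1))
      then show ?thesis using u(2)[of "smul c x"] sn(2)[of c x] \<open>norm c = 1\<close> by simp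
    qed (use sn in simp)
    have "p a \<le> norm (f a)"
      using complex_Re_le_cmod[of "to_complex (f a)"] tf[of a] u(3) norm_to_complex[of "f a"] by (metis complex.sel(1))
    then have "norm (f a) = p a" using bound[of a] by simp
    moreover have "Vector_Spaces.linear smul (*) f" by (intro lin add scale)
    ultimately show ?thesis using bound by (intro that[of f]) auto
  qed
qed

lemma Banach_Steinhaus:
  fixes F :: "('a::real_normed_vector \<Rightarrow> 'b::real_normed_vector) set"
  assumes compl: "complete (UNIV :: 'a set)" and lin: "\<And>f. f \<in> F \<Longrightarrow> bounded_linear f"
    and pw: "\<And>x. \<exists>C. \<forall>f\<in>F. norm (f x) \<le> C"
  obtains C where "C \<ge> 0" "\<And>f x. f \<in> F \<Longrightarrow> norm (f x) \<le> C * norm x"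
proof -
  define E where "E n = {x. \<forall>f\<in>F. norm (f x) \<le> real n}" for n :: nat
  have cl: "closed (E n)" for n
  proof -
    have "E n = (\<Inter>f\<in>F. {x. norm (f x) \<le> real n})" by (auto simp: E_def)
    also have "closed \<dots>"
      by (intro closed_INT ballI closed_Collect_le continuous_intros bounded_linear.continuous_on[OF lin]) auto
    finally show ?thesis .
  qed
  have un: "(\<Union>n. E n) = UNIV"
  proof -
    have "\<exists>n. x \<in> E n" for x
    proof -
      obtain C where "\<forall>f\<in>F. norm (f x) \<le> C" using pw by blast
      moreover obtain n :: nat where "C \<le> real n" using real_arch_simple by blast
      ultimately show ?thesis unfolding E_def using order_trans by blast
    qed
    then show ?thesis by blast
  qed
  have cm: "completely_metrizable_space (euclidean :: 'a topology)"
    unfolding completely_metrizable_space_def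
    using Met_TC.Metric_space_axioms compl
    by (metis mcomplete_iff_complete mtopology_is_euclidean)
  have "\<exists>n. interior (E n) \<noteq> {}"
  proof (rule ccontr)
    assume "\<not> (\<exists>n. interior (E n) \<noteq> {})"
    then have "(euclidean :: 'a topology) interior_of \<Union>(range E) = {}"
      using cl by (intro Baire_category_alt disjI1 cm) auto
    then show False by (simp add: un)
  qed
  then obtain n a where "a \<in> interior (E n)" by blast
  then obtain e where e: "e > 0" "cball a e \<subseteq> E n" by (meson mem_interior_cball)
  \<comment> \<open>\<open>E n\<close> contains \<open>a\<close> and \<open>a + z\<close> for every
    \<open>z\<close> of norm \<open>e\<close>; subtraction gives
    \<open>norm (f z) \<le> 2 n\<close>, and scaling gives this constant.\<close>
  define C where "C = 2 * real n / e"
  show ?thesis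
  proof (rule that[of C])
    show "C \<ge> 0" using e by (simp add: C_def)
    fix f x assume f: "f \<in> F"
    interpret bounded_linear f by (rule lin) fact
    show "norm (f x) \<le> C * norm x"
    proof (cases "x = 0")
      case False
      define z where "z = (e / norm x) *\<^sub>R x"
      have "norm z = e" using False e by (simp add: z_def)
      then have "a + z \<in> E n" "a \<in> E n" using e by (auto simp: dist_norm)
      then have "norm (f (a + z)) \<le> real n" "norm (f a) \<le> real n" using f by (auto simp: E_def)
      then have "norm (f z) \<le> 2 * real n"
        using norm_triangle_ineq4[of "f (a + z)" "f a"] by (simp add: add)
      then have "e / norm x * norm (f x) \<le> 2 * real n" using e by (simp add: z_def scaleR)
      then show ?thesis using False e by (simp add: C_def field_simps)
    qed (simp add: zero)
  qed
qed


section \<open>Finitely additive measures\<close>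

lemma finitely_additive_UN_le:
  fixes m :: "'h set \<Rightarrow> real"
  assumes add: "\<And>A B. A \<inter> B = {} \<Longrightarrow> m (A \<union> B) = m A + m B" and nn: "\<And>A. 0 \<le> m A"
    and F: "finite F"
  shows "m (\<Union>i\<in>F. A i) \<le> (\<Sum>i\<in>F. m (A i))"
proof -
  have mono: "A \<subseteq> B \<Longrightarrow> m A \<le> m B" for A B using add[of A "B - A"] nn[of "B - A"] by (simp add: Un_absorb1)
  have em: "m {} = 0" using add[of "{}" "{}"] by simp
  have un: "m (A \<union> B) \<le> m A + m B" for A B
    using add[of A "B - A"] mono[of "B - A" B] by auto
  show ?thesis
    using F
  proof induct
    case (insert i F)
    then show ?case using un[of "A i" "\<Union> (A ` F)"] by simp
  qed (simp add: em)
qed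

text \<open>Otherwise, for each \<open>i\<close> and each \<open>d' > 0\<close>, only finitely many
  \<open>j\<close> give an intersection of measure at least \<open>d'\<close>. One can then keep
  picking indices whose sets hardly overlap inside \<open>B\<close>; each adds at least
  \<open>d / 2\<close> to the measure of the union, which eventually exceeds 1.\<close>

lemma finitely_additive_recurrence:
  fixes m :: "'h set \<Rightarrow> real" and A :: "nat \<Rightarrow> 'h set"
  assumes add: "\<And>A B. A \<inter> B = {} \<Longrightarrow> m (A \<union> B) = m A + m B" and nn: "\<And>A. 0 \<le> m A"
    and bound: "\<And>A. m A \<le> 1"
    and I: "infinite I" and d: "d > 0" and low: "\<And>n. n \<in> I \<Longrightarrow> m (B \<inter> A n) \<ge> d"
  shows "\<exists>i\<in>I. \<exists>d'>0. infinite {j\<in>I. m (B \<inter> A i \<inter> A j) \<ge> d'}"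
proof (rule ccontr)
  assume neg: "\<not> ?thesis"
  then have fin: "finite {j\<in>I. m (B \<inter> A i \<inter> A j) \<ge> d'}" if "i \<in> I" "d' > 0" for i d' using that by blast
  have "\<exists>F. finite F \<and> F \<subseteq> I \<and> m (\<Union>i\<in>F. B \<inter> A i) \<ge> real N * d / 2" for N
  proof (induction N)
    case 0
    then show ?case using nn by (intro exI[of _ "{}"]) simp
  next
    case (Suc N)
    then obtain F where F: "finite F" "F \<subseteq> I" "m (\<Union>i\<in>F. B \<inter> A i) \<ge> real N * d / 2" by blast
    \<comment> \<open>The new set then meets the union of the \<open>card F\<close> chosen ones in
      measure at most \<open>d / 2\<close>; the summand 1 covers the empty \<open>F\<close>.\<close>
    define d' where "d' = d / (2 * (real (card F) + 1))"
    have d': "d' > 0" using d by (simp add: d'_def)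
    have "finite (\<Union>i\<in>F. {j\<in>I. m (B \<inter> A i \<inter> A j) \<ge> d'})" using F d' fin by blast
    then obtain j where j: "j \<in> I" "j \<notin> (\<Union>i\<in>F. {j\<in>I. m (B \<inter> A i \<inter> A j) \<ge> d'})"
      using I by (meson finite_subset subsetI)
    let ?U = "\<Union>i\<in>F. B \<inter> A i"
    have "m (B \<inter> A j) = m (B \<inter> A j - ?U) + m (\<Union>i\<in>F. B \<inter> A i \<inter> A j)"
      by (subst add[symmetric]) (auto intro: arg_cong[of _ _ m])
    moreover have "m (\<Union>i\<in>F. B \<inter> A i \<inter> A j) \<le> (\<Sum>i\<in>F. m (B \<inter> A i \<inter> A j))"
      by (rule finitely_additive_UN_le[OF add nn F(1)])
    moreover have "(\<Sum>i\<in>F. m (B \<inter> A i \<inter> A j)) \<le> (\<Sum>i\<in>F. d')"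
      using j by (intro sum_mono) auto
    moreover have "(\<Sum>i\<in>F. d') \<le> d / 2" using d by (simp add: d'_def field_simps)
    moreover have "m ((B \<inter> A j) \<union> ?U) = m (B \<inter> A j - ?U) + m ?U"
      by (subst add[symmetric]) (auto intro: arg_cong[of _ _ m])
    ultimately have "m ((B \<inter> A j) \<union> ?U) \<ge> d / 2 + real N * d / 2" using low[OF j(1)] F(3) by linarith
    then show ?case using F j by (intro exI[of _ "insert j F"]) (auto simp: field_simps)
  qed
  then have le: "real N * d / 2 \<le> 1" for N using bound order_trans by blast
  obtain N :: nat where "2 / d < real N" using reals_Archimedean2 by blast
  then show False using le[of N] d by (simp add: field_simps)
qed

text \<open>Finite additivity does not give a point in infinitely many sets, but it gives a subsequence
  with the finite intersection property, provided the measures are bounded below.\<close>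

lemma finitely_additive_subsequence:
  fixes m :: "'h set \<Rightarrow> real" and A :: "nat \<Rightarrow> 'h set"
  assumes add: "\<And>A B. A \<inter> B = {} \<Longrightarrow> m (A \<union> B) = m A + m B" and nn: "\<And>A. 0 \<le> m A"
    and bound: "\<And>A. m A \<le> 1"
    and d: "d > 0" and low: "\<And>n. m (A n) \<ge> d"
  obtains r :: "nat \<Rightarrow> nat" where "strict_mono r" "\<And>k. (\<Inter>l\<in>{..<k}. A (r l)) \<noteq> {}"
proof -
  \<comment> \<open>A state \<open>(B, I, i)\<close> holds the intersection formed so far, the
    indices still admissible and the index chosen last. The invariant keeps a positive lower bound
    common to all \<open>m (B \<inter> A n)\<close> with \<open>n\<close> in the infinite set
    \<open>I\<close>; the bound may shrink from one state to the next.\<close>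
  define good where "good = (\<lambda>(B, I, i::nat). infinite I \<and> (\<exists>d>0. \<forall>n\<in>I. m (B \<inter> A n) \<ge> d))"
  define step where "step = (\<lambda>(B, I, i :: nat) (B', I', i'). (i' :: nat) \<in> I \<and> B' = B \<inter> A i' \<and> I' \<subseteq> I \<inter> {i'<..})"
  have "\<exists>f. \<forall>n. good (f n) \<and> step (f n) (f (Suc n)) \<and> (n = 0 \<longrightarrow> fst (f n) = UNIV)"
  proof -
    have "\<exists>f. \<forall>n. (good (f n) \<and> (n = 0 \<longrightarrow> fst (f n) = UNIV)) \<and> step (f n) (f (Suc n))"
    proof (rule dependent_nat_choice)
      show "\<exists>x. good x \<and> (0 = 0 \<longrightarrow> fst x = UNIV)"
        by (rule exI[of _ "(UNIV, UNIV, 0)"]) (use d low in \<open>auto simp: good_def\<close>)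
    next
      fix x and n :: nat assume x: "good x \<and> (n = 0 \<longrightarrow> fst x = UNIV)"
      obtain B I i0 where xe: "x = (B, I, i0)" by (metis prod.exhaust)
      obtain d where Id: "infinite I" "d > 0" "\<And>n. n \<in> I \<Longrightarrow> m (B \<inter> A n) \<ge> d"
        using x by (auto simp: xe good_def)
      obtain i d' where i: "i \<in> I" "d' > 0" "infinite {j\<in>I. m (B \<inter> A i \<inter> A j) \<ge> d'}"
        using finitely_additive_recurrence[where m = m and A = A and B = B, OF _ nn bound Id] add by blast
      \<comment> \<open>Discarding the indices up to \<open>i\<close> makes the chosen subsequence
        strictly increasing.\<close>
      define J where "J = {j\<in>I. m (B \<inter> A i \<inter> A j) \<ge> d'} \<inter> {i<..}"
      have "infinite J"
      proof
        assume "finite J"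
        then have "finite (J \<union> {..i})" by simp
        moreover have "{j\<in>I. m (B \<inter> A i \<inter> A j) \<ge> d'} \<subseteq> J \<union> {..i}" by (auto simp: J_def)
        ultimately show False using i(3) finite_subset by blast
      qed
      then have "good (B \<inter> A i, J, i)" using i(2) by (auto simp: good_def J_def)
      moreover have "step x (B \<inter> A i, J, i)" using i by (auto simp: step_def xe J_def)
      ultimately show "\<exists>y. (good y \<and> (Suc n = 0 \<longrightarrow> fst y = UNIV)) \<and> step x y" by blast
    qed
    then show ?thesis by blast
  qed
  then obtain f where f: "\<And>n. good (f n)" "\<And>n. step (f n) (f (Suc n))" "fst (f 0) = UNIV" by blast
  define Bf where "Bf n = fst (f n)" for n
  define If where "If n = fst (snd (f n))" for n
  \<comment> \<open>The index chosen at stage \<open>n\<close> is recorded in state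
    \<open>n + 1\<close>; the 0 in the initial state is a dummy that \<open>r\<close> never
    reads.\<close>
  define r where "r n = snd (snd (f (Suc n)))" for n
  have fe: "f n = (Bf n, If n, snd (snd (f n)))" for n by (simp add: Bf_def If_def)
  have st: "r n \<in> If n" "Bf (Suc n) = Bf n \<inter> A (r n)" "If (Suc n) \<subseteq> If n \<inter> {r n<..}" for n
    using f(2)[of n] fe[of n] fe[of "Suc n"] by (auto simp: step_def r_def split: prod.splits)
  have "r n < r (Suc n)" for n using st(1)[of "Suc n"] st(3)[of n] by auto
  then have "strict_mono r" by (simp add: strict_mono_Suc_iff)
  moreover have Beq: "Bf k = (\<Inter>l\<in>{..<k}. A (r l))" for k
    by (induction k) (use f(3) st(2) in \<open>auto simp: Bf_def[of 0] lessThan_Suc\<close>)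
  moreover have "Bf k \<noteq> {}" for k
  proof
    assume e: "Bf k = {}"
    have "m {} = 0" using add[of "{}" "{}"] by simp
    moreover obtain d' where "d' > 0" "\<forall>n\<in>If k. m (Bf k \<inter> A n) \<ge> d'"
      using f(1)[of k] fe[of k] by (auto simp: good_def split: prod.splits)
    ultimately show False using e st(1)[of k] by force
  qed
  ultimately show ?thesis by (intro that[of r]) simp_all
qed


section \<open>Seminorms of the mixed topology\<close>

lemma linear_functional_iff:
  fixes smul :: "'k::real_or_complex \<Rightarrow> 'a::real_normed_vector \<Rightarrow> 'a" and f :: "'a \<Rightarrow> 'k"
  assumes "normed_space_over smul"
  shows "Vector_Spaces.linear smul (*) f \<longleftrightarrow>
    (\<forall>x y. f (x + y) = f x + f y) \<and> (\<forall>c x. f (smul c x) = c * f x)"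
proof -
  have "vector_space ((*) :: 'k \<Rightarrow> 'k \<Rightarrow> 'k)" by unfold_locales (simp_all add: algebra_simps)
  then show ?thesis using assms
    by (auto simp: Vector_Spaces.linear_def module_hom_def module_hom_axioms_def vector_space_def
        module_def normed_space_over_def)
qed

lemma linear_operator_iff:
  fixes smul :: "'k::real_or_complex \<Rightarrow> 'a::real_normed_vector \<Rightarrow> 'a"
  assumes "normed_space_over smul"
  shows "Vector_Spaces.linear smul smul f \<longleftrightarrow>
    (\<forall>x y. f (x + y) = f x + f y) \<and> (\<forall>c x. f (smul c x) = smul c (f x))"
  using assms
  by (auto simp: Vector_Spaces.linear_def module_hom_def module_hom_axioms_def vector_space_def
      module_def normed_space_over_def)

lemma linear_functional_real:
  fixes smul :: "'k::real_or_complex \<Rightarrow> 'a::real_normed_vector \<Rightarrow> 'a" and f :: "'a \<Rightarrow> 'k"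
  assumes ns: "normed_space_over smul" and f: "Vector_Spaces.linear smul (*) f"
  shows "linear f"
proof (rule linearI)
  note f' = f[unfolded linear_functional_iff[OF ns]]
  show "f (x + y) = f x + f y" for x y using f' by blast
  show "f (r *\<^sub>R x) = r *\<^sub>R f x" for r x
    using f' normed_space_overD(1)[OF ns, of r x] by (metis scaleR_conv_of_real)
qed

lemma linear_operator_real:
  fixes smul :: "'k::real_or_complex \<Rightarrow> 'a::real_normed_vector \<Rightarrow> 'a"
  assumes ns: "normed_space_over smul" and f: "Vector_Spaces.linear smul smul f"
  shows "linear f"
proof (rule linearI)
  note f' = f[unfolded linear_operator_iff[OF ns]]
  show "f (x + y) = f x + f y" for x y using f' by blast
  show "f (r *\<^sub>R x) = r *\<^sub>R f x" for r x
    using f' normed_space_overD(1)[OF ns] by metis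
qed

lemma openin_seminorm_ball:
  assumes "p \<in> P" "0 < r"
  shows "openin (seminorm_topology P) {y. p (y - x) < r}"
  unfolding seminorm_topology_def by (rule topology_generated_by_Basis) (use assms in blast)

lemma continuous_map_into_seminorm_topology:
  assumes "P \<noteq> {}" and zero: "\<And>p. p \<in> P \<Longrightarrow> p 0 = 0"
    and cont: "\<And>p x. p \<in> P \<Longrightarrow> continuous_map T euclideanreal (\<lambda>t. p (f t - x))"
  shows "continuous_map T (seminorm_topology P) f"
  unfolding seminorm_topology_def
proof (rule continuous_on_generated_topo)
  fix U assume "U \<in> {{y. p (y - x) < r} | p x r. p \<in> P \<and> 0 < r}"
  then obtain p x r where p: "p \<in> P" "0 < r" and U: "U = {y. p (y - x) < r}" by blast
  have "openin T {t \<in> topspace T. p (f t - x) \<in> {..<r}}"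
    using cont[OF p(1), of x] by (rule openin_continuous_map_preimage) auto
  moreover have "{t \<in> topspace T. p (f t - x) \<in> {..<r}} = f -` U \<inter> topspace T" by (auto simp: U)
  ultimately show "openin T (f -` U \<inter> topspace T)" by simp
next
  obtain p where p: "p \<in> P" using assms(1) by blast
  have "y \<in> \<Union>{{y. p (y - x) < r} | p x r. p \<in> P \<and> 0 < r}" for y
    by (rule UnionI[of "{z. p (z - y) < 1}"]) (use p zero[OF p] zero_less_one in \<open>simp, blast\<close>, simp add: zero[OF p])
  then show "f ` topspace T \<subseteq> \<Union>{{y. p (y - x) < r} | p x r. p \<in> P \<and> 0 < r}" by blast
qed

lemma topspace_seminorm_topology:
  assumes "P \<noteq> {}" and zero: "\<And>p. p \<in> P \<Longrightarrow> p 0 = 0"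
  shows "topspace (seminorm_topology P) = UNIV"
proof -
  have "continuous_map (discrete_topology UNIV) (seminorm_topology P) id"
    by (rule continuous_map_into_seminorm_topology) (use assms in auto)
  then show ?thesis by (auto simp: continuous_map_def)
qed

lemma finer_top_iff_continuous_id:
  assumes "topspace s = UNIV" "topspace r = UNIV"
  shows "finer_top s r \<longleftrightarrow> continuous_map s r id"
  using assms by (auto simp: finer_top_def continuous_map_def)

lemma seminorm_topology_nbhd:
  assumes dir: "directed_seminorms P" and sn: "\<And>p x y. p \<in> P \<Longrightarrow> p (x + y) \<le> p x + p y"
    and U: "openin (seminorm_topology P) U" "x \<in> U"
  obtains p r where "p \<in> P" "r > 0" "{y. p (y - x) < r} \<subseteq> U"
proof -
  have "generate_topology_on {{y. p (y - x) < r} | p x r. p \<in> P \<and> 0 < r} U"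
    using U(1) unfolding seminorm_topology_def by (rule openin_topology_generated_by)
  then have "\<forall>x\<in>U. \<exists>p\<in>P. \<exists>r>0. {y. p (y - x) < r} \<subseteq> U"
  proof induct
    case (Int a b)
    show ?case
    proof
      fix x assume x: "x \<in> a \<inter> b"
      obtain p r where p: "p \<in> P" "r > 0" "{y. p (y - x) < r} \<subseteq> a" using Int x by blast
      obtain q s where q: "q \<in> P" "s > 0" "{y. q (y - x) < s} \<subseteq> b" using Int x by blast
      obtain m C where m: "m \<in> P" "C \<ge> 0" "\<And>x. max (p x) (q x) \<le> C * m x"
        using dir p(1) q(1) unfolding directed_seminorms_def by blast
      \<comment> \<open>\<open>C + 1\<close> keeps the radius meaningful when \<open>C = 0\<close>.
        Only subadditivity of the members of \<open>P\<close> is assumed here, hence the separate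
        treatment of negative values of \<open>m\<close>.\<close>
      have "{y. m (y - x) < min r s / (C + 1)} \<subseteq> a \<inter> b"
      proof
        fix y assume "y \<in> {y. m (y - x) < min r s / (C + 1)}"
        then have "(C + 1) * m (y - x) < min r s" using m(2) by (simp add: field_simps)
        moreover have "C * m (y - x) \<le> (C + 1) * m (y - x) \<or> m (y - x) < 0"
          by (simp add: algebra_simps) linarith
        moreover have "C * m (y - x) \<le> 0" if "m (y - x) < 0" using that m(2) by (simp add: mult_nonneg_nonpos)
        ultimately have "C * m (y - x) < min r s" using p(2) q(2) by fastforce
        then have "p (y - x) < r" "q (y - x) < s" using m(3)[of "y - x"] by auto
        then show "y \<in> a \<inter> b" using p q by blast
      qed
      then show "\<exists>p\<in>P. \<exists>r>0. {y. p (y - x) < r} \<subseteq> a \<inter> b"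
        using m p(2) q(2) by (intro bexI[of _ m] exI[of _ "min r s / (C + 1)"]) auto
    qed
  next
    case (UN K)
    then show ?case by (meson Sup_upper UnionE order_trans)
  next
    case (Basis s)
    then obtain p a r where p: "p \<in> P" "0 < r" and s: "s = {y. p (y - a) < r}" by blast
    show ?case
    proof
      fix x assume "x \<in> s"
      then have "p (x - a) < r" by (simp add: s)
      moreover have "p (y - a) \<le> p (y - x) + p (x - a)" for y using sn[OF p(1), of "y - x" "x - a"] by simp
      ultimately have "{y. p (y - x) < r - p (x - a)} \<subseteq> s" "r - p (x - a) > 0"
        by (auto simp: s) (smt (verit, best))
      then show "\<exists>p\<in>P. \<exists>r>0. {y. p (y - x) < r} \<subseteq> s" using p(1) by blast
    qed
  qed simp
  then show ?thesis using U(2) that by blast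
qed

lemma continuous_map_seminorm:
  fixes T :: "'a::ab_group_add topology"
  assumes sn: "\<And>x y. \<bar>p x - p y\<bar> \<le> p (x - y)" and zero: "p 0 = (0 :: real)"
    and op: "\<And>x r. r > 0 \<Longrightarrow> openin T {y. p (y - x) < r}"
  shows "continuous_map T euclideanreal (\<lambda>y. p (y - a))"
  unfolding continuous_map_def
proof (intro conjI allI impI)
  fix U :: "real set" assume "openin euclideanreal U"
  then have U: "open U" by simp
  show "openin T {x \<in> topspace T. p (x - a) \<in> U}"
    unfolding openin_subopen[of T "{x \<in> topspace T. p (x - a) \<in> U}"]
  proof
    fix x assume x: "x \<in> {x \<in> topspace T. p (x - a) \<in> U}"
    then obtain e where e: "e > 0" "ball (p (x - a)) e \<subseteq> U" using U by (auto simp: open_contains_ball)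
    have "p (y - a) \<in> U" if "p (y - x) < e" for y
      using that sn[of "y - a" "x - a"] e(2) by (auto simp: dist_real_def abs_minus_commute intro!: subsetD[OF e(2)])
    then show "\<exists>V. openin T V \<and> x \<in> V \<and> V \<subseteq> {x \<in> topspace T. p (x - a) \<in> U}"
      using op[OF e(1), of x] zero e(1) openin_subset[OF op[OF e(1), of x]]
      by (intro exI[of _ "{y. p (y - x) < e}"]) auto
  qed
qed auto

locale mixed_space =
  fixes smul :: "'k::real_or_complex \<Rightarrow> 'a::real_normed_vector \<Rightarrow> 'a"
    and \<tau> \<gamma> :: "'a topology" and P :: "('a \<Rightarrow> real) set"
  assumes saks: "saks_space smul \<tau> P" and mixed: "is_mixed_topology smul \<tau> \<gamma>"
begin

lemma ns: "normed_space_over smul"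
  using saks by (simp add: saks_space_def)

lemmas smul_simps = normed_space_overD[OF ns]
lemmas sn_add = seminormD(1)
lemmas sn_smul = seminormD(2)
lemmas sn_scaleR = seminorm_normedD(1)[OF ns]
lemmas sn_zero = seminorm_normedD(2)[OF ns]
lemmas sn_nonneg = seminorm_normedD(4)[OF ns]
lemmas sn_diff = seminorm_normedD(5)[OF ns]
lemmas sn_commute = seminorm_normedD(6)[OF ns]
lemmas sn_abs = seminorm_normedD(7)[OF ns]

lemma P_seminorm: "p \<in> P \<Longrightarrow> seminorm smul p"
  using saks by (simp add: saks_space_def)

lemma P_directed: "directed_seminorms P"
  using saks by (simp add: saks_space_def)

lemma P_nonempty: "P \<noteq> {}"
  using P_directed by (simp add: directed_seminorms_def)

lemma tau_eq: "\<tau> = seminorm_topology P"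
  using saks by (simp add: saks_space_def)

lemma P_le_norm: "p \<in> P \<Longrightarrow> p x \<le> norm x"
  using saks by (auto simp: saks_space_def intro: cSUP_upper)

lemma norm_le_if_P: "(\<And>p. p \<in> P \<Longrightarrow> p x \<le> c) \<Longrightarrow> norm x \<le> c"
  using saks P_nonempty by (auto simp: saks_space_def intro: cSUP_least)

lemma linear_gamma: "linear_topology smul \<gamma>"
  using mixed by (simp add: is_mixed_topology_def mixed_candidate_def)

lemma topspace_gamma [simp]: "topspace \<gamma> = UNIV"
  using linear_gamma by (simp add: linear_topology_def)

lemma topspace_tau [simp]: "topspace \<tau> = UNIV"
  unfolding tau_eq by (intro topspace_seminorm_topology P_nonempty) (simp add: sn_zero P_seminorm)

lemma tau_nbhd:
  assumes "openin \<tau> U" "x \<in> U"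
  obtains p r where "p \<in> P" "r > 0" "\<And>y. p (y - x) < r \<Longrightarrow> y \<in> U"
proof -
  have "openin (seminorm_topology P) U" using assms(1) tau_eq by simp
  then obtain p r where "p \<in> P" "r > 0" "{y. p (y - x) < r} \<subseteq> U"
    using seminorm_topology_nbhd[of P U x thesis] P_directed sn_add[OF P_seminorm] assms(2) by blast
  then show ?thesis by (intro that[of p r]) auto
qed

lemma openin_gamma_if_tau: "openin \<tau> U \<Longrightarrow> openin \<gamma> U"
  using mixed by (simp add: is_mixed_topology_def mixed_candidate_def finer_top_def)

lemma open_if_gamma: "openin \<gamma> U \<Longrightarrow> open U"
  using mixed by (simp add: is_mixed_topology_def mixed_candidate_def finer_top_def)

section \<open>Tight seminorms: closure properties and continuity\<close>

definition tight :: "('a \<Rightarrow> real) \<Rightarrow> bool" where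
  "tight p \<longleftrightarrow> seminorm smul p \<and> (\<forall>\<epsilon>>0. \<exists>q\<in>P. \<exists>K\<ge>0. \<forall>x. p x \<le> K * q x + \<epsilon> * norm x)"

lemma tight_seminorm: "tight p \<Longrightarrow> seminorm smul p"
  by (simp add: tight_def)

lemma tightE:
  assumes "tight p" "\<epsilon> > 0"
  obtains q K where "q \<in> P" "K \<ge> 0" "\<And>x. p x \<le> K * q x + \<epsilon> * norm x"
  using assms by (auto simp: tight_def)

lemma tight_bound:
  assumes "tight p"
  obtains C where "C \<ge> 0" "\<And>x. p x \<le> C * norm x"
proof -
  obtain q K where q: "q \<in> P" "K \<ge> 0" "\<And>x. p x \<le> K * q x + 1 * norm x"
    using tightE[OF assms, of 1] by auto
  have "p x \<le> (K + 1) * norm x" for x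
    using q(3)[of x] mult_left_mono[OF P_le_norm[OF q(1)] q(2), of x] by (simp add: algebra_simps)
  then show ?thesis using q(2) by (intro that[of "K + 1"]) auto
qed

lemma tight_P: "p \<in> P \<Longrightarrow> tight p"
  unfolding tight_def by (intro conjI allI impI bexI[of _ p] exI[of _ 1]) (auto simp: P_seminorm)

text \<open>Half of \<epsilon> goes into the approximation and half into the tightness of
  \<open>q\<close>. Suprema, which need not be dominated by a single obvious tight seminorm, are
  handled through this criterion.\<close>

lemma tight_approx:
  assumes p: "seminorm smul p" and approx: "\<And>\<epsilon>. \<epsilon> > 0 \<Longrightarrow> \<exists>q. tight q \<and> (\<forall>x. p x \<le> q x + \<epsilon> * norm x)"
  shows "tight p"
  unfolding tight_def
proof (intro conjI p allI impI)
  fix \<epsilon> :: real assume e: "\<epsilon> > 0"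
  obtain q where q: "tight q" "\<And>x. p x \<le> q x + \<epsilon> / 2 * norm x" using approx[of "\<epsilon> / 2"] e by auto
  obtain r K where r: "r \<in> P" "K \<ge> 0" "\<And>x. q x \<le> K * r x + \<epsilon> / 2 * norm x"
    using tightE[OF q(1), of "\<epsilon> / 2"] e by auto
  have "p x \<le> K * r x + \<epsilon> * norm x" for x using q(2)[of x] r(3)[of x] by (simp add: field_simps)
  then show "\<exists>q\<in>P. \<exists>K\<ge>0. \<forall>x. p x \<le> K * q x + \<epsilon> * norm x" using r by blast
qed

lemma tight_le: "tight q \<Longrightarrow> seminorm smul p \<Longrightarrow> (\<And>x. p x \<le> q x) \<Longrightarrow> tight p"
  by (rule tight_approx) (auto intro!: exI[of _ q] add_increasing2)

lemma tight_scale: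
  assumes "tight p" "c \<ge> 0"
  shows "tight (\<lambda>x. c * p x)"
  unfolding tight_def
proof (intro conjI allI impI)
  show "seminorm smul (\<lambda>x. c * p x)"
    using tight_seminorm[OF assms(1)] assms(2)
    by (auto simp: seminorm_def distrib_left[symmetric] intro!: mult_left_mono)
  fix \<epsilon> :: real assume e: "\<epsilon> > 0"
  have e': "\<epsilon> / (c + 1) > 0" using e assms(2) by simp
  obtain r K where r: "r \<in> P" "K \<ge> 0" "\<And>x. p x \<le> K * r x + \<epsilon> / (c + 1) * norm x"
    using tightE[OF assms(1) e'] by auto
  have "c * p x \<le> (c * K) * r x + \<epsilon> * norm x" for x
  proof -
    have "c * p x \<le> c * (K * r x + \<epsilon> / (c + 1) * norm x)" using r(3) assms(2) by (rule mult_left_mono)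
    also have "\<dots> = (c * K) * r x + (c / (c + 1)) * (\<epsilon> * norm x)" by (simp add: algebra_simps)
    also have "(c / (c + 1)) * (\<epsilon> * norm x) \<le> 1 * (\<epsilon> * norm x)"
      using assms(2) e by (intro mult_right_mono) auto
    finally show ?thesis by simp
  qed
  then show "\<exists>q\<in>P. \<exists>K\<ge>0. \<forall>x. c * p x \<le> K * q x + \<epsilon> * norm x" using r assms(2)
    by (intro bexI[of _ r] exI[of _ "c * K"]) auto
qed

lemma tight_add:
  assumes "tight p" "tight q"
  shows "tight (\<lambda>x. p x + q x)"
  unfolding tight_def
proof (intro conjI allI impI)
  show "seminorm smul (\<lambda>x. p x + q x)"
    unfolding seminorm_def
    using sn_add[OF tight_seminorm[OF assms(1)]] sn_add[OF tight_seminorm[OF assms(2)]]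
      sn_smul[OF tight_seminorm[OF assms(1)]] sn_smul[OF tight_seminorm[OF assms(2)]]
    by (simp add: distrib_left) (metis add.assoc add.left_commute add_mono)
  fix \<epsilon> :: real assume e: "\<epsilon> > 0"
  obtain r K where r: "r \<in> P" "K \<ge> 0" "\<And>x. p x \<le> K * r x + \<epsilon> / 2 * norm x"
    using tightE[OF assms(1), of "\<epsilon> / 2"] e by auto
  obtain s L where s: "s \<in> P" "L \<ge> 0" "\<And>x. q x \<le> L * s x + \<epsilon> / 2 * norm x"
    using tightE[OF assms(2), of "\<epsilon> / 2"] e by auto
  obtain m C where m: "m \<in> P" "C \<ge> 0" "\<And>x. max (r x) (s x) \<le> C * m x"
    using P_directed r(1) s(1) unfolding directed_seminorms_def by blast
  have "p x + q x \<le> ((K + L) * C) * m x + \<epsilon> * norm x" for x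
  proof -
    have "K * r x \<le> K * (C * m x)" "L * s x \<le> L * (C * m x)"
      using r(2) s(2) m(3)[of x] by (auto intro!: mult_left_mono)
    then show ?thesis using r(3)[of x] s(3)[of x] by (simp add: algebra_simps)
  qed
  then show "\<exists>qa\<in>P. \<exists>K\<ge>0. \<forall>x. p x + q x \<le> K * qa x + \<epsilon> * norm x"
    using m r(2) s(2) by (intro bexI[of _ m] exI[of _ "(K + L) * C"]) auto
qed

lemma tight_zero: "tight (\<lambda>x. 0)"
proof -
  obtain p where "p \<in> P" using P_nonempty by blast
  then show ?thesis using tight_scale[OF tight_P, of p 0] by simp
qed

lemma tight_sum: "(\<And>n. tight (p n)) \<Longrightarrow> tight (\<lambda>x. \<Sum>n<(N::nat). p n x)"
  by (induction N) (auto simp: tight_zero intro: tight_add)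

text \<open>On a set bounded by \<open>b\<close>, differences have norm at most \<open>2 b\<close>.
  Tightness with error \<open>d / (4 b)\<close> therefore spends at most \<open>d / 2\<close> on the
  norm term and leaves the other half to a \<tau>-ball of \<open>q\<close>.\<close>

lemma openin_bounded_tight_ball:
  assumes p: "tight p" and B: "bounded B" and r: "r > 0"
  shows "openin (subtopology \<tau> B) ({y. p (y - x) < r} \<inter> B)"
  unfolding openin_subopen[of _ "{y. p (y - x) < r} \<inter> B"]
proof
  fix z assume z: "z \<in> {y. p (y - x) < r} \<inter> B"
  note sn = tight_seminorm[OF p]
  obtain b where b: "b > 0" "\<And>y. y \<in> B \<Longrightarrow> norm y \<le> b" using B by (auto simp: bounded_pos)
  define d where "d = r - p (z - x)"
  have d: "d > 0" using z by (simp add: d_def)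
  obtain q K where q: "q \<in> P" "K \<ge> 0" "\<And>x. p x \<le> K * q x + d / (4 * b) * norm x"
    using tightE[OF p, of "d / (4 * b)"] d b(1) by auto
  define V where "V = {y. q (y - z) < d / (2 * (K + 1))}"
  have "openin \<tau> V" unfolding tau_eq V_def using q d by (intro openin_seminorm_ball) auto
  moreover have "z \<in> V" using q(2) d sn_zero[OF P_seminorm[OF q(1)]] by (simp add: V_def)
  moreover have "V \<inter> B \<subseteq> {y. p (y - x) < r}"
  proof
    fix y assume y: "y \<in> V \<inter> B"
    have "norm (y - z) \<le> 2 * b" using norm_triangle_ineq4[of y z] b(2)[of y] b(2)[of z] y z by auto
    then have "d / (4 * b) * norm (y - z) \<le> d / (4 * b) * (2 * b)" using b(1) d by (intro mult_left_mono) auto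
    then have 1: "d / (4 * b) * norm (y - z) \<le> d / 2" using b(1) by simp
    have "(K + 1) * q (y - z) < d / 2" using y q(2) by (simp add: V_def field_simps)
    then have "K * q (y - z) < d / 2" using sn_nonneg[OF P_seminorm[OF q(1)], of "y - z"] by (simp add: algebra_simps)
    then have "p (y - z) < d" using 1 q(3)[of "y - z"] by simp
    then show "y \<in> {y. p (y - x) < r}" using sn_add[OF sn, of "y - z" "z - x"] by (simp add: d_def)
  qed
  ultimately show "\<exists>T. openin (subtopology \<tau> B) T \<and> z \<in> T \<and> T \<subseteq> {y. p (y - x) < r} \<inter> B"
    using z by (intro exI[of _ "V \<inter> B"]) (auto simp: openin_subtopology_Int)
qed

lemma gamma_continuous_if_tight:
  assumes p: "tight p"
  shows "p \<in> continuous_seminorms smul \<gamma>"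
proof -
  note sn = tight_seminorm[OF p]
  let ?Q = "insert p P" and ?s = "seminorm_topology (insert p P)"
  have Qt: "tight q" if "q \<in> ?Q" for q using that p tight_P by auto
  have Qsn: "seminorm smul q" if "q \<in> ?Q" for q using tight_seminorm[OF Qt[OF that]] .
  have top: "topspace ?s = UNIV" by (intro topspace_seminorm_topology) (auto simp: sn_zero[OF Qsn])
  have tau: "finer_top ?s \<tau>"
    unfolding finer_top_iff_continuous_id[OF top topspace_tau] unfolding tau_eq
  proof (rule continuous_map_into_seminorm_topology[OF P_nonempty])
    fix q x assume "q \<in> P"
    then show "continuous_map ?s euclideanreal (\<lambda>t. q (id t - x))"
      using continuous_map_seminorm[of q ?s x] sn_abs[OF P_seminorm] sn_zero[OF P_seminorm]
          openin_seminorm_ball[of q ?Q] by simp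
  qed (simp add: sn_zero P_seminorm)
  have "mixed_candidate smul \<tau> ?s"
    unfolding mixed_candidate_def
  proof (intro conjI allI impI tau)
    show "linear_topology smul ?s"
      using ns Qsn by (intro linear_topology_seminorm_topology) (auto simp: normed_space_over_def)
    show "finer_top euclidean ?s"
      unfolding finer_top_iff_continuous_id[OF topspace_euclidean top]
    proof (rule continuous_map_into_seminorm_topology)
      fix q x assume q: "q \<in> ?Q"
      obtain C where C: "C \<ge> 0" "\<And>x. q x \<le> C * norm x" by (rule tight_bound[OF Qt[OF q]]) blast
      have "C-lipschitz_on UNIV (\<lambda>t. q (t - x))"
      proof (rule lipschitz_onI)
        fix s t :: 'a
        have "\<bar>q (s - x) - q (t - x)\<bar> \<le> q (s - t)" using sn_abs[OF Qsn[OF q], of "s - x" "t - x"] by simp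
        then show "dist (q (s - x)) (q (t - x)) \<le> C * dist s t"
          using C(2)[of "s - t"] by (simp add: dist_norm)
      qed (rule C)
      then show "continuous_map euclidean euclideanreal (\<lambda>t. q (id t - x))"
        using lipschitz_on_continuous_on by auto
    qed (auto simp: sn_zero[OF Qsn])
    fix B :: "'a set" assume B: "bounded B"
    \<comment> \<open>Agreement with \<tau> on bounded sets is the delicate requirement after
      adjoining \<open>p\<close>; it holds because balls of tight seminorms are relatively
      \<tau>-open there.\<close>
    have "continuous_map (subtopology \<tau> B) ?s id"
      unfolding seminorm_topology_def
    proof (rule continuous_on_generated_topo)
      fix U assume "U \<in> {{y. p (y - x) < r} | p x r. p \<in> ?Q \<and> 0 < r}"
      then obtain q a r where q: "q \<in> ?Q" "0 < r" and U: "U = {y. q (y - a) < r}" by blast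
      show "openin (subtopology \<tau> B) (id -` U \<inter> topspace (subtopology \<tau> B))"
        using openin_bounded_tight_ball[OF Qt[OF q(1)] B q(2), of a] by (simp add: U)
    qed (use top in \<open>simp add: seminorm_topology_def topology_generated_by_topspace\<close>)
    then have "openin (subtopology \<tau> B) (U \<inter> B)" if "openin ?s U" for U
      using openin_continuous_map_preimage[of "subtopology \<tau> B" ?s id U] that
      by (simp add: Int_def conj_commute)
    then have "openin (subtopology \<tau> B) V" if "openin (subtopology ?s B) V" for V
      using that by (auto simp: openin_subtopology)
    moreover have "openin (subtopology ?s B) V" if "openin (subtopology \<tau> B) V" for V
      using that tau by (auto simp: openin_subtopology finer_top_def)
    ultimately show "subtopology ?s B = subtopology \<tau> B" unfolding topology_eq by blast
  qed
  then have "finer_top \<gamma> ?s" using mixed by (simp add: is_mixed_topology_def)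
  then have op: "openin \<gamma> {y. p (y - x) < r}" if "r > 0" for x r
    using openin_seminorm_ball[of p ?Q r x] that by (simp add: finer_top_def)
  have "continuous_map \<gamma> euclideanreal (\<lambda>y. p (y - 0))"
    using continuous_map_seminorm[of p \<gamma> 0, OF sn_abs[OF sn] sn_zero[OF sn] op] .
  then show ?thesis using sn by (simp add: continuous_seminorms_def)
qed

section \<open>Local convexity of the mixed topology\<close>

lemma openin_gamma_translate:
  assumes "openin \<gamma> U"
  shows "openin \<gamma> {y. x + y \<in> U}"
proof -
  have add: "continuous_map (prod_topology \<gamma> \<gamma>) \<gamma> (\<lambda>(x, y). x + y)"
    using linear_gamma by (simp add: linear_topology_def)
  have "continuous_map \<gamma> (prod_topology \<gamma> \<gamma>) (\<lambda>y. (x, y))"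
    by (intro continuous_map_pairedI) auto
  from continuous_map_compose[OF this add] have "continuous_map \<gamma> \<gamma> (\<lambda>y. x + y)"
    by (simp add: o_def)
  then show ?thesis using assms by (auto simp: continuous_map_def)
qed

text \<open>Within the unit ball, \<open>U\<close> contains a \<tau>-ball of some \<open>q\<close>
  of radius \<open>r\<close>. If \<open>q x < r * norm x\<close>, the normalised vector lies in
  \<open>U\<close>, so \<open>p x\<close> is below \<open>\<epsilon> * norm x\<close>; otherwise the
  norm is at most \<open>q x / r\<close>, and the norm bound \<open>C\<close> of \<open>p\<close>
  produces the term \<open>(C / r) * q x\<close>.\<close>

lemma tight_if_small_on_gamma_nbhds:
  assumes sn: "seminorm smul p" and small: "\<And>\<epsilon>. \<epsilon> > 0 \<Longrightarrow> \<exists>U. openin \<gamma> U \<and> 0 \<in> U \<and> (\<forall>x\<in>U. p x < \<epsilon>)"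
  shows "tight p"
  unfolding tight_def
proof (intro conjI sn allI impI)
  fix \<epsilon> :: real assume e: "\<epsilon> > 0"
  obtain U where U: "openin \<gamma> U" "0 \<in> U" "\<And>x. x \<in> U \<Longrightarrow> p x < \<epsilon>" using small[OF e] by blast
  let ?B = "cball (0::'a) 1"
  have eq: "subtopology \<gamma> ?B = subtopology \<tau> ?B"
    using mixed by (simp add: is_mixed_topology_def mixed_candidate_def)
  have "openin (subtopology \<tau> ?B) (U \<inter> ?B)"
    unfolding eq[symmetric] using U(1) by (rule openin_subtopology_Int)
  then obtain V where V: "openin \<tau> V" "U \<inter> ?B = V \<inter> ?B" by (auto simp: openin_subtopology)
  have "0 \<in> V \<inter> ?B" unfolding V(2)[symmetric] using U(2) by simp
  then have "0 \<in> V" by (rule IntD1)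
  obtain q r where q: "q \<in> P" "r > 0" "\<And>y. q (y - 0) < r \<Longrightarrow> y \<in> V"
    by (rule tau_nbhd[OF V(1) \<open>0 \<in> V\<close>]) (rule that; assumption)
  obtain d where d: "d > 0" "ball 0 d \<subseteq> U" using open_if_gamma[OF U(1)] U(2) by (meson open_contains_ball)
  \<comment> \<open>A nonzero vector is scaled to norm \<open>d / 2\<close>, which lies safely in
    the norm ball of radius \<open>d\<close> inside \<open>U\<close>; hence the factor 2.\<close>
  define C where "C = 2 * \<epsilon> / d"
  have C: "p x \<le> C * norm x" for x
  proof (cases "x = 0")
    case False
    have "(d / (2 * norm x)) *\<^sub>R x \<in> U" using d False by (intro subsetD[OF d(2)]) simp
    then have "p ((d / (2 * norm x)) *\<^sub>R x) < \<epsilon>" by (rule U(3))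
    then show ?thesis using False d(1) by (simp add: sn_scaleR[OF sn] C_def field_simps)
  qed (simp add: sn_zero[OF sn])
  have "C \<ge> 0" using e d by (simp add: C_def)
  have "p x \<le> (C / r) * q x + \<epsilon> * norm x" for x
  proof (cases "x = 0")
    case False
    note q0 = sn_nonneg[OF P_seminorm[OF q(1)], of x]
    show ?thesis
    proof (cases "q x < r * norm x")
      case True
      let ?z = "(1 / norm x) *\<^sub>R x"
      have "q ?z < r" using True False by (simp add: sn_scaleR[OF P_seminorm[OF q(1)]] field_simps)
      then have "?z \<in> V \<inter> ?B" using q(3) False by auto
      then have "p ?z < \<epsilon>" using U(3) V(2) by blast
      then have "p x < \<epsilon> * norm x" using False by (simp add: sn_scaleR[OF sn] field_simps)
      moreover have "0 \<le> (C / r) * q x" using q0 q(2) \<open>C \<ge> 0\<close> by simp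
      ultimately show ?thesis by simp
    next
      case False
      have "p x \<le> C * norm x" by (rule C)
      also have "\<dots> \<le> C * (q x / r)" using False q(2) \<open>C \<ge> 0\<close> by (intro mult_left_mono) (auto simp: field_simps)
      finally show ?thesis using e by (simp add: add_increasing2)
    qed
  qed (simp add: sn_zero[OF sn] sn_zero[OF P_seminorm[OF q(1)]])
  then show "\<exists>q\<in>P. \<exists>K\<ge>0. \<forall>x. p x \<le> K * q x + \<epsilon> * norm x"
    using q \<open>C \<ge> 0\<close> by (intro bexI[of _ q] exI[of _ "C / r"]) auto
qed

text \<open>The estimates \<open>p \<le> K q + \<epsilon> \<parallel>\<cdot>\<parallel>\<close> express continuity at \<open>0\<close> for \<open>\<tau>\<close> on the unit ball.\<close>

lemma continuous_seminorm_iff_tight: "p \<in> continuous_seminorms smul \<gamma> \<longleftrightarrow> tight p"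
proof
  assume p: "p \<in> continuous_seminorms smul \<gamma>"
  then have sn: "seminorm smul p" and c: "continuous_map \<gamma> euclideanreal p"
    by (auto simp: continuous_seminorms_def)
  have "openin \<gamma> {x. p x < e}" for e
    using openin_continuous_map_preimage[OF c, of "{..<e}"] by simp
  then show "tight p"
    using sn_zero[OF sn] by (intro tight_if_small_on_gamma_nbhds sn) (metis mem_Collect_eq)
qed (rule gamma_continuous_if_tight)

lemma openin_gamma_ball:
  assumes "tight p" "r > 0"
  shows "openin \<gamma> {y. p (y - x) < r}"
proof -
  have "continuous_map \<gamma> euclideanreal p"
    using assms(1) by (simp add: continuous_seminorm_iff_tight[symmetric] continuous_seminorms_def)
  then have "openin \<gamma> {y. p y < r}" using openin_continuous_map_preimage[of \<gamma> euclideanreal p "{..<r}"] by simp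
  from openin_gamma_translate[OF this, of "- x"] show ?thesis by simp
qed

lemma gamma_nbhd_halve:
  assumes "openin \<gamma> U" "0 \<in> U"
  shows "\<exists>V. openin \<gamma> V \<and> 0 \<in> V \<and> (\<forall>x\<in>V. \<forall>y\<in>V. x + y \<in> U)"
proof -
  have add: "continuous_map (prod_topology \<gamma> \<gamma>) \<gamma> (\<lambda>(x, y). x + y)"
    using linear_gamma by (simp add: linear_topology_def)
  have "openin (prod_topology \<gamma> \<gamma>) {z. (case z of (x, y) \<Rightarrow> x + y) \<in> U}"
    using openin_continuous_map_preimage[OF add assms(1)] by simp
  then obtain V W where "openin \<gamma> V" "openin \<gamma> W" "0 \<in> V" "0 \<in> W"
    "V \<times> W \<subseteq> {z. (case z of (x, y) \<Rightarrow> x + y) \<in> U}"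
    using assms(2) unfolding openin_prod_topology_alt by (auto dest!: spec[of _ 0])
  then show ?thesis by (intro exI[of _ "V \<inter> W"]) auto
qed

text \<open>Inside a given neighbourhood, the inf-convolution of seminorms
  \<open>c\<^sub>k q\<^sub>k + \<parallel>\<cdot>\<parallel> / (k + 1)\<close> has a unit ball built from a sum of neighbourhoods.\<close>

lemma gamma_locally_convex_0:
  assumes U: "openin \<gamma> U" "0 \<in> U"
  shows "\<exists>p. tight p \<and> {y. p y < 1} \<subseteq> U"
proof -
  \<comment> \<open>A string of neighbourhoods with \<open>G (n + 1) + G (n + 1)\<close> inside
    \<open>G n\<close>. Sums of any length with \<open>k\<close>-th term in \<open>G (k + 1)\<close>
    then stay in \<open>U\<close>; the remainder \<open>z\<close> in \<open>G n\<close> is what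
    makes the induction for \<open>sumG\<close> work.\<close>
  have "\<exists>G. \<forall>n. (openin \<gamma> (G n) \<and> 0 \<in> G n \<and> (n = 0 \<longrightarrow> G n = U)) \<and>
      (\<forall>x\<in>G (Suc n). \<forall>y\<in>G (Suc n). x + y \<in> G n)"
    by (rule dependent_nat_choice) (use U gamma_nbhd_halve in auto)
  then obtain G where G: "\<And>n. openin \<gamma> (G n)" "\<And>n. 0 \<in> G n" "G 0 = U"
    "\<And>n x y. x \<in> G (Suc n) \<Longrightarrow> y \<in> G (Suc n) \<Longrightarrow> x + y \<in> G n" by metis
  have sumG: "(\<Sum>k<n. f k) + z \<in> U" if "\<And>k. k < n \<Longrightarrow> f k \<in> G (Suc k)" "z \<in> G n" for n :: nat and f z
    using that
  proof (induction n arbitrary: z)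
    case 0
    then show ?case by (simp add: G(3))
  next
    case (Suc n)
    then have "f n + z \<in> G n" by (intro G(4)) auto
    then have "(\<Sum>k<n. f k) + (f n + z) \<in> U" using Suc by auto
    then show ?case by (simp add: add.assoc)
  qed
  \<comment> \<open>The term \<open>norm x / (k + 1)\<close> confines \<open>x\<close> to the ball
    of radius \<open>k + 1\<close>, where \<gamma> and \<tau> agree, and \<open>c = 1 / r\<close>
    puts it into the \<tau>-neighbourhood found there.\<close>
  have "\<exists>q\<in>P. \<exists>c\<ge>0. \<forall>x. q x * c + norm x / real (k + 1) < 1 \<longrightarrow> x \<in> G (Suc k)" for k
  proof -
    let ?B = "cball (0::'a) (real (k + 1))"
    have eq: "subtopology \<gamma> ?B = subtopology \<tau> ?B"
      using mixed by (simp add: is_mixed_topology_def mixed_candidate_def)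
    have "openin (subtopology \<tau> ?B) (G (Suc k) \<inter> ?B)"
      unfolding eq[symmetric] using G(1) by (rule openin_subtopology_Int)
    then obtain V where V: "openin \<tau> V" "G (Suc k) \<inter> ?B = V \<inter> ?B" by (auto simp: openin_subtopology)
    have "0 \<in> V \<inter> ?B" unfolding V(2)[symmetric] using G(2)[of "Suc k"] by simp
    then have "0 \<in> V" by (rule IntD1)
    obtain q r where q: "q \<in> P" "r > 0" "\<And>y. q (y - 0) < r \<Longrightarrow> y \<in> V"
      by (rule tau_nbhd[OF V(1) \<open>0 \<in> V\<close>]) (rule that; assumption)
    have "x \<in> G (Suc k)" if "q x * (1 / r) + norm x / real (k + 1) < 1" for x
    proof -
      have "norm x / real (k + 1) \<ge> 0" "q x * (1 / r) \<ge> 0"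
        using sn_nonneg[OF P_seminorm[OF q(1)], of x] q(2) by auto
      then have "q x * (1 / r) < 1" "norm x / real (k + 1) < 1" using that by linarith+
      then have "q x < r" "norm x \<le> real (k + 1)" using q(2) by (auto simp: field_simps)
      then have "x \<in> V \<inter> ?B" using q(3) by auto
      then show ?thesis using V(2) by blast
    qed
    then show ?thesis using q by (intro bexI[of _ q] exI[of _ "1 / r"]) auto
  qed
  then obtain q c where q: "\<And>k. q k \<in> P" "\<And>k. c k \<ge> 0"
    "\<And>k x. q k x * c k + norm x / real (k + 1) < 1 \<Longrightarrow> x \<in> G (Suc k)" by metis
  define w where "w = (\<lambda>k x. q k x * c k + norm x / real (k + 1))"
  note qs = P_seminorm[OF q(1)]
  have wnn: "0 \<le> w k x" for k x using sn_nonneg[OF qs] q(2) by (simp add: w_def)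
  have wz: "w k 0 = 0" for k using sn_zero[OF qs] by (simp add: w_def)
  have wadd: "w k (x + y) \<le> w k x + w k y" for k x y
  proof -
    have "q k (x + y) * c k \<le> (q k x + q k y) * c k" using sn_add[OF qs] q(2) by (rule mult_right_mono)
    moreover have "norm (x + y) / real (k + 1) \<le> (norm x + norm y) / real (k + 1)"
      by (intro divide_right_mono norm_triangle_ineq) simp
    ultimately show ?thesis by (simp add: w_def algebra_simps add_divide_distrib)
  qed
  have wsm: "w k (smul a x) = norm a * w k x" for k a x
    by (simp add: w_def sn_smul[OF qs] smul_simps algebra_simps)
  \<comment> \<open>Finite decompositions of \<open>x\<close>. The sequence vanishes from
    \<open>n\<close> on, so that two decompositions can be padded to a common length without
    changing their sums or costs.\<close>
  define A where "A = (\<lambda>x. {(n :: nat, f :: nat \<Rightarrow> 'a). (\<forall>k\<ge>n. f k = 0) \<and> (\<Sum>k<n. f k) = x})"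
  define cost where "cost = (\<lambda>(n, f). \<Sum>k<n. w k (f k) :: real)"
  define p where "p x = (INF a\<in>A x. cost a)" for x
  have costnn: "0 \<le> cost a" for a by (auto simp: cost_def intro!: sum_nonneg wnn split: prod.split)
  have bdd: "bdd_below (cost ` A x)" for x by (rule bdd_belowI2[where m = 0]) (rule costnn)
  have sing: "(Suc k, (\<lambda>i. if i = k then x else 0)) \<in> A x" for k x by (auto simp: A_def)
  have costs: "cost (Suc k, (\<lambda>i. if i = k then x else 0)) = w k x" for k x
    by (simp add: cost_def if_distrib[of "w _"] wz cong: if_cong)
  have ne: "A x \<noteq> {}" for x using sing by blast
  have p_le: "p x \<le> cost a" if "a \<in> A x" for a x unfolding p_def by (rule cINF_lower[OF bdd that])
  have le_p: "e \<le> p x" if "\<And>a. a \<in> A x \<Longrightarrow> e \<le> cost a" for e x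
    unfolding p_def by (rule cINF_greatest[OF ne that])
  have p_w: "p x \<le> w k x" for k x using p_le[OF sing[of k x]] costs by simp
  have pnn: "0 \<le> p x" for x using costnn by (rule le_p)
  have sub: "p (x + y) \<le> p x + p y" for x y
  proof -
    have "p (x + y) \<le> cost a + cost b" if ab: "a \<in> A x" "b \<in> A y" for a b
    proof -
      obtain n f m g where a: "a = (n, f)" and b: "b = (m, g)" by (metis prod.exhaust)
      define N where "N = max n m"
      have z: "\<forall>k\<ge>n. f k = 0" "\<forall>k\<ge>m. g k = 0" using ab by (auto simp: A_def a b)
      have 1: "(\<Sum>k<n. f k) = (\<Sum>k<N. f k)" "(\<Sum>k<m. g k) = (\<Sum>k<N. g k)"
        "(\<Sum>k<n. w k (f k)) = (\<Sum>k<N. w k (f k))" "(\<Sum>k<m. w k (g k)) = (\<Sum>k<N. w k (g k))"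
        using z by (auto intro!: sum.mono_neutral_left simp: N_def wz) (metis not_less wz)+
      have "(N, (\<lambda>k. f k + g k)) \<in> A (x + y)"
      proof -
        have "(\<Sum>k<N. f k) = x" "(\<Sum>k<N. g k) = y" using ab unfolding A_def a b 1[symmetric] by auto
        moreover have "\<forall>k\<ge>N. f k + g k = 0" using z by (simp add: N_def)
        ultimately show ?thesis by (simp add: A_def sum.distrib)
      qed
      then have "p (x + y) \<le> cost (N, (\<lambda>k. f k + g k))" by (rule p_le)
      also have "\<dots> \<le> (\<Sum>k<N. w k (f k) + w k (g k))" unfolding cost_def prod.case by (intro sum_mono wadd)
      also have "\<dots> = cost a + cost b" by (simp add: cost_def a b 1 sum.distrib)
      finally show ?thesis .
    qed
    then have "p (x + y) - cost b \<le> p x" if "b \<in> A y" for b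
      using that by (intro le_p) (simp add: algebra_simps)
    then have "p (x + y) - p x \<le> p y" by (intro le_p) (simp add: algebra_simps)
    then show ?thesis by simp
  qed
  have sm_le: "p (smul b x) \<le> norm b * p x" if "b \<noteq> 0" for b x
  proof -
    have "p (smul b x) / norm b \<le> cost a" if a: "a \<in> A x" for a
    proof -
      obtain n f where af: "a = (n, f)" by (metis prod.exhaust)
      interpret vs: vector_space smul using ns by (simp add: normed_space_over_def)
      have "(n, (\<lambda>k. smul b (f k))) \<in> A (smul b x)"
        using a by (auto simp: A_def af vs.scale_sum_right)
      then have "p (smul b x) \<le> cost (n, (\<lambda>k. smul b (f k)))" by (rule p_le)
      also have "\<dots> = norm b * cost a" by (simp add: cost_def af wsm sum_distrib_left)
      finally show ?thesis using \<open>b \<noteq> 0\<close> by (simp add: field_simps)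
    qed
    then have "p (smul b x) / norm b \<le> p x" by (rule le_p)
    then show ?thesis using \<open>b \<noteq> 0\<close> by (simp add: field_simps)
  qed
  have "p (smul b x) = norm b * p x" for b x
  proof (cases "b = 0")
    case True
    have "smul 0 x = 0" using smul_simps(1)[of 0 x] by simp
    then show ?thesis using p_w[of 0 0] pnn[of 0] True by (simp add: wz)
  next
    case False
    have "smul (inverse b) (smul b x) = x" using smul_simps(1)[of 1 x] smul_simps(5) False by simp
    then have "p x \<le> norm (inverse b) * p (smul b x)" using sm_le[of "inverse b" "smul b x"] False by simp
    then have "norm b * p x \<le> p (smul b x)" using False by (simp add: norm_inverse inverse_eq_divide[of "norm b"] pos_le_divide_eq mult.commute)
    then show ?thesis using sm_le[OF False, of x] by simp
  qed
  then have psn: "seminorm smul p" unfolding seminorm_def using sub by blast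
  have "tight p"
    unfolding tight_def
  proof (intro conjI psn allI impI)
    fix \<epsilon> :: real assume "\<epsilon> > 0"
    \<comment> \<open>The one-term decomposition at place \<open>k\<close> bounds \<open>p\<close>
      by \<open>w k\<close>, whose norm coefficient \<open>1 / (k + 1)\<close> is as small as
      desired. This is why the balls grow with \<open>k\<close>.\<close>
    then obtain k where k: "1 / real (k + 1) < \<epsilon>" using nat_approx_posE[of \<epsilon>] by auto
    have "p x \<le> c k * q k x + \<epsilon> * norm x" for x
    proof -
      have "p x \<le> c k * q k x + 1 / real (k + 1) * norm x" using p_w[of x k] by (simp add: w_def algebra_simps)
      also have "1 / real (k + 1) * norm x \<le> \<epsilon> * norm x" using k by (intro mult_right_mono) auto
      finally show ?thesis by simp
    qed
    then show "\<exists>q\<in>P. \<exists>K\<ge>0. \<forall>x. p x \<le> K * q x + \<epsilon> * norm x" using q by blast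
  qed
  moreover have "{y. p y < 1} \<subseteq> U"
  proof
    fix y assume "y \<in> {y. p y < 1}"
    then have "\<exists>a\<in>A y. cost a < 1" using le_p[of y 1] by (meson mem_Collect_eq not_le)
    then obtain n f where nf: "(n, f) \<in> A y" "(\<Sum>k<n. w k (f k)) < 1" by (auto simp: cost_def)
    have "f k \<in> G (Suc k)" if "k < n" for k
    proof -
      have "w k (f k) \<le> (\<Sum>k<n. w k (f k))" using that by (intro member_le_sum) (auto intro: wnn)
      then show ?thesis using nf(2) q(3)[of k "f k"] by (simp add: w_def)
    qed
    then show "y \<in> U" using sumG[of n f 0] G(2) nf(1) by (auto simp: A_def)
  qed
  ultimately show ?thesis by blast
qed

lemma gamma_locally_convex:
  assumes "openin \<gamma> U" "x \<in> U"
  obtains p where "tight p" "{y. p (y - x) < 1} \<subseteq> U"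
proof -
  obtain p where p: "tight p" "{y. p y < 1} \<subseteq> {y. x + y \<in> U}"
    using gamma_locally_convex_0[OF openin_gamma_translate[OF assms(1), of x]] assms(2) by auto
  then have "y \<in> U" if "p (y - x) < 1" for y using that by force
  then show ?thesis using p(1) that by blast
qed

lemma gamma_eq: "\<gamma> = seminorm_topology (Collect tight)"
proof -
  have "openin \<gamma> U" if "openin (seminorm_topology (Collect tight)) U" for U
  proof -
    have "continuous_map \<gamma> (seminorm_topology (Collect tight)) id"
    proof (rule continuous_map_into_seminorm_topology)
      fix p x assume "p \<in> Collect tight"
      then have p: "tight p" by simp
      show "continuous_map \<gamma> euclideanreal (\<lambda>t. p (id t - x))"
        using continuous_map_seminorm[of p \<gamma> x, OF sn_abs[OF tight_seminorm[OF p]]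
            sn_zero[OF tight_seminorm[OF p]] openin_gamma_ball[OF p]] by simp
    qed (use tight_zero tight_seminorm sn_zero in auto)
    then show ?thesis using that by (auto simp: continuous_map_def)
  qed
  moreover have "openin (seminorm_topology (Collect tight)) U" if U: "openin \<gamma> U" for U
    unfolding openin_subopen[of _ U]
  proof
    fix x assume x: "x \<in> U"
    obtain p where p: "tight p" "{y. p (y - x) < 1} \<subseteq> U" by (rule gamma_locally_convex[OF U x])
    then show "\<exists>T. openin (seminorm_topology (Collect tight)) T \<and> x \<in> T \<and> T \<subseteq> U"
      using openin_seminorm_ball[of p "Collect tight" 1 x] sn_zero[OF tight_seminorm[OF p(1)]]
      by (intro exI[of _ "{y. p (y - x) < 1}"]) auto
  qed
  ultimately show ?thesis unfolding topology_eq by blast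
qed

lemma continuous_map_gamma_seminorm:
  "tight p \<Longrightarrow> continuous_map \<gamma> euclideanreal (\<lambda>t. p (t - x))"
  by (rule continuous_map_seminorm) (simp_all add: sn_abs sn_zero tight_seminorm openin_gamma_ball)

lemma continuous_map_into_gamma_iff:
  "continuous_map T \<gamma> f \<longleftrightarrow> (\<forall>p x. tight p \<longrightarrow> continuous_map T euclideanreal (\<lambda>t. p (f t - x)))"
proof safe
  fix p x assume "continuous_map T \<gamma> f" "tight p"
  then show "continuous_map T euclideanreal (\<lambda>t. p (f t - x))"
    using continuous_map_compose[OF _ continuous_map_gamma_seminorm, of T f p x] by (simp add: o_def)
next
  assume "\<forall>p x. tight p \<longrightarrow> continuous_map T euclideanreal (\<lambda>t. p (f t - x))"
  then show "continuous_map T \<gamma> f"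
    by (subst gamma_eq, intro continuous_map_into_seminorm_topology)
      (use tight_zero tight_seminorm sn_zero in auto)
qed

lemma limitin_gamma_iff:
  "limitin \<gamma> xs x F \<longleftrightarrow> (\<forall>p. tight p \<longrightarrow> ((\<lambda>n. p (xs n - x)) \<longlongrightarrow> 0) F)"
proof safe
  fix p assume l: "limitin \<gamma> xs x F" and p: "tight p"
  show "((\<lambda>n. p (xs n - x)) \<longlongrightarrow> 0) F"
    using continuous_map_limit[OF continuous_map_gamma_seminorm[OF p, of x] l] sn_zero[OF tight_seminorm[OF p]]
    by (simp add: o_def)
next
  assume *: "\<forall>p. tight p \<longrightarrow> ((\<lambda>n. p (xs n - x)) \<longlongrightarrow> 0) F"
  show "limitin \<gamma> xs x F"
    unfolding limitin_def
  proof (intro conjI allI impI)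
    fix U assume U: "openin \<gamma> U \<and> x \<in> U"
    then have "openin \<gamma> U" "x \<in> U" by auto
    then obtain p where p: "tight p" "{y. p (y - x) < 1} \<subseteq> U" by (rule gamma_locally_convex)
    have "eventually (\<lambda>n. p (xs n - x) < 1) F"
      using * p(1) by (intro order_tendstoD(2)[of _ 0]) auto
    then show "eventually (\<lambda>n. xs n \<in> U) F" by eventually_elim (use p(2) in auto)
  qed simp
qed

lemma limitin_tau_iff:
  "limitin \<tau> xs x F \<longleftrightarrow> (\<forall>p\<in>P. ((\<lambda>n. p (xs n - x)) \<longlongrightarrow> 0) F)"
proof safe
  fix p assume l: "limitin \<tau> xs x F" and p: "p \<in> P"
  have "continuous_map \<tau> euclideanreal (\<lambda>t. p (t - x))"
    using continuous_map_seminorm[of p \<tau> x, OF sn_abs[OF P_seminorm[OF p]] sn_zero[OF P_seminorm[OF p]]]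
      openin_seminorm_ball[OF p] unfolding tau_eq by blast
  from continuous_map_limit[OF this l] show "((\<lambda>n. p (xs n - x)) \<longlongrightarrow> 0) F"
    using sn_zero[OF P_seminorm[OF p]] by (simp add: o_def)
next
  assume *: "\<forall>p\<in>P. ((\<lambda>n. p (xs n - x)) \<longlongrightarrow> 0) F"
  show "limitin \<tau> xs x F"
    unfolding limitin_def
  proof (intro conjI allI impI)
    fix U assume U: "openin \<tau> U \<and> x \<in> U"
    then have "openin \<tau> U" "x \<in> U" by auto
    then obtain p r where p: "p \<in> P" "r > 0" "\<And>y. p (y - x) < r \<Longrightarrow> y \<in> U"
      by (rule tau_nbhd) (rule that; assumption)
    have "eventually (\<lambda>n. p (xs n - x) < r) F"
      using * p by (intro order_tendstoD(2)[of _ 0]) auto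
    then show "eventually (\<lambda>n. xs n \<in> U) F" by eventually_elim (use p(3) in auto)
  qed simp
qed

section \<open>Suprema of tight seminorms, bounded sets, convergent sequences\<close>

lemma seminorm_SUP:
  assumes J: "J \<noteq> {}" and sn: "\<And>t. t \<in> J \<Longrightarrow> seminorm smul (f t)"
    and bdd: "\<And>x. bdd_above ((\<lambda>t. f t x) ` J)"
  shows "seminorm smul (\<lambda>x. SUP t\<in>J. f t x)"
proof -
  have up: "f t x \<le> (SUP t\<in>J. f t x)" if "t \<in> J" for t x by (rule cSUP_upper[OF that bdd])
  have sub: "(SUP t\<in>J. f t (x + y)) \<le> (SUP t\<in>J. f t x) + (SUP t\<in>J. f t y)" for x y
  proof (rule cSUP_least[OF J])
    fix t assume t: "t \<in> J"
    show "f t (x + y) \<le> (SUP t\<in>J. f t x) + (SUP t\<in>J. f t y)"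
      using sn_add[OF sn[OF t], of x y] up[OF t, of x] up[OF t, of y] by linarith
  qed
  have le: "(SUP t\<in>J. f t (smul c x)) \<le> norm c * (SUP t\<in>J. f t x)" for c x
    by (rule cSUP_least[OF J]) (auto simp: sn_smul[OF sn] intro!: mult_left_mono up)
  have "(SUP t\<in>J. f t (smul c x)) = norm c * (SUP t\<in>J. f t x)" for c x
  proof (cases "c = 0")
    case True
    obtain t where t: "t \<in> J" using J by blast
    have "0 \<le> f t (smul c x)" by (rule sn_nonneg[OF sn[OF t]])
    then show ?thesis using le[of c x] up[OF t, of "smul c x"] True by simp
  next
    case False
    have "smul (inverse c) (smul c x) = x" using smul_simps(1)[of 1 x] smul_simps(5) False by simp
    then have "(SUP t\<in>J. f t x) \<le> norm (inverse c) * (SUP t\<in>J. f t (smul c x))"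
      using le[of "inverse c" "smul c x"] by simp
    then have "norm c * (SUP t\<in>J. f t x) \<le> (SUP t\<in>J. f t (smul c x))"
      using False by (simp add: norm_inverse inverse_eq_divide[of "norm c"] pos_le_divide_eq mult.commute)
    then show ?thesis using le[of c x] by simp
  qed
  then show ?thesis unfolding seminorm_def using sub by blast
qed

text \<open>For each \<epsilon>, one tight seminorm has to serve all \<open>t\<close>
  simultaneously, up to an error in norm; the case \<epsilon> = 1 already makes the suprema
  finite.\<close>

lemma tight_SUP:
  assumes J: "J \<noteq> {}" and sn: "\<And>t. t \<in> J \<Longrightarrow> seminorm smul (f t)"
    and approx: "\<And>\<epsilon>. \<epsilon> > 0 \<Longrightarrow> \<exists>r. tight r \<and> (\<forall>t\<in>J. \<forall>x. f t x \<le> r x + \<epsilon> * norm x)"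
  shows "tight (\<lambda>x. SUP t\<in>J. f t x)" "t \<in> J \<Longrightarrow> f t x \<le> (SUP t\<in>J. f t x)"
proof -
  have bdd: "bdd_above ((\<lambda>t. f t x) ` J)" for x
  proof -
    obtain r where "\<forall>t\<in>J. \<forall>x. f t x \<le> r x + 1 * norm x" using approx[of 1] by auto
    then show ?thesis by (intro bdd_aboveI2[where M = "r x + 1 * norm x"]) blast
  qed
  show "t \<in> J \<Longrightarrow> f t x \<le> (SUP t\<in>J. f t x)" by (rule cSUP_upper[OF _ bdd])
  show "tight (\<lambda>x. SUP t\<in>J. f t x)"
  proof (rule tight_approx[OF seminorm_SUP[OF J sn bdd]])
    fix \<epsilon> :: real assume "\<epsilon> > 0"
    then obtain r where r: "tight r" "\<forall>t\<in>J. \<forall>x. f t x \<le> r x + \<epsilon> * norm x" using approx by blast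
    have "(SUP t\<in>J. f t x) \<le> r x + \<epsilon> * norm x" for x by (rule cSUP_least[OF J]) (use r in blast)
    then show "\<exists>q. tight q \<and> (\<forall>x. (SUP t\<in>J. f t x) \<le> q x + \<epsilon> * norm x)" using r(1) by blast
  qed
qed

text \<open>Past some \<open>N\<close> the weights are below \<epsilon>, so these terms are at most
  \<epsilon> times the norm, and the finitely many others are dominated by their sum. With all
  \<open>p n\<close> in \<open>P\<close> these are the seminorms of the submixed topology.\<close>

lemma tight_SUP_null_sequence:
  assumes p: "\<And>n. tight (p n)" and le: "\<And>n x. p n x \<le> norm x"
    and a: "\<And>n. 0 \<le> a n" "a \<longlonglongrightarrow> 0"
  shows "tight (\<lambda>x. SUP n. p n x * a n)" "p n x * a n \<le> (SUP n. p n x * a n)"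
proof -
  note ps = tight_seminorm[OF p]
  have sn: "seminorm smul (\<lambda>x. p n x * a n)" for n
    using tight_seminorm[OF tight_scale[OF p a(1)], of n n] by (simp add: mult.commute)
  have approx: "\<exists>r. tight r \<and> (\<forall>n\<in>UNIV. \<forall>x. p n x * a n \<le> r x + \<epsilon> * norm x)" if e: "\<epsilon> > 0" for \<epsilon>
  proof -
    obtain N where N: "\<And>n. n \<ge> N \<Longrightarrow> a n < \<epsilon>"
      using order_tendstoD(2)[OF a(2) e] by (auto simp: eventually_sequentially)
    let ?q = "\<lambda>x. \<Sum>n<N. a n * p n x"
    have "p n x * a n \<le> ?q x + \<epsilon> * norm x" for n x
    proof (cases "n < N")
      case True
      have "a n * p n x \<le> ?q x"
        using True a(1) sn_nonneg[OF ps] by (intro member_le_sum) auto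
      then show ?thesis using e by (simp add: mult.commute add_increasing2)
    next
      case False
      then have "a n < \<epsilon>" by (intro N) simp
      then have "p n x * a n \<le> norm x * \<epsilon>" using le[of n x] a(1)[of n] by (intro mult_mono) auto
      moreover have "?q x \<ge> 0" using a(1) sn_nonneg[OF ps] by (intro sum_nonneg) auto
      ultimately show ?thesis by (simp add: mult.commute)
    qed
    moreover have "tight ?q" using a(1) p by (intro tight_sum tight_scale)
    ultimately show ?thesis by blast
  qed
  show "tight (\<lambda>x. SUP n. p n x * a n)" by (rule tight_SUP(1)[OF _ sn approx]) simp_all
  show "p n x * a n \<le> (SUP n. p n x * a n)"
    by (rule tight_SUP(2)[where f = "\<lambda>n x. p n x * a n" and J = UNIV, OF _ sn approx]) simp_all
qed

text \<open>In an unbounded set there are \<open>x n\<close> of norm above \<open>(n + 1)^2\<close>,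
  and as the norm is the supremum of \<open>P\<close>, some \<open>p n\<close> in \<open>P\<close>
  sees this. Weighted with the null sequence \<open>1 / (n + 1)\<close>, the \<open>p n\<close>
  combine into one tight seminorm exceeding \<open>n + 1\<close> at \<open>x n\<close>.\<close>

lemma bounded_if_gamma_bounded:
  assumes "\<And>p. tight p \<Longrightarrow> bdd_above (p ` A)"
  shows "bounded A"
proof (rule ccontr)
  assume "\<not> bounded A"
  then have "\<exists>x\<in>A. norm x > (real n + 1)^2" for n :: nat
    unfolding bounded_iff by (meson not_le)
  then have "\<exists>x\<in>A. \<exists>p\<in>P. p x > (real n + 1)^2" for n :: nat
    using norm_le_if_P by (meson not_le)
  then obtain x p where xp: "\<And>n. x n \<in> A" "\<And>n. p n \<in> P" "\<And>n. p n (x n) > (real n + 1)^2" by metis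
  define a where "a n = 1 / (real n + 1)" for n :: nat
  have a: "0 \<le> a n" "a \<longlonglongrightarrow> 0" for n
    unfolding a_def using LIMSEQ_inverse_real_of_nat by (auto simp: inverse_eq_divide add.commute)
  let ?q = "\<lambda>x. SUP n. p n x * a n"
  have "bdd_above (?q ` A)" by (rule assms[OF tight_SUP_null_sequence(1)[OF tight_P[OF xp(2)] P_le_norm[OF xp(2)] a]])
  then obtain M where M: "\<And>x. x \<in> A \<Longrightarrow> ?q x \<le> M" by (auto simp: bdd_above_def)
  have "real n + 1 \<le> M" for n
  proof -
    have "real n + 1 = (real n + 1)^2 * a n" by (simp add: a_def power2_eq_square)
    also have "\<dots> \<le> p n (x n) * a n" using xp(3)[of n] a(1)[of n] by (intro mult_right_mono) auto
    also have "\<dots> \<le> ?q (x n)" by (rule tight_SUP_null_sequence(2)[OF tight_P[OF xp(2)] P_le_norm[OF xp(2)] a])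
    also have "\<dots> \<le> M" by (rule M[OF xp(1)])
    finally show ?thesis .
  qed
  moreover obtain n :: nat where "M < real n" using reals_Archimedean2 by blast
  ultimately show False by (metis add_increasing2 linorder_not_le order_refl order_trans zero_le_one)
qed

lemma tendsto_tight_if_bounded:
  assumes b: "\<forall>n. norm (xs n) \<le> b" and l: "\<And>q. q \<in> P \<Longrightarrow> ((\<lambda>n. q (xs n)) \<longlongrightarrow> 0) F" and p: "tight p"
  shows "((\<lambda>n. p (xs n)) \<longlongrightarrow> 0) F"
proof (rule tendstoI)
  fix e :: real assume e: "e > 0"
  have b0: "\<bar>b\<bar> + 1 > 0" by simp
  obtain q K where q: "q \<in> P" "K \<ge> 0" "\<And>x. p x \<le> K * q x + e / (2 * (\<bar>b\<bar> + 1)) * norm x"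
    using tightE[OF p, of "e / (2 * (\<bar>b\<bar> + 1))"] e b0 by auto
  have "((\<lambda>n. K * q (xs n)) \<longlongrightarrow> K * 0) F" by (intro tendsto_mult_left l q(1))
  then have "eventually (\<lambda>n. K * q (xs n) < e / 2) F" using e by (intro order_tendstoD(2)[of _ "K * 0"]) auto
  then show "eventually (\<lambda>n. dist (p (xs n)) 0 < e) F"
  proof eventually_elim
    case (elim n)
    have "norm (xs n) \<le> \<bar>b\<bar> + 1" using b by (meson abs_ge_self add_increasing2 order_trans zero_le_one)
    then have "e / (2 * (\<bar>b\<bar> + 1)) * norm (xs n) \<le> e / (2 * (\<bar>b\<bar> + 1)) * (\<bar>b\<bar> + 1)"
      using e by (intro mult_left_mono) auto
    also have "\<dots> = e / 2" using b0 by (simp add: field_simps)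
    finally have "p (xs n) < e" using q(3)[of "xs n"] elim by linarith
    then show ?case using sn_nonneg[OF tight_seminorm[OF p], of "xs n"] by simp
  qed
qed

text \<open>A \<gamma>-convergent sequence is bounded for every tight seminorm, hence in norm;
  conversely, along a bounded sequence the norm term in a tightness estimate is negligible. This
  translates bi-equicontinuity, which speaks of bounded \<tau>-convergent sequences, into a
  statement about \<gamma>.\<close>

lemma limitin_gamma_iff_tau:
  "limitin \<gamma> xs x sequentially \<longleftrightarrow> bounded (range xs) \<and> limitin \<tau> xs x sequentially"
proof safe
  assume l: "limitin \<gamma> xs x sequentially"
  show "bounded (range xs)"
  proof (rule bounded_if_gamma_bounded)
    fix p assume p: "tight p"
    have "Bseq (\<lambda>n. p (xs n - x))"
      using l p unfolding limitin_gamma_iff by (meson convergent_imp_Bseq convergentI)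
    then obtain M where M: "\<And>n. norm (p (xs n - x)) \<le> M" by (auto simp: Bseq_def)
    have "p (xs n) \<le> M + p x" for n
      using sn_add[OF tight_seminorm[OF p], of "xs n - x" x] M[of n] by simp
    then show "bdd_above (p ` range xs)" by (auto intro!: bdd_aboveI[where M = "M + p x"])
  qed
  show "limitin \<tau> xs x sequentially"
    using l unfolding limitin_gamma_iff limitin_tau_iff using tight_P by blast
next
  assume b: "bounded (range xs)" and l: "limitin \<tau> xs x sequentially"
  obtain B where "\<And>n. norm (xs n) \<le> B" using b by (auto simp: bounded_iff)
  then have "norm (xs n - x) \<le> B + norm x" for n using norm_triangle_ineq4[of "xs n" x] by (meson add_mono order_refl order_trans)
  then show "limitin \<gamma> xs x sequentially"
    unfolding limitin_gamma_iff using tendsto_tight_if_bounded[of "\<lambda>n. xs n - x"] l[unfolded limitin_tau_iff] by blast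
qed

section \<open>The dual space\<close>

abbreviation Y :: "('a \<Rightarrow> 'k) set" where "Y \<equiv> top_dual smul \<gamma>"

lemma dual_linear:
  assumes "Vector_Spaces.linear smul (*) (f :: 'a \<Rightarrow> 'k)"
  shows "f (x + y) = f x + f y" "f (smul c x) = c * f x" "f (x - y) = f x - f y" "f 0 = 0"
    "f (r *\<^sub>R x) = of_real r * f x"
proof -
  note l = assms[unfolded linear_functional_iff[OF ns]] linear_functional_real[OF ns assms]
  show "f (x + y) = f x + f y" "f (smul c x) = c * f x" using l(1) by blast+
  show "f (x - y) = f x - f y" "f 0 = 0" using linear_diff[OF l(2)] linear_0[OF l(2)] by auto
  show "f (r *\<^sub>R x) = of_real r * f x" using linear_cmul[OF l(2)] by (simp add: scaleR_conv_of_real)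
qed

lemma seminorm_norm_linear:
  assumes "Vector_Spaces.linear smul (*) (f :: 'a \<Rightarrow> 'k)"
  shows "seminorm smul (\<lambda>x. norm (f x))"
  by (simp add: seminorm_def dual_linear[OF assms] norm_triangle_ineq norm_mult)

lemma dualI:
  assumes lin: "Vector_Spaces.linear smul (*) f" and le: "\<And>x. norm (f x) \<le> p x" and p: "tight p"
  shows "f \<in> Y"
  unfolding top_dual_def
proof (intro CollectI conjI lin)
  have t: "tight (\<lambda>x. norm (f x))" using tight_le[OF p seminorm_norm_linear[OF lin] le] .
  show "continuous_map \<gamma> euclidean f"
    unfolding continuous_map_def
  proof (intro conjI allI impI)
    fix U :: "'k set" assume "openin euclidean U"
    then have U: "open U" by simp
    show "openin \<gamma> {x \<in> topspace \<gamma>. f x \<in> U}"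
      unfolding openin_subopen[of \<gamma> "{x \<in> topspace \<gamma>. f x \<in> U}"]
    proof
      fix x assume x: "x \<in> {x \<in> topspace \<gamma>. f x \<in> U}"
      then obtain e where e: "e > 0" "ball (f x) e \<subseteq> U" using U by (auto simp: open_contains_ball)
      have "f y \<in> U" if "norm (f (y - x)) < e" for y
        using that by (intro subsetD[OF e(2)]) (simp add: dual_linear(3)[OF lin] dist_norm norm_minus_commute)
      then show "\<exists>V. openin \<gamma> V \<and> x \<in> V \<and> V \<subseteq> {x \<in> topspace \<gamma>. f x \<in> U}"
        using openin_gamma_ball[OF t e(1), of x] e(1)
        by (intro exI[of _ "{y. norm (f (y - x)) < e}"]) (auto simp: dual_linear(4)[OF lin])
    qed
  qed auto
qed

lemma dualD:
  assumes "f \<in> Y"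
  shows "Vector_Spaces.linear smul (*) f" "continuous_map \<gamma> euclidean f" "tight (\<lambda>x. norm (f x))"
proof -
  show l: "Vector_Spaces.linear smul (*) f" and c: "continuous_map \<gamma> euclidean f"
    using assms by (auto simp: top_dual_def)
  have "openin \<gamma> {x. norm (f x) < e}" for e
    using openin_continuous_map_preimage[OF c, of "ball 0 e"] by simp
  then show "tight (\<lambda>x. norm (f x))"
    by (intro tight_if_small_on_gamma_nbhds[OF seminorm_norm_linear[OF l]] exI[of _ "{x. norm (f x) < e}" for e])
      (auto simp: dual_linear(4)[OF l])
qed

lemma dual_Hahn_Banach:
  assumes "tight p"
  shows "\<exists>f\<in>Y. (\<forall>x. norm (f x) \<le> p x) \<and> norm (f a) = p a"
proof (rule Hahn_Banach_seminorm[OF ns tight_seminorm[OF assms], of a])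
  fix f :: "'a \<Rightarrow> 'k"
  assume f: "Vector_Spaces.linear smul (*) f" "\<And>x. norm (f x) \<le> p x" "norm (f a) = p a"
  then show ?thesis using dualI[OF f(1,2) assms] by blast
qed

text \<open>Each \<open>p x\<close> with \<open>p\<close> in \<open>P\<close> is attained as
  \<open>norm (f x)\<close> by some \<open>f\<close> in the dual, and the norm of \<open>x\<close>
  is the supremum of these values.\<close>

lemma dual_separates:
  assumes "\<And>f. f \<in> Y \<Longrightarrow> f x = 0"
  shows "x = 0"
proof -
  have "norm x \<le> 0"
  proof (rule norm_le_if_P)
    fix p assume "p \<in> P"
    then obtain f where "f \<in> Y" "norm (f x) = p x" using dual_Hahn_Banach[OF tight_P] by blast
    then show "p x \<le> 0" using assms by force
  qed
  then show ?thesis by simp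
qed

end


section \<open>Operator families and the Mackey topology\<close>

context mixed_space
begin

section \<open>Continuous operators, equicontinuity and equitightness\<close>

lemma seminorm_comp:
  assumes p: "seminorm smul p" and T: "Vector_Spaces.linear smul smul T"
  shows "seminorm smul (\<lambda>x. p (T x))"
proof -
  note l = T[unfolded linear_operator_iff[OF ns]]
  have "T (x + y) = T x + T y" "T (smul c x) = smul c (T x)" for c x y using l by blast+
  then show ?thesis using sn_add[OF p] sn_smul[OF p] by (simp add: seminorm_def)
qed

lemma linear_operatorD:
  assumes "Vector_Spaces.linear smul smul T"
  shows "T (x + y) = T x + T y" "T (smul c x) = smul c (T x)" "T (x - y) = T x - T y" "T 0 = 0"
    "T (r *\<^sub>R x) = r *\<^sub>R T x"
proof -
  note l = assms[unfolded linear_operator_iff[OF ns]] linear_operator_real[OF ns assms]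
  show "T (x + y) = T x + T y" "T (smul c x) = smul c (T x)" using l(1) by blast+
  show "T (x - y) = T x - T y" "T 0 = 0" using linear_diff[OF l(2)] linear_0[OF l(2)] by auto
  show "T (r *\<^sub>R x) = r *\<^sub>R T x" using linear_cmul[OF l(2)] .
qed

lemma continuous_operator_gamma_iff:
  "T \<in> continuous_operators smul \<gamma> \<longleftrightarrow>
     Vector_Spaces.linear smul smul T \<and> (\<forall>p. tight p \<longrightarrow> tight (\<lambda>x. p (T x)))"
proof safe
  assume T: "T \<in> continuous_operators smul \<gamma>"
  then show l: "Vector_Spaces.linear smul smul T" by (simp add: continuous_operators_def)
  fix p assume p: "tight p"
  have "continuous_map \<gamma> euclideanreal (\<lambda>t. p (T t - 0))"
    using T p by (simp only: continuous_operators_def continuous_map_into_gamma_iff mem_Collect_eq)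
  then show "tight (\<lambda>x. p (T x))"
    using seminorm_comp[OF tight_seminorm[OF p] l]
    by (simp add: continuous_seminorm_iff_tight[symmetric] continuous_seminorms_def)
next
  assume l: "Vector_Spaces.linear smul smul T" and t: "\<forall>p. tight p \<longrightarrow> tight (\<lambda>x. p (T x))"
  have "continuous_map \<gamma> \<gamma> T"
    unfolding continuous_map_def
  proof (intro conjI allI impI)
    fix U assume U: "openin \<gamma> U"
    show "openin \<gamma> {x \<in> topspace \<gamma>. T x \<in> U}"
      unfolding openin_subopen[of \<gamma> "{x \<in> topspace \<gamma>. T x \<in> U}"]
    proof
      fix x assume "x \<in> {x \<in> topspace \<gamma>. T x \<in> U}"
      then have "T x \<in> U" by simp
      then obtain p where p: "tight p" "{y. p (y - T x) < 1} \<subseteq> U" by (rule gamma_locally_convex[OF U])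
      have "openin \<gamma> {y. p (T (y - x)) < 1}" using openin_gamma_ball[of "\<lambda>x. p (T x)" 1 x] t p(1) by simp
      moreover have "{y. p (T (y - x)) < 1} \<subseteq> {x \<in> topspace \<gamma>. T x \<in> U}"
        using p(2) by (auto simp: linear_operatorD(3)[OF l])
      ultimately show "\<exists>V. openin \<gamma> V \<and> x \<in> V \<and> V \<subseteq> {x \<in> topspace \<gamma>. T x \<in> U}"
        using linear_operatorD(4)[OF l] sn_zero[OF tight_seminorm[OF p(1)]]
        by (intro exI[of _ "{y. p (T (y - x)) < 1}"]) simp
    qed
  qed simp
  then show "T \<in> continuous_operators smul \<gamma>" using l by (simp add: continuous_operators_def)
qed

lemma equicontinuous_family_iff:
  "equicontinuous_family smul \<gamma> J V \<longleftrightarrow>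
     (\<forall>p. tight p \<longrightarrow> (\<exists>q. tight q \<and> (\<forall>t\<in>J. \<forall>x. p (V t x) \<le> q x)))"
proof safe
  fix p assume "equicontinuous_family smul \<gamma> J V" "tight p"
  then obtain q K where "tight q" "K \<ge> 0" "\<forall>t\<in>J. \<forall>x. p (V t x) \<le> K * q x"
    unfolding equicontinuous_family_def Ball_def Bex_def continuous_seminorm_iff_tight by blast
  then show "\<exists>q. tight q \<and> (\<forall>t\<in>J. \<forall>x. p (V t x) \<le> q x)" using tight_scale by blast
next
  assume *: "\<forall>p. tight p \<longrightarrow> (\<exists>q. tight q \<and> (\<forall>t\<in>J. \<forall>x. p (V t x) \<le> q x))"
  show "equicontinuous_family smul \<gamma> J V"
    unfolding equicontinuous_family_def Ball_def Bex_def continuous_seminorm_iff_tight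
  proof (intro allI impI)
    fix p assume "tight p"
    then obtain q where "tight q" "\<forall>t\<in>J. \<forall>x. p (V t x) \<le> 1 * q x" using * by auto
    then show "\<exists>q. tight q \<and> (\<exists>K\<ge>0. \<forall>t. t \<in> J \<longrightarrow> (\<forall>x. p (V t x) \<le> K * q x))"
      by (intro exI[of _ q] conjI exI[of _ 1]) auto
  qed
qed

text \<open>The common bound is the supremum of \<open>p (V t x)\<close> over \<open>t\<close>;
  errors \<epsilon> times the norm are allowed because this supremum is still tight.\<close>

lemma equicontinuous_familyI:
  assumes lin: "\<And>t. t \<in> J \<Longrightarrow> Vector_Spaces.linear smul smul (V t)"
    and approx: "\<And>p \<epsilon>. tight p \<Longrightarrow> \<epsilon> > 0 \<Longrightarrow>
      \<exists>r. tight r \<and> (\<forall>t\<in>J. \<forall>x. p (V t x) \<le> r x + \<epsilon> * norm x)"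
  shows "equicontinuous_family smul \<gamma> J V"
  unfolding equicontinuous_family_iff
proof (intro allI impI)
  fix p assume p: "tight p"
  show "\<exists>q. tight q \<and> (\<forall>t\<in>J. \<forall>x. p (V t x) \<le> q x)"
  proof (cases "J = {}")
    case False
    have sn: "seminorm smul (\<lambda>x. p (V t x))" if "t \<in> J" for t
      by (rule seminorm_comp[OF tight_seminorm[OF p] lin[OF that]])
    have "p (V t x) \<le> (SUP t\<in>J. p (V t x))" if "t \<in> J" for t x
      by (rule tight_SUP(2)[where f = "\<lambda>t x. p (V t x)", OF False sn approx[OF p] that])
    moreover have "tight (\<lambda>x. SUP t\<in>J. p (V t x))"
      by (rule tight_SUP(1)[OF False sn approx[OF p]])
    ultimately show ?thesis by blast
  qed (use p in blast)
qed

lemma bounded_family_iff: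
  assumes lin: "\<And>t. t \<in> J \<Longrightarrow> Vector_Spaces.linear smul smul (V t)"
  shows "bounded_family smul J V \<longleftrightarrow> (\<exists>C\<ge>0. \<forall>t\<in>J. \<forall>x. norm (V t x) \<le> C * norm x)"
proof safe
  assume b: "bounded_family smul J V"
  then obtain C where C: "\<And>t. t \<in> J \<Longrightarrow> onorm (V t) \<le> C" by (auto simp: bounded_family_def bdd_above_def)
  have "norm (V t x) \<le> max C 0 * norm x" if "t \<in> J" for t x
  proof -
    have "bounded_linear (V t)" using b that by (simp add: bounded_family_def family_in_def bounded_operators_def)
    then have "norm (V t x) \<le> onorm (V t) * norm x" by (rule onorm)
    also have "\<dots> \<le> max C 0 * norm x" using C[OF that] by (intro mult_right_mono) auto
    finally show ?thesis .
  qed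
  then show "\<exists>C\<ge>0. \<forall>t\<in>J. \<forall>x. norm (V t x) \<le> C * norm x" by (intro exI[of _ "max C 0"]) auto
next
  fix C :: real assume C: "C \<ge> 0" "\<forall>t\<in>J. \<forall>x. norm (V t x) \<le> C * norm x"
  have "bounded_linear (V t)" if "t \<in> J" for t
    by (rule bounded_linear_intro[where K = C])
      (use that C(2) linear_operatorD[OF lin[OF that]] in \<open>auto simp: mult.commute\<close>)
  moreover have "onorm (V t) \<le> C" if "t \<in> J" for t
    by (rule onorm_bound) (use that C in auto)
  ultimately show "bounded_family smul J V"
    using lin by (auto simp: bounded_family_def family_in_def bounded_operators_def intro!: bdd_aboveI2)
qed

text \<open>The union of the images of the unit ball under all \<open>V t\<close> is bounded for
  every tight seminorm, hence in norm, so no completeness is involved.\<close>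

lemma uniform_bound_if_equicontinuous:
  assumes lin: "\<And>t. t \<in> J \<Longrightarrow> Vector_Spaces.linear smul smul (V t)"
    and eq: "equicontinuous_family smul \<gamma> J V"
  shows "\<exists>C\<ge>0. \<forall>t\<in>J. \<forall>x. norm (V t x) \<le> C * norm x"
proof -
  let ?A = "{V t x | t x. t \<in> J \<and> norm x \<le> 1}"
  have "bounded ?A"
  proof (rule bounded_if_gamma_bounded)
    fix p assume "tight p"
    then obtain q where q: "tight q" "\<And>t x. t \<in> J \<Longrightarrow> p (V t x) \<le> q x"
      using eq unfolding equicontinuous_family_iff by blast
    obtain C where C: "C \<ge> 0" "\<And>x. q x \<le> C * norm x" by (rule tight_bound[OF q(1)]) blast
    have "p (V t x) \<le> C" if "t \<in> J" "norm x \<le> 1" for t x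
      using q(2)[OF that(1), of x] C(2)[of x] mult_left_mono[OF that(2) C(1)] by simp
    then show "bdd_above (p ` ?A)" by (intro bdd_aboveI[where M = C]) auto
  qed
  then obtain C where C: "C > 0" "\<And>y. y \<in> ?A \<Longrightarrow> norm y \<le> C" by (meson bounded_pos)
  have "norm (V t x) \<le> C * norm x" if t: "t \<in> J" for t x
  proof (cases "x = 0")
    case False
    have "norm (V t ((1 / norm x) *\<^sub>R x)) \<le> C"
    proof (rule C(2), intro CollectI exI conjI)
      show "norm ((1 / norm x) *\<^sub>R x) \<le> 1" using False by simp
    qed (use t in simp_all)
    then show ?thesis using False by (simp add: linear_operatorD(5)[OF lin[OF t]] field_simps)
  qed (simp add: linear_operatorD(4)[OF lin[OF t]])
  then show ?thesis using C(1) by (intro exI[of _ C]) auto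
qed

lemma equitight_familyD:
  assumes "equitight_family P J V" "p \<in> P" "\<epsilon> > 0"
  shows "\<exists>q\<in>P. \<exists>K\<ge>0. \<forall>t\<in>J. \<forall>x. p (V t x) \<le> K * q x + \<epsilon> * norm x"
  using assms(1)[unfolded equitight_family_def, THEN spec, THEN mp, OF assms(3), THEN bspec, OF assms(2)] .

lemma equitight_if_equicontinuous:
  assumes "equicontinuous_family smul \<gamma> J V"
  shows "equitight_family P J V"
  unfolding equitight_family_def
proof (intro allI impI ballI)
  fix \<epsilon> :: real and p assume e: "\<epsilon> > 0" and p: "p \<in> P"
  obtain q where q: "tight q" "\<And>t x. t \<in> J \<Longrightarrow> p (V t x) \<le> q x"
    using assms tight_P[OF p] unfolding equicontinuous_family_iff by blast
  obtain r K where "r \<in> P" "K \<ge> 0" "\<And>x. q x \<le> K * r x + \<epsilon> * norm x" by (rule tightE[OF q(1) e]) blast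
  then show "\<exists>q\<in>P. \<exists>K\<ge>0. \<forall>t\<in>J. \<forall>x. p (V t x) \<le> K * q x + \<epsilon> * norm x"
    using q(2) order_trans by blast
qed

text \<open>Equitightness controls only the members of \<open>P\<close>. For a general tight
  \<open>p\<close> the error is a multiple of \<open>norm (V t x)\<close>, which the uniform bound
  \<open>C\<close> turns back into a multiple of \<open>norm x\<close>. The denominators
  \<open>C + 1\<close> and \<open>K + 1\<close> allow for vanishing constants.\<close>

lemma equicontinuous_if_equitight:
  assumes lin: "\<And>t. t \<in> J \<Longrightarrow> Vector_Spaces.linear smul smul (V t)"
    and eq: "equitight_family P J V" and C: "C \<ge> 0" "\<And>t x. t \<in> J \<Longrightarrow> norm (V t x) \<le> C * norm x"
  shows "equicontinuous_family smul \<gamma> J V"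
proof (rule equicontinuous_familyI[OF lin])
  fix p and \<epsilon> :: real assume p: "tight p" and e: "\<epsilon> > 0"
  have d: "\<epsilon> / (2 * (C + 1)) > 0" using e C(1) by simp
  obtain q K where q: "q \<in> P" "K \<ge> 0" "\<And>x. p x \<le> K * q x + \<epsilon> / (2 * (C + 1)) * norm x"
    by (rule tightE[OF p d]) blast
  have d': "\<epsilon> / (2 * (K + 1)) > 0" using e q(2) by simp
  then obtain r L where r: "r \<in> P" "L \<ge> 0"
    "\<And>t x. t \<in> J \<Longrightarrow> q (V t x) \<le> L * r x + \<epsilon> / (2 * (K + 1)) * norm x"
    using eq q(1) unfolding equitight_family_def by blast
  have "p (V t x) \<le> (K * L) * r x + \<epsilon> * norm x" if t: "t \<in> J" for t x
  proof -
    have "\<epsilon> / (2 * (C + 1)) * norm (V t x) \<le> \<epsilon> / (2 * (C + 1)) * (C * norm x)"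
      using d C(2)[OF t, of x] by (intro mult_left_mono) auto
    also have "\<dots> = (C / (C + 1)) * (\<epsilon> / 2 * norm x)" using C(1) by (simp add: field_simps)
    also have "\<dots> \<le> 1 * (\<epsilon> / 2 * norm x)" using C(1) e by (intro mult_right_mono) auto
    finally have 1: "\<epsilon> / (2 * (C + 1)) * norm (V t x) \<le> \<epsilon> / 2 * norm x" by simp
    have "K * q (V t x) \<le> K * (L * r x + \<epsilon> / (2 * (K + 1)) * norm x)"
      using q(2) r(3)[OF t, of x] by (intro mult_left_mono) auto
    also have "\<dots> = (K * L) * r x + (K / (K + 1)) * (\<epsilon> / 2 * norm x)" using q(2) by (simp add: field_simps)
    also have "(K / (K + 1)) * (\<epsilon> / 2 * norm x) \<le> 1 * (\<epsilon> / 2 * norm x)"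
      using q(2) e by (intro mult_right_mono) auto
    finally have "K * q (V t x) \<le> (K * L) * r x + \<epsilon> / 2 * norm x" by simp
    then show ?thesis using q(3)[of "V t x"] 1 by linarith
  qed
  moreover have "tight (\<lambda>x. (K * L) * r x)" using q(2) r by (intro tight_scale tight_P) auto
  ultimately show "\<exists>r. tight r \<and> (\<forall>t\<in>J. \<forall>x. p (V t x) \<le> r x + \<epsilon> * norm x)" by blast
qed

lemma strongly_continuous_gamma_iff:
  "strongly_continuous \<gamma> J V \<longleftrightarrow> (\<forall>x p z. tight p \<longrightarrow> continuous_on J (\<lambda>t. p (V t x - z)))"
  unfolding strongly_continuous_def continuous_map_into_gamma_iff by auto

text \<open>Each tight seminorm is bounded on the orbit piece by compactness of \<open>M\<close>.
  These are the pointwise bounds for the uniform boundedness principle.\<close>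

lemma strongly_continuous_bounded:
  assumes sc: "strongly_continuous \<gamma> J V" and M: "compact M" "M \<subseteq> J"
  shows "bounded ((\<lambda>t. V t x) ` M)"
proof (rule bounded_if_gamma_bounded)
  fix p assume "tight p"
  then have "continuous_on J (\<lambda>t. p (V t x - 0))" using sc unfolding strongly_continuous_gamma_iff by blast
  then have "continuous_on M (\<lambda>t. p (V t x))" using continuous_on_subset[OF _ M(2)] by simp
  then have "compact ((\<lambda>t. p (V t x)) ` M)" using M(1) by (rule compact_continuous_image)
  then show "bdd_above (p ` (\<lambda>t. V t x) ` M)"
    using bounded_imp_bdd_above[OF compact_imp_bounded] by (simp add: image_image)
qed

section \<open>Polars and the Mackey topology\<close>

lemma mackey_generator_seminorm:
  assumes HY: "H \<subseteq> Y" and c: "compact H" and ne: "H \<noteq> {}"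
  shows "seminorm smul (\<lambda>x. SUP f\<in>H. norm (f x))" "bdd_above ((\<lambda>f. norm (f x)) ` H)"
proof -
  have bdd: "bdd_above ((\<lambda>f. norm (f x)) ` H)" for x
  proof -
    have "continuous_on H (\<lambda>f. norm (f x))"
      by (intro continuous_on_norm continuous_on_subset[OF continuous_on_product_coordinates]) auto
    then have "compact ((\<lambda>f. norm (f x)) ` H)" using c by (rule compact_continuous_image)
    then show ?thesis by (intro bounded_imp_bdd_above compact_imp_bounded)
  qed
  then show "bdd_above ((\<lambda>f. norm (f x)) ` H)" .
  show "seminorm smul (\<lambda>x. SUP f\<in>H. norm (f x))"
    by (rule seminorm_SUP[OF ne _ bdd]) (use HY dualD(1) seminorm_norm_linear in blast)
qed

text \<open>The topology of the function type is the product topology, that is, pointwise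
  convergence, so weak-star compactness becomes the type-class notion
  \<open>compact\<close>.\<close>

lemma compactin_weak_star_iff: "compactin (weak_star_topology (Z :: ('a \<Rightarrow> 'k) set)) H \<longleftrightarrow> compact H \<and> H \<subseteq> Z"
  unfolding weak_star_topology_def euclidean_product_topology compactin_subtopology by simp

lemma tight_if_equicontinuous_functionals:
  assumes HY: "H \<subseteq> Y" and c: "compact H" and ne: "H \<noteq> {}" and eq: "equicontinuous_functionals \<gamma> H"
  shows "tight (\<lambda>x. SUP f\<in>H. norm (f x))"
proof (rule tight_if_small_on_gamma_nbhds[OF mackey_generator_seminorm(1)[OF HY c ne]])
  fix \<epsilon> :: real assume "\<epsilon> > 0"
  then have "\<epsilon> / 2 > 0" by simp
  then have "\<exists>U. openin \<gamma> U \<and> 0 \<in> U \<and> (\<forall>f\<in>H. \<forall>x\<in>U. norm (f x) < \<epsilon> / 2)"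
    using eq unfolding equicontinuous_functionals_def by (elim allE impE)
  then obtain U where U: "openin \<gamma> U" "0 \<in> U" "\<forall>f\<in>H. \<forall>x\<in>U. norm (f x) < \<epsilon> / 2" by blast
  have "(SUP f\<in>H. norm (f x)) < \<epsilon>" if "x \<in> U" for x
  proof -
    have "(SUP f\<in>H. norm (f x)) \<le> \<epsilon> / 2" by (rule cSUP_least[OF ne]) (use U(3) that in \<open>auto intro: less_imp_le\<close>)
    then show ?thesis using \<open>\<epsilon> > 0\<close> by simp
  qed
  then show "\<exists>U. openin \<gamma> U \<and> 0 \<in> U \<and> (\<forall>x\<in>U. (SUP f\<in>H. norm (f x)) < \<epsilon>)" using U by blast
qed

text \<open>For a seminorm \<open>p\<close>, this is the absolute polar of the ball
  \<open>{x. p x \<le> 1}\<close>.\<close>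

definition polar :: "('a \<Rightarrow> real) \<Rightarrow> ('a \<Rightarrow> 'k) set" where
  "polar p = {f. Vector_Spaces.linear smul (*) f \<and> (\<forall>x. norm (f x) \<le> p x)}"

lemma polar_subset: "tight p \<Longrightarrow> polar p \<subseteq> Y"
  unfolding polar_def using dualI by blast

lemma closed_linear_functionals: "closed {f :: 'a \<Rightarrow> 'k. Vector_Spaces.linear smul (*) f}"
proof -
  have *: "continuous_on UNIV (\<lambda>f :: 'a \<Rightarrow> 'k. f x)" for x by simp
  have "closed {f :: 'a \<Rightarrow> 'k. (\<forall>x y. f (x + y) = f x + f y) \<and> (\<forall>c x. f (smul c x) = c * f x)}"
    by (intro closed_Collect_conj closed_Collect_all closed_Collect_eq continuous_on_add
        continuous_on_mult continuous_on_const *)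
  then show ?thesis by (simp add: linear_functional_iff[OF ns])
qed

lemma compact_pointwise_bounded: "compact {f :: 'a \<Rightarrow> 'k. \<forall>x. norm (f x) \<le> c x}"
proof -
  have "compactin (product_topology (\<lambda>_. euclidean) UNIV) (PiE UNIV (\<lambda>x. cball (0 :: 'k) (c x)))"
    by (simp add: compactin_PiE compact_cball_scalars)
  moreover have "PiE UNIV (\<lambda>x. cball (0 :: 'k) (c x)) = {f. \<forall>x. norm (f x) \<le> c x}"
    by (auto simp: PiE_def)
  ultimately show ?thesis unfolding euclidean_product_topology by simp
qed

text \<open>Banach--Alaoglu: linearity is a closed condition under pointwise convergence, and the
  pointwise bounds define a product of compact discs.\<close>

lemma compact_polar: "compact (polar p)"
proof -
  have "polar p = {f. Vector_Spaces.linear smul (*) f} \<inter> {f. \<forall>x. norm (f x) \<le> p x}"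
    by (auto simp: polar_def)
  then show ?thesis using closed_Int_compact[OF closed_linear_functionals compact_pointwise_bounded] by simp
qed

lemma zero_in_polar: "tight p \<Longrightarrow> (\<lambda>x. 0) \<in> polar p"
  using sn_nonneg[OF tight_seminorm] by (simp add: polar_def linear_functional_iff[OF ns])

lemma SUP_polar:
  assumes p: "tight p"
  shows "(SUP f\<in>polar p. norm (f x)) = p x"
proof (rule antisym)
  show "(SUP f\<in>polar p. norm (f x)) \<le> p x"
    by (rule cSUP_least) (use zero_in_polar[OF p] in \<open>auto simp: polar_def\<close>)
  obtain f where "f \<in> Y" "\<forall>x. norm (f x) \<le> p x" "norm (f x) = p x"
    using dual_Hahn_Banach[OF p, of x] by blast
  then have "f \<in> polar p" "polar p \<noteq> {}" "norm (f x) = p x" using dualD(1) by (auto simp: polar_def)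
  then show "p x \<le> (SUP f\<in>polar p. norm (f x))"
    using cSUP_upper[of f "polar p" "\<lambda>f. norm (f x)"]
      mackey_generator_seminorm(2)[OF polar_subset[OF p] compact_polar, of x] by auto
qed

lemma absolutely_convex_polar: "absolutely_convex_functionals (polar p)"
  unfolding absolutely_convex_functionals_def
proof (intro ballI allI impI)
  fix f g and a b :: 'k assume f: "f \<in> polar p" and g: "g \<in> polar p" and ab: "norm a + norm b \<le> 1"
  note l = dual_linear(1,2)[of f] dual_linear(1,2)[of g]
  have "norm (a * f x + b * g x) \<le> p x" for x
  proof -
    have "norm (f x) \<le> p x" using f by (simp add: polar_def)
    then have "0 \<le> p x" using norm_ge_zero[of "f x"] by linarith
    have "norm (a * f x + b * g x) \<le> norm a * norm (f x) + norm b * norm (g x)"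
      by (metis norm_mult norm_triangle_ineq)
    also have "\<dots> \<le> norm a * p x + norm b * p x"
      using f g by (intro add_mono mult_left_mono) (auto simp: polar_def)
    also have "\<dots> \<le> 1 * p x" unfolding distrib_right[symmetric] using ab \<open>0 \<le> p x\<close> by (rule mult_right_mono)
    finally show ?thesis by simp
  qed
  moreover have "Vector_Spaces.linear smul (*) (\<lambda>x. a * f x + b * g x)"
    unfolding linear_functional_iff[OF ns] using f g l by (auto simp: polar_def algebra_simps)
  ultimately show "(\<lambda>x. a * f x + b * g x) \<in> polar p" by (simp add: polar_def)
qed

text \<open>The generators of the Mackey topology turn out to be precisely the tight seminorms: the
  strong Mackey property makes each generator tight, and a tight seminorm is the generator given by
  its own polar.\<close>

lemma mackey_if_strong_mackey:
  assumes sm: "strong_mackey_space smul \<gamma>"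
  shows "mackey_space smul \<gamma>"
proof -
  let ?Q = "{(\<lambda>x. SUP f\<in>H. norm (f x)) | H.
        H \<noteq> {} \<and> compactin (weak_star_topology Y) H \<and> absolutely_convex_functionals H}"
  have Qt: "tight q" if "q \<in> ?Q" for q
    using that sm unfolding strong_mackey_space_def compactin_weak_star_iff
    by (auto intro!: tight_if_equicontinuous_functionals)
  have tQ: "p \<in> ?Q" if "tight p" for p
  proof (intro CollectI exI conjI)
    show "p = (\<lambda>x. SUP f\<in>polar p. norm (f x))" using SUP_polar[OF that] by simp
    show "polar p \<noteq> {}" using zero_in_polar[OF that] by blast
  qed (use absolutely_convex_polar compact_polar polar_subset[OF that] in \<open>auto simp: compactin_weak_star_iff\<close>)
  have "?Q = Collect tight" using Qt tQ by blast
  then show ?thesis unfolding mackey_space_def mackey_topology_def using gamma_eq by simp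
qed

lemma mackey_tight:
  assumes m: "mackey_space smul \<gamma>" and H: "H \<subseteq> Y" "compact H" "H \<noteq> {}" "absolutely_convex_functionals H"
  shows "tight (\<lambda>x. SUP f\<in>H. norm (f x))"
proof -
  let ?p = "\<lambda>x. SUP f\<in>H. norm (f x)"
  have sn: "seminorm smul ?p" by (rule mackey_generator_seminorm(1)[OF H(1-3)])
  have "?p \<in> {(\<lambda>x. SUP f\<in>H. norm (f x)) | H.
        H \<noteq> {} \<and> compactin (weak_star_topology Y) H \<and> absolutely_convex_functionals H}"
    using H by (intro CollectI exI[of _ H]) (simp add: compactin_weak_star_iff)
  then have "openin (mackey_topology Y) {y. ?p (y - 0) < e}" if "e > 0" for e
    unfolding mackey_topology_def using that by (rule openin_seminorm_ball)
  then have "openin \<gamma> {y. ?p (y - 0) < e}" if "e > 0" for e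
    using that by (subst m[unfolded mackey_space_def])
  then show ?thesis
    by (intro tight_if_small_on_gamma_nbhds[OF sn] exI[of _ "{y. ?p (y - 0) < e}" for e])
      (auto simp: sn_zero[OF sn])
qed

lemma absolutely_convex_comp:
  "absolutely_convex_functionals (H :: ('b \<Rightarrow> 'k) set) \<Longrightarrow> absolutely_convex_functionals ((\<lambda>f x. f (T x)) ` H)"
  unfolding absolutely_convex_functionals_def
proof (intro ballI allI impI)
  fix f g :: "'c \<Rightarrow> 'k" and a b :: 'k
  assume H: "\<forall>f\<in>H. \<forall>g\<in>H. \<forall>a b. norm a + norm b \<le> 1 \<longrightarrow> (\<lambda>x. a * f x + b * g x) \<in> H"
    and fg: "f \<in> (\<lambda>f x. f (T x)) ` H" "g \<in> (\<lambda>f x. f (T x)) ` H" and ab: "norm a + norm b \<le> 1"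
  obtain f' g' where "f' \<in> H" "g' \<in> H" "f = (\<lambda>x. f' (T x))" "g = (\<lambda>x. g' (T x))" using fg by blast
  then show "(\<lambda>x. a * f x + b * g x) \<in> (\<lambda>f x. f (T x)) ` H"
    using H ab by (intro image_eqI[of _ _ "\<lambda>x. a * f' x + b * g' x"]) auto
qed

lemma compact_comp:
  assumes "compact (H :: ('a \<Rightarrow> 'k) set)" shows "compact ((\<lambda>f x. f (T x)) ` H)"
  by (intro compact_continuous_image[OF _ assms] continuous_on_coordinatewise_then_product
      continuous_on_subset[OF continuous_on_product_coordinates]) auto

text \<open>Composition with \<open>T\<close> carries the polar of \<open>p\<close> to an absolutely
  convex compact subset of the dual, and the Mackey seminorm of this image is \<open>p\<close>
  composed with \<open>T\<close>.\<close>

lemma mackey_continuous_operator: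
  assumes m: "mackey_space smul \<gamma>" and lin: "Vector_Spaces.linear smul smul T"
    and dual: "\<And>f. f \<in> Y \<Longrightarrow> (\<lambda>x. f (T x)) \<in> Y"
  shows "T \<in> continuous_operators smul \<gamma>"
  unfolding continuous_operator_gamma_iff
proof (intro conjI lin allI impI)
  fix p assume p: "tight p"
  let ?H = "(\<lambda>f x. f (T x)) ` polar p"
  have "tight (\<lambda>x. SUP f\<in>?H. norm (f x))"
    by (rule mackey_tight[OF m _ compact_comp[OF compact_polar] _ absolutely_convex_comp[OF absolutely_convex_polar]])
      (use zero_in_polar[OF p] polar_subset[OF p] dual in auto)
  then show "tight (\<lambda>x. p (T x))" by (simp add: image_image SUP_polar[OF p])
qed

section \<open>Weakly continuous operators and completeness of the norm\<close>

lemma topspace_weak [simp]: "topspace (weak_topology Y) = UNIV"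
proof -
  have "(\<lambda>x. 0) \<in> Y" using zero_in_polar[OF tight_zero] polar_subset[OF tight_zero] by blast
  then have "UNIV \<in> {f -` U | f U. f \<in> Y \<and> open U}" by blast
  then show ?thesis unfolding weak_topology_def topology_generated_by_topspace by blast
qed

lemma gamma_finer_weak: "finer_top \<gamma> (weak_topology Y)"
  unfolding finer_top_iff_continuous_id[OF topspace_gamma topspace_weak] unfolding weak_topology_def
proof (rule continuous_on_generated_topo)
  fix U assume "U \<in> {f -` U | f U. f \<in> Y \<and> open U}"
  then obtain f V where "f \<in> Y" "open V" "U = f -` V" by blast
  then show "openin \<gamma> (id -` U \<inter> topspace \<gamma>)"
    using openin_continuous_map_preimage[OF dualD(2)[of f], of V] by (simp add: vimage_def)
next
  show "id ` topspace \<gamma> \<subseteq> \<Union>{f -` U | f U. f \<in> Y \<and> open U}"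
    using topspace_weak unfolding weak_topology_def topology_generated_by_topspace by simp
qed

lemma weak_continuous_operatorI:
  assumes lin: "Vector_Spaces.linear smul smul T" and dual: "\<And>f. f \<in> Y \<Longrightarrow> (\<lambda>x. f (T x)) \<in> Y"
  shows "T \<in> continuous_operators smul (weak_topology Y)"
proof -
  have "continuous_map (weak_topology Y) (topology_generated_by {f -` U | f U. f \<in> Y \<and> open U}) T"
  proof (rule continuous_on_generated_topo)
    fix U assume "U \<in> {f -` U | f U. f \<in> Y \<and> open U}"
    then obtain f V where f: "f \<in> Y" "open V" "U = f -` V" by blast
    have "T -` U \<in> {f -` U | f U. f \<in> Y \<and> open U}"
      using dual[OF f(1)] f(2,3) by (intro CollectI exI[of _ "\<lambda>x. f (T x)"] exI[of _ V]) auto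
    then show "openin (weak_topology Y) (T -` U \<inter> topspace (weak_topology Y))"
      unfolding topspace_weak Int_UNIV_right unfolding weak_topology_def by (rule topology_generated_by_Basis)
  next
    show "T ` topspace (weak_topology Y) \<subseteq> \<Union>{f -` U | f U. f \<in> Y \<and> open U}"
      using topspace_weak unfolding weak_topology_def topology_generated_by_topspace by simp
  qed
  then show ?thesis using lin by (simp add: continuous_operators_def weak_topology_def)
qed

lemma weak_continuous_operatorD:
  assumes T: "T \<in> continuous_operators smul (weak_topology Y)" and f: "f \<in> Y"
  shows "(\<lambda>x. f (T x)) \<in> Y"
proof -
  have l: "Vector_Spaces.linear smul smul T" and c: "continuous_map (weak_topology Y) (weak_topology Y) T"
    using T by (auto simp: continuous_operators_def)
  have "continuous_map \<gamma> euclidean (\<lambda>x. f (T x))"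
    unfolding continuous_map_def
  proof (intro conjI allI impI)
    fix V :: "'k set" assume "openin euclidean V"
    then have V: "open V" by simp
    have "openin (weak_topology Y) (f -` V)"
      unfolding weak_topology_def by (rule topology_generated_by_Basis) (use f V in blast)
    then have "openin (weak_topology Y) {x. T x \<in> f -` V}"
      using openin_continuous_map_preimage[OF c] by fastforce
    then show "openin \<gamma> {x \<in> topspace \<gamma>. f (T x) \<in> V}" using gamma_finer_weak by (simp add: finer_top_def)
  qed simp
  moreover have "Vector_Spaces.linear smul (*) (\<lambda>x. f (T x))"
    unfolding linear_functional_iff[OF ns]
    by (simp add: linear_operatorD(1,2)[OF l] dual_linear(1,2)[OF dualD(1)[OF f]])
  ultimately show ?thesis by (simp add: top_dual_def)
qed

text \<open>A norm Cauchy sequence is \<gamma>-Cauchy, as \<gamma> is coarser than the norm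
  topology. The \<gamma>-limit is a norm limit because each \<open>p\<close> in \<open>P\<close>
  inherits the Cauchy estimate in the limit, with a bound independent of \<open>p\<close>.\<close>

lemma complete_if_sequentially_complete:
  assumes sc: "sequentially_complete \<gamma>"
  shows "complete (UNIV :: 'a set)"
  unfolding complete_def
proof (intro allI impI)
  fix xs :: "nat \<Rightarrow> 'a" assume "(\<forall>n. xs n \<in> UNIV) \<and> Cauchy xs"
  then have C: "Cauchy xs" by simp
  have "\<exists>N::nat. \<forall>m\<ge>N. \<forall>n\<ge>N. xs m - xs n \<in> U" if U: "openin \<gamma> U \<and> 0 \<in> U" for U
  proof -
    obtain d where d: "d > 0" "ball 0 d \<subseteq> U" using open_if_gamma U by (meson open_contains_ball)
    obtain N where "\<And>m n. m \<ge> N \<Longrightarrow> n \<ge> N \<Longrightarrow> norm (xs m - xs n) < d" using CauchyD[OF C d(1)] by blast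
    then show ?thesis using d(2) by (intro exI[of _ N]) (auto intro!: subsetD[OF d(2)])
  qed
  then obtain x where x: "limitin \<gamma> xs x sequentially" using sc unfolding sequentially_complete_def by blast
  have "xs \<longlonglongrightarrow> x"
  proof (rule LIMSEQ_I)
    fix e :: real assume e: "e > 0"
    then have "e / 2 > 0" by simp
    then obtain N where N: "\<And>m n. m \<ge> N \<Longrightarrow> n \<ge> N \<Longrightarrow> norm (xs m - xs n) < e / 2"
      using CauchyD[OF C] by blast
    have "norm (xs n - x) \<le> e / 2" if n: "n \<ge> N" for n
    proof (rule norm_le_if_P)
      fix p assume p: "p \<in> P"
      have "(\<lambda>m. e / 2 + p (xs m - x)) \<longlonglongrightarrow> e / 2 + 0"
        using x tight_P[OF p] unfolding limitin_gamma_iff by (intro tendsto_add tendsto_const) blast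
      moreover have "p (xs n - x) \<le> e / 2 + p (xs m - x)" if "m \<ge> N" for m
        using sn_add[OF P_seminorm[OF p], of "xs n - xs m" "xs m - x"] P_le_norm[OF p, of "xs n - xs m"]
          N[OF n that] by simp
      ultimately show "p (xs n - x) \<le> e / 2" by (intro LIMSEQ_le_const) auto
    qed
    then show "\<exists>no. \<forall>n\<ge>no. norm (xs n - x) < e" using e by (intro exI[of _ N]) force
  qed
  then show "\<exists>l\<in>UNIV. xs \<longlonglongrightarrow> l" by blast
qed

end

section \<open>Growth of semigroups and cosine families\<close>

locale mixed_family = mixed_space smul \<tau> \<gamma> P
  for smul :: "'k::real_or_complex \<Rightarrow> 'a::real_normed_vector \<Rightarrow> 'a" and \<tau> \<gamma> P +
  fixes S :: "real \<Rightarrow> 'a \<Rightarrow> 'a"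
  assumes S: "semigroup_on smul S \<or> cosine_family_on smul S"
begin

lemma S_linear: "t \<ge> 0 \<Longrightarrow> Vector_Spaces.linear smul smul (S t)"
  using S by (auto simp: semigroup_on_def cosine_family_on_def)

lemmas S_simps = linear_operatorD[OF S_linear]

lemma S_exp_linear: "t \<ge> 0 \<Longrightarrow> Vector_Spaces.linear smul smul (\<lambda>x. exp (\<alpha> * t) *\<^sub>R S t x)"
  unfolding linear_operator_iff[OF ns]
  by (simp add: S_simps smul_simps scaleR_add_right)

text \<open>One inequality for both cases: a semigroup satisfies it with room to spare, and for a
  cosine family it is the functional equation solved for \<open>S (t + 1) x\<close>. Afterwards the
  two cases need not be distinguished for growth estimates.\<close>

lemma S_recursion:
  assumes t: "t \<ge> 1"
  shows "norm (S (t + 1) x) \<le> 2 * norm (S t (S 1 x)) + norm (S (t - 1) x)"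
  using S
proof
  assume "semigroup_on smul S"
  then have "S (t + 1) x = S t (S 1 x)" using t unfolding semigroup_on_def
    by (metis comp_apply order_trans zero_le_one)
  then show ?thesis by (simp add: add_increasing2)
next
  assume "cosine_family_on smul S"
  then have "smul 2 (S t (S 1 x)) = S (t + 1) x + S (t - 1) x"
    using t unfolding cosine_family_on_def by auto
  then have "S (t + 1) x = 2 *\<^sub>R S t (S 1 x) - S (t - 1) x"
    using smul_simps(1)[of 2 "S t (S 1 x)"] by (simp add: algebra_simps)
  then show ?thesis using norm_triangle_ineq4[of "2 *\<^sub>R S t (S 1 x)" "S (t - 1) x"] by simp
qed

lemma exponential_bound:
  assumes C: "\<And>t x. 0 \<le> t \<Longrightarrow> t \<le> 2 \<Longrightarrow> norm (S t x) \<le> C * norm x"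
  obtains M \<omega> where "M \<ge> 1" "\<omega> \<ge> 0" "\<And>t x. t \<ge> 0 \<Longrightarrow> norm (S t x) \<le> M * exp (\<omega> * t) * norm x"
proof -
  define M where "M = max C 1"
  have M: "M \<ge> 1" "\<And>t x. 0 \<le> t \<Longrightarrow> t \<le> 2 \<Longrightarrow> norm (S t x) \<le> M * norm x"
  proof -
    fix t :: real and x assume "0 \<le> t" "t \<le> 2"
    then have "norm (S t x) \<le> C * norm x" by (rule C)
    also have "\<dots> \<le> M * norm x" by (intro mult_right_mono) (auto simp: M_def)
    finally show "norm (S t x) \<le> M * norm x" .
  qed (simp add: M_def)
  \<comment> \<open>Each unit of time costs a factor \<open>3 * M\<close>: two parts from
    \<open>2 * norm (S (t - 1) (S 1 x))\<close> with \<open>norm (S 1 x) \<le> M * norm x\<close>,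
    one from the remaining term, as \<open>M \<ge> 1\<close>. The base interval has length 2 because
    the recursion reaches back two units.\<close>
  have *: "\<forall>t x. 0 \<le> t \<and> t \<le> real n + 2 \<longrightarrow> norm (S t x) \<le> M * (3 * M) ^ n * norm x" for n
  proof (induction n)
    case (Suc n)
    show ?case
    proof (intro allI impI)
      fix t x assume t: "0 \<le> t \<and> t \<le> real (Suc n) + 2"
      let ?c = "M * (3 * M) ^ n"
      have c: "?c \<ge> 0" "?c * (3 * M) = M * (3 * M) ^ Suc n" using M(1) by auto
      show "norm (S t x) \<le> M * (3 * M) ^ Suc n * norm x"
      proof (cases "t \<le> real n + 2")
        case True
        then have "norm (S t x) \<le> ?c * norm x" using Suc t by blast
        also have "\<dots> \<le> (?c * (3 * M)) * norm x"
          using M(1) c(1) mult_left_mono[of 1 "3 * M" ?c] by (intro mult_right_mono) auto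
        finally show ?thesis unfolding c(2) .
      next
        case False
        then have "t - 1 \<ge> 1" by simp
        then have "norm (S t x) \<le> 2 * norm (S (t - 1) (S 1 x)) + norm (S (t - 1 - 1) x)"
          using S_recursion[of "t - 1" x] by simp
        also have "norm (S (t - 1) (S 1 x)) \<le> ?c * norm (S 1 x)" using Suc t False by auto
        also have "norm (S 1 x) \<le> M * norm x" by (rule M(2)) auto
        also have "norm (S (t - 1 - 1) x) \<le> ?c * norm x" using Suc t False by auto
        finally have "norm (S t x) \<le> 2 * (?c * (M * norm x)) + ?c * norm x"
          using c(1) by (simp add: mult_left_mono)
        also have "?c * norm x \<le> ?c * (M * norm x)"
          using c(1) M(1) mult_right_mono[of 1 M "norm x"] by (intro mult_left_mono) auto
        finally show ?thesis using c(2) by (simp add: algebra_simps)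
      qed
    qed
  qed (use M(2) in simp)
  define \<omega> where "\<omega> = ln (3 * M)"
  have w: "\<omega> \<ge> 0" using M(1) by (simp add: \<omega>_def)
  have "norm (S t x) \<le> M * exp (\<omega> * t) * norm x" if t: "t \<ge> 0" for t x
  proof -
    define n where "n = nat \<lfloor>t\<rfloor>"
    have n: "real n \<le> t" "t \<le> real n + 2" using t by (simp_all add: n_def) linarith
    have "norm (S t x) \<le> M * (3 * M) ^ n * norm x" using * t n(2) by blast
    also have "(3 * M) ^ n = exp (\<omega> * real n)"
    proof -
      have "exp \<omega> = 3 * M" using M(1) by (simp add: \<omega>_def)
      then show ?thesis by (metis exp_of_nat_mult mult.commute)
    qed
    also have "M * exp (\<omega> * real n) * norm x \<le> M * exp (\<omega> * t) * norm x"
      using M(1) w n(1) by (intro mult_right_mono mult_left_mono) (auto intro: mult_left_mono)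
    finally show ?thesis .
  qed
  then show ?thesis using that M(1) w by blast
qed

lemma exponentially_bounded_if_locally:
  assumes "locally_family (bounded_family smul) S"
  shows "exponentially_family (bounded_family smul) S"
proof -
  have "bounded_family smul {0..2} S" using assms by (simp add: locally_family_def)
  then obtain C where "\<forall>t\<in>{0..2}. \<forall>x. norm (S t x) \<le> C * norm x"
    using bounded_family_iff[of "{0..2}" S] S_linear by auto
  then obtain M \<omega> where M: "M \<ge> 1" "\<And>t x. t \<ge> 0 \<Longrightarrow> norm (S t x) \<le> M * exp (\<omega> * t) * norm x"
    using exponential_bound[of C thesis] by auto
  have "norm (exp (- \<omega> * t) *\<^sub>R S t x) \<le> M * norm x" if "t \<ge> 0" for t x
  proof -
    have "norm (exp (- \<omega> * t) *\<^sub>R S t x) \<le> exp (- \<omega> * t) * (M * exp (\<omega> * t) * norm x)"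
      using M(2)[OF that] by (simp add: mult_left_mono)
    also have "\<dots> = M * norm x" by (simp add: exp_minus field_simps)
    finally show ?thesis .
  qed
  then have "bounded_family smul {0..} (\<lambda>t x. exp (- \<omega> * t) *\<^sub>R S t x)"
    using M(1) S_exp_linear[of _ "- \<omega>"] by (subst bounded_family_iff) (auto intro!: exI[of _ M])
  then show ?thesis unfolding exponentially_family_def by blast
qed

lemma locally_bounded_if_locally_equicontinuous:
  assumes "locally_family (equicontinuous_family smul \<gamma>) S"
  shows "locally_family (bounded_family smul) S"
  unfolding locally_family_def
proof (intro allI impI)
  fix M :: "real set" assume M: "compact M \<and> M \<subseteq> {0..}"
  then have e: "equicontinuous_family smul \<gamma> M S" using assms by (simp add: locally_family_def)
  have l: "Vector_Spaces.linear smul smul (S t)" if "t \<in> M" for t using M that S_linear by auto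
  show "bounded_family smul M S"
    using uniform_bound_if_equicontinuous[of M S, OF l e] bounded_family_iff[of M S, OF l] by simp
qed

lemma bounded_operators_if_locally_bounded:
  assumes "locally_family (bounded_family smul) S"
  shows "family_in (bounded_operators smul) {0..} S"
  unfolding family_in_def
proof
  fix t :: real assume "t \<in> {0..}"
  then have "bounded_family smul {t} S" using assms by (simp add: locally_family_def)
  then show "S t \<in> bounded_operators smul" by (simp add: bounded_family_def family_in_def)
qed

text \<open>On a compact set of times the weight is bounded below by a positive constant;
  \<open>c\<close> is its reciprocal and hence the same for all seminorms.\<close>

lemma exponential_weight_bound:
  assumes M: "compact M" "M \<subseteq> {0..}"
  obtains c where "c > 0"
    "\<And>p t x. seminorm smul p \<Longrightarrow> t \<in> M \<Longrightarrow> p (S t x) \<le> c * p (exp (\<alpha> * t) *\<^sub>R S t x)"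
proof -
  obtain b where b: "\<And>t. t \<in> M \<Longrightarrow> norm t \<le> b" using compact_imp_bounded[OF M(1)] by (metis bounded_iff)
  have "p (S t x) \<le> exp (\<bar>\<alpha>\<bar> * b) * p (exp (\<alpha> * t) *\<^sub>R S t x)"
    if p: "seminorm smul p" and t: "t \<in> M" for p t x
  proof -
    have "\<bar>\<alpha>\<bar> * \<bar>t\<bar> \<le> \<bar>\<alpha>\<bar> * b" using b[OF t] by (intro mult_left_mono) auto
    then have "- (\<alpha> * t) \<le> \<bar>\<alpha>\<bar> * b" using abs_ge_minus_self[of "\<alpha> * t"] by (simp add: abs_mult)
    then have "1 \<le> exp (\<bar>\<alpha>\<bar> * b) * exp (\<alpha> * t)" by (simp flip: exp_add)
    from mult_right_mono[OF this sn_nonneg[OF p, of "S t x"]] show ?thesis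
      by (simp add: sn_scaleR[OF p] mult.assoc)
  qed
  then show ?thesis by (intro that[of "exp (\<bar>\<alpha>\<bar> * b)"]) simp_all
qed

lemma locally_equicontinuous_if_exponentially:
  assumes "exponentially_family (equicontinuous_family smul \<gamma>) S"
  shows "locally_family (equicontinuous_family smul \<gamma>) S"
  unfolding locally_family_def equicontinuous_family_iff
proof (intro allI impI)
  fix M :: "real set" and p assume M: "compact M \<and> M \<subseteq> {0..}" and p: "tight p"
  obtain \<alpha> where "equicontinuous_family smul \<gamma> {0..} (\<lambda>t x. exp (\<alpha> * t) *\<^sub>R S t x)"
    using assms by (auto simp: exponentially_family_def)
  then obtain q where q: "tight q" "\<And>t x. t \<ge> 0 \<Longrightarrow> p (exp (\<alpha> * t) *\<^sub>R S t x) \<le> q x"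
    using p unfolding equicontinuous_family_iff by auto
  obtain c where c: "c > 0"
    "\<And>p t x. seminorm smul p \<Longrightarrow> t \<in> M \<Longrightarrow> p (S t x) \<le> c * p (exp (\<alpha> * t) *\<^sub>R S t x)"
    by (rule exponential_weight_bound[of M]) (use M in auto)
  have "p (S t x) \<le> c * q x" if t: "t \<in> M" for t x
  proof -
    have "p (S t x) \<le> c * p (exp (\<alpha> * t) *\<^sub>R S t x)" by (rule c(2)[OF tight_seminorm[OF p] t])
    also have "\<dots> \<le> c * q x" using q(2) M t c(1) by (intro mult_left_mono) auto
    finally show ?thesis .
  qed
  moreover have "tight (\<lambda>x. c * q x)" using c(1) by (intro tight_scale q(1)) simp
  ultimately show "\<exists>q. tight q \<and> (\<forall>t\<in>M. \<forall>x. p (S t x) \<le> q x)" by blast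
qed

text \<open>With the weight \<open>exp (- (\<omega> + 1) t)\<close> the tail \<open>t \<ge> N\<close> is at most a multiple of
  \<open>exp (- N) \<parallel>\<cdot>\<parallel>\<close>, which tightness absorbs.\<close>

lemma exponentially_equicontinuous_if_locally:
  assumes loc: "locally_family (equicontinuous_family smul \<gamma>) S"
  shows "exponentially_family (equicontinuous_family smul \<gamma>) S"
proof -
  have "bounded_family smul {0..2} S"
    using locally_bounded_if_locally_equicontinuous[OF loc] by (simp add: locally_family_def)
  then obtain C where "\<forall>t\<in>{0..2}. \<forall>x. norm (S t x) \<le> C * norm x"
    using bounded_family_iff[of "{0..2}" S] S_linear by auto
  then obtain M \<omega> where M: "M \<ge> 1" "\<omega> \<ge> 0" "\<And>t x. t \<ge> 0 \<Longrightarrow> norm (S t x) \<le> M * exp (\<omega> * t) * norm x"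
    using exponential_bound[of C thesis] by auto
  have "equicontinuous_family smul \<gamma> {0..} (\<lambda>t x. exp (- (\<omega> + 1) * t) *\<^sub>R S t x)"
  proof (rule equicontinuous_familyI)
    fix p and \<epsilon> :: real assume p: "tight p" and e: "\<epsilon> > 0"
    note ps = tight_seminorm[OF p]
    obtain B where B: "B \<ge> 0" "\<And>x. p x \<le> B * norm x" by (rule tight_bound[OF p]) blast
    \<comment> \<open>Combined with \<open>exp N \<ge> N\<close>, this makes the tail constant
      \<open>B * M * exp (- N)\<close> at most \<epsilon>.\<close>
    obtain N :: nat where N: "B * M / \<epsilon> \<le> real N" using real_arch_simple by blast
    have eN: "B * M * exp (- real N) \<le> \<epsilon>"
    proof -
      have "real N \<le> exp (real N)" using exp_ge_add_one_self[of "real N"] by linarith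
      then have "B * M \<le> \<epsilon> * exp (real N)" using N e by (simp add: field_simps) (meson order_trans mult_left_mono less_imp_le)
      then show ?thesis by (simp add: exp_minus field_simps)
    qed
    have "equicontinuous_family smul \<gamma> {0..real N} S" using loc by (auto simp: locally_family_def)
    then obtain r where r: "tight r" "\<And>t x. 0 \<le> t \<Longrightarrow> t \<le> real N \<Longrightarrow> p (S t x) \<le> r x"
      using p unfolding equicontinuous_family_iff by fastforce
    have "p (exp (- (\<omega> + 1) * t) *\<^sub>R S t x) \<le> r x + \<epsilon> * norm x" if t: "t \<ge> 0" for t x
    proof -
      have eq: "p (exp (- (\<omega> + 1) * t) *\<^sub>R S t x) = exp (- (\<omega> + 1) * t) * p (S t x)"
        by (simp add: sn_scaleR[OF ps])
      have nn: "p (S t x) \<ge> 0" "r x \<ge> 0" using sn_nonneg[OF ps] sn_nonneg[OF tight_seminorm[OF r(1)]] by auto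
      show ?thesis
      proof (cases "t \<le> real N")
        case True
        have "- (\<omega> + 1) * t \<le> 0" using M(2) t by (intro mult_nonpos_nonneg) auto
        then have "exp (- (\<omega> + 1) * t) * p (S t x) \<le> 1 * p (S t x)" using nn by (intro mult_right_mono) auto
        also have "\<dots> \<le> r x" using r(2)[OF t True] by simp
        finally show ?thesis using eq e by (simp add: add_increasing2)
      next
        case False
        have "exp (- (\<omega> + 1) * t) * p (S t x) \<le> exp (- (\<omega> + 1) * t) * (B * (M * exp (\<omega> * t) * norm x))"
          using B(2)[of "S t x"] mult_left_mono[OF M(3)[OF t, of x] B(1)] by (intro mult_left_mono) auto
        also have "\<dots> = B * M * (exp (- (\<omega> + 1) * t) * exp (\<omega> * t)) * norm x" by (simp only: mult_ac)
        also have "exp (- (\<omega> + 1) * t) * exp (\<omega> * t) = exp (- t)" by (simp add: algebra_simps flip: exp_add)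
        finally have "exp (- (\<omega> + 1) * t) * p (S t x) \<le> B * M * exp (- t) * norm x" .
        also have "\<dots> \<le> B * M * exp (- real N) * norm x"
          using False B(1) M(1) by (intro mult_right_mono mult_left_mono) auto
        also have "\<dots> \<le> \<epsilon> * norm x" using eN by (intro mult_right_mono) auto
        finally show ?thesis using eq nn(2) by simp
      qed
    qed
    then show "\<exists>r. tight r \<and> (\<forall>t\<in>{0..}. \<forall>x. p (exp (- (\<omega> + 1) * t) *\<^sub>R S t x) \<le> r x + \<epsilon> * norm x)"
      using r(1) by auto
  qed (use S_exp_linear in auto)
  then show ?thesis unfolding exponentially_family_def by blast
qed

lemma exponentially_iff_locally:
  "exponentially_family (equicontinuous_family smul \<gamma>) S \<longleftrightarrow>
     locally_family (equicontinuous_family smul \<gamma>) S"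
  using exponentially_equicontinuous_if_locally locally_equicontinuous_if_exponentially by blast

lemma locally_equitight_if_exponentially:
  assumes "exponentially_family (equitight_family P) S"
  shows "locally_family (equitight_family P) S"
  unfolding locally_family_def equitight_family_def
proof (intro allI impI ballI)
  fix M :: "real set" and p and \<epsilon> :: real
  assume M: "compact M \<and> M \<subseteq> {0..}" and p: "p \<in> P" and e: "\<epsilon> > 0"
  obtain \<alpha> where a: "equitight_family P {0..} (\<lambda>t x. exp (\<alpha> * t) *\<^sub>R S t x)"
    using assms by (auto simp: exponentially_family_def)
  obtain c where c: "c > 0"
    "\<And>p t x. seminorm smul p \<Longrightarrow> t \<in> M \<Longrightarrow> p (S t x) \<le> c * p (exp (\<alpha> * t) *\<^sub>R S t x)"
    by (rule exponential_weight_bound[of M]) (use M in auto)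
  have "\<epsilon> / c > 0" using e c(1) by simp
  from equitight_familyD[OF a p this]
  obtain q K where q: "q \<in> P" "K \<ge> 0"
    "\<forall>t\<in>{0..}. \<forall>x. p (exp (\<alpha> * t) *\<^sub>R S t x) \<le> K * q x + \<epsilon> / c * norm x" by blast
  have "p (S t x) \<le> (c * K) * q x + \<epsilon> * norm x" if t: "t \<in> M" for t x
  proof -
    have "p (S t x) \<le> c * p (exp (\<alpha> * t) *\<^sub>R S t x)" by (rule c(2)[OF P_seminorm[OF p] t])
    also have "\<dots> \<le> c * (K * q x + \<epsilon> / c * norm x)" using q(3) M t c(1) by (intro mult_left_mono) auto
    also have "\<dots> = (c * K) * q x + \<epsilon> * norm x" using c(1) by (simp add: field_simps)
    finally show ?thesis .
  qed
  then show "\<exists>q\<in>P. \<exists>K\<ge>0. \<forall>t\<in>M. \<forall>x. p (S t x) \<le> K * q x + \<epsilon> * norm x"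
    using q c(1) by (intro bexI[of _ q] exI[of _ "c * K"]) auto
qed

text \<open>The constants of equitightness depend on the seminorm and give no uniform norm bound.
  Orbits over compact sets are norm bounded, and completeness turns this into a uniform bound by
  Banach--Steinhaus.\<close>

lemma locally_equicontinuous_if_equitight:
  assumes ban: "complete (UNIV :: 'a set)" and sc: "strongly_continuous \<gamma> {0..} S"
    and et: "locally_family (equitight_family P) S" and bo: "family_in (bounded_operators smul) {0..} S"
  shows "locally_family (equicontinuous_family smul \<gamma>) S"
  unfolding locally_family_def
proof (intro allI impI)
  fix M :: "real set" assume M: "compact M \<and> M \<subseteq> {0..}"
  have pw: "\<exists>C. \<forall>f\<in>S ` M. norm (f x) \<le> C" for x
    using strongly_continuous_bounded[OF sc, of M x] M by (auto simp: bounded_iff)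
  have bl: "bounded_linear f" if "f \<in> S ` M" for f
    using bo M that by (auto simp: family_in_def bounded_operators_def)
  obtain C where C: "C \<ge> 0" "\<And>f x. f \<in> S ` M \<Longrightarrow> norm (f x) \<le> C * norm x"
    by (rule Banach_Steinhaus[OF ban bl pw]) (assumption, (rule that; assumption))
  show "equicontinuous_family smul \<gamma> M S"
    by (rule equicontinuous_if_equitight[of M S C])
      (use M et C S_linear in \<open>auto simp: locally_family_def\<close>)
qed

section \<open>Bi-continuity and equicontinuity\<close>

lemma bi_continuous_if_equicontinuous:
  assumes sc: "strongly_continuous \<gamma> {0..} S" and eq: "locally_family (equicontinuous_family smul \<gamma>) S"
  shows "locally_bi_continuous smul \<tau> S"
  unfolding locally_bi_continuous_def
proof (intro conjI)
  note lb = locally_bounded_if_locally_equicontinuous[OF eq]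
  show "locally_family (bounded_family smul) S" by (rule lb)
  show "family_in (bounded_operators smul) {0..} S" by (rule bounded_operators_if_locally_bounded[OF lb])
  have "continuous_map \<gamma> \<tau> id" using openin_gamma_if_tau by (simp add: continuous_map_def)
  then have "continuous_map T \<tau> f" if "continuous_map T \<gamma> f" for f and T :: "real topology"
    using continuous_map_compose[OF that, of \<tau> id] by simp
  then show "strongly_continuous \<tau> {0..} S" using sc unfolding strongly_continuous_def by blast
  show "locally_family (bi_equicontinuous_family \<tau>) S"
    unfolding locally_family_def bi_equicontinuous_family_def
  proof (intro allI impI)
    fix M :: "real set" and xs :: "nat \<Rightarrow> 'a" and x U
    assume M: "compact M \<and> M \<subseteq> {0..}" and xs: "bounded (range xs) \<and> limitin \<tau> xs x sequentially"
      and U: "openin \<tau> U \<and> 0 \<in> U"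
    then have "openin \<tau> U" "0 \<in> U" by auto
    then obtain p r where p: "p \<in> P" "r > 0" "\<And>y. p (y - 0) < r \<Longrightarrow> y \<in> U"
      by (rule tau_nbhd) (rule that; assumption)
    have "equicontinuous_family smul \<gamma> M S" using M eq by (simp add: locally_family_def)
    then obtain q where q: "tight q" "\<And>t x. t \<in> M \<Longrightarrow> p (S t x) \<le> q x"
      using tight_P[OF p(1)] unfolding equicontinuous_family_iff by blast
    have "limitin \<gamma> xs x sequentially" using xs limitin_gamma_iff_tau by blast
    then have "(\<lambda>n. q (xs n - x)) \<longlonglongrightarrow> 0" using q(1) unfolding limitin_gamma_iff by blast
    then have "\<forall>\<^sub>F n in sequentially. q (xs n - x) < r" using p(2) by (rule order_tendstoD)
    then show "\<forall>\<^sub>F n in sequentially. \<forall>t\<in>M. S t (xs n - x) \<in> U"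
    proof eventually_elim
      case (elim n)
      show ?case
      proof
        fix t assume "t \<in> M"
        then show "S t (xs n - x) \<in> U" using q(2)[of t "xs n - x"] elim by (intro p(3)) simp
      qed
    qed
  qed
qed

lemma local_bound_if_bi_continuous:
  assumes bc: "locally_bi_continuous smul \<tau> S" and M: "compact M" "M \<subseteq> {0..}"
  obtains C where "C \<ge> 0" "\<And>t x. t \<in> M \<Longrightarrow> norm (S t x) \<le> C * norm x"
proof -
  have "bounded_family smul M S" using bc M by (simp add: locally_bi_continuous_def locally_family_def)
  moreover have "t \<in> M \<Longrightarrow> Vector_Spaces.linear smul smul (S t)" for t using M S_linear by auto
  ultimately have "\<exists>C\<ge>0. \<forall>t\<in>M. \<forall>x. norm (S t x) \<le> C * norm x" using bounded_family_iff[of M S] by blast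
  then show ?thesis using that by blast
qed

text \<open>Continuity on the half-line can be tested by sequences. A convergent sequence of times
  stays in a compact interval, where the operators are uniformly bounded, and \<tau>-convergence of
  a norm-bounded sequence passes to every tight seminorm.\<close>

lemma gamma_strongly_continuous_if_bi_continuous:
  assumes bc: "locally_bi_continuous smul \<tau> S"
  shows "strongly_continuous \<gamma> {0..} S"
  unfolding strongly_continuous_gamma_iff
proof (intro allI impI)
  fix x p z assume p: "tight p"
  note ps = tight_seminorm[OF p]
  show "continuous_on {0..} (\<lambda>t. p (S t x - z))"
    unfolding continuous_on_sequentially
  proof (intro allI ballI impI)
    fix ts :: "nat \<Rightarrow> real" and a assume a: "a \<in> {0..}" and ts: "(\<forall>n. ts n \<in> {0..}) \<and> ts \<longlonglongrightarrow> a"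
    obtain b where b: "\<And>n. norm (ts n) \<le> b" using ts convergent_imp_Bseq[of ts] by (auto simp: convergent_def Bseq_def)
    obtain C where C: "C \<ge> 0" "\<And>t x. t \<in> {0..max a b} \<Longrightarrow> norm (S t x) \<le> C * norm x"
      by (rule local_bound_if_bi_continuous[OF bc, of "{0..max a b}"]) auto
    have nb: "norm (S (ts n) x - S a x) \<le> 2 * C * norm x" for n
    proof -
      have "ts n \<in> {0..max a b}" "a \<in> {0..max a b}" using ts a b[of n] by auto
      then show ?thesis
        using C(2)[of "ts n" x] C(2)[of a x] norm_triangle_ineq4[of "S (ts n) x" "S a x"] by simp
    qed
    have cm: "continuous_map (top_of_set {0..}) \<tau> (\<lambda>t. S t x)"
      using bc by (simp add: locally_bi_continuous_def strongly_continuous_def)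
    have "limitin (top_of_set {0..}) ts a sequentially" using a ts by (simp add: limitin_subtopology)
    from continuous_map_limit[OF cm this]
    have tl: "limitin \<tau> (\<lambda>n. S (ts n) x) (S a x) sequentially" by (simp add: o_def)
    have A: "(\<lambda>n. p (S (ts n) x - S a x)) \<longlonglongrightarrow> 0"
      by (rule tendsto_tight_if_bounded[OF _ _ p]) (use nb tl in \<open>auto simp: limitin_tau_iff\<close>)
    have B: "norm (p (S (ts n) x - z) - p (S a x - z)) \<le> p (S (ts n) x - S a x)" for n
      using sn_abs[OF ps, of "S (ts n) x - z" "S a x - z"] by simp
    have "(\<lambda>n. p (S (ts n) x - z) - p (S a x - z)) \<longlonglongrightarrow> 0"
      by (rule Lim_null_comparison[OF always_eventually A]) (use B in blast)
    then show "((\<lambda>t. p (S t x - z)) \<circ> ts) \<longlonglongrightarrow> p (S a x - z)"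
      unfolding o_def by (rule LIM_zero_cancel)
  qed
qed

text \<open>The norms of all \<open>S t (xs n - x)\<close> are bounded by one \<open>R\<close>, so
  tightness with error \<open>e / (2 * R)\<close> reduces the claim to a seminorm in
  \<open>P\<close>, where bi-equicontinuity applies.\<close>

lemma bi_continuous_uniform:
  assumes bc: "locally_bi_continuous smul \<tau> S" and M: "compact M" "M \<subseteq> {0..}"
    and xs: "limitin \<gamma> xs x sequentially" and p: "tight p" and e: "e > 0"
  shows "\<forall>\<^sub>F n in sequentially. \<forall>t\<in>M. p (S t (xs n - x)) < e"
proof -
  obtain C where C: "C \<ge> 0" "\<And>t x. t \<in> M \<Longrightarrow> norm (S t x) \<le> C * norm x"
    by (rule local_bound_if_bi_continuous[OF bc M]) blast
  have xs': "bounded (range xs)" "limitin \<tau> xs x sequentially" using xs limitin_gamma_iff_tau by blast+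
  have bq: "bi_equicontinuous_family \<tau> M S"
    using bc M by (simp add: locally_bi_continuous_def locally_family_def)
  obtain B where B: "\<And>n. norm (xs n) \<le> B" using xs'(1) by (auto simp: bounded_iff)
  define R where "R = C * (\<bar>B\<bar> + norm x) + 1"
  have R: "R > 0" using C(1) by (simp add: R_def add_nonneg_pos)
  have nb: "norm (S t (xs n - x)) \<le> R" if "t \<in> M" for t n
  proof -
    have "norm (S t (xs n - x)) \<le> C * norm (xs n - x)" by (rule C(2)[OF that])
    also have "\<dots> \<le> C * (\<bar>B\<bar> + norm x)"
      using C(1) B[of n] norm_triangle_ineq4[of "xs n" x] by (intro mult_left_mono) linarith+
    finally show ?thesis by (simp add: R_def)
  qed
  have "e / (2 * R) > 0" using e R by simp
  then obtain q K where q: "q \<in> P" "K \<ge> 0" "\<And>x. p x \<le> K * q x + e / (2 * R) * norm x"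
    by (rule tightE[OF p]) blast
  let ?U = "{y. q (y - 0) < e / (2 * (K + 1))}"
  have "openin \<tau> ?U" "0 \<in> ?U"
    using openin_seminorm_ball[OF q(1), of "e / (2 * (K + 1))" 0] q(2) e sn_zero[OF P_seminorm[OF q(1)]]
    by (auto simp: tau_eq)
  then have "\<forall>\<^sub>F n in sequentially. \<forall>t\<in>M. S t (xs n - x) \<in> ?U"
    using bq xs' unfolding bi_equicontinuous_family_def by blast
  then show ?thesis
  proof eventually_elim
    case (elim n)
    show ?case
    proof
      fix t assume t: "t \<in> M"
      let ?z = "S t (xs n - x)"
      have "(K + 1) * q ?z < e / 2" using elim t q(2) by (simp add: field_simps)
      then have "K * q ?z < e / 2" using sn_nonneg[OF P_seminorm[OF q(1)], of ?z] by (simp add: algebra_simps)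
      moreover have "e / (2 * R) * norm ?z \<le> e / (2 * R) * R"
        using nb[OF t] e R by (intro mult_left_mono) auto
      moreover have "e / (2 * R) * R = e / 2" using R by simp
      ultimately show "p ?z < e" using q(3)[of ?z] by linarith
    qed
  qed
qed

text \<open>The candidate is the supremum of \<open>p (S t x)\<close> over \<open>t\<close>. Its
  sublevel sets are convex, and they are sequentially open because the convergence along sequences
  is uniform in \<open>t\<close>; C-sequentiality makes them open.\<close>

lemma equicontinuous_if_bi_continuous_C_sequential:
  assumes bc: "locally_bi_continuous smul \<tau> S" and cs: "C_sequential \<gamma>"
  shows "locally_family (equicontinuous_family smul \<gamma>) S"
  unfolding locally_family_def equicontinuous_family_iff
proof (intro allI impI)
  fix M :: "real set" and p assume M: "compact M \<and> M \<subseteq> {0..}" and p: "tight p"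
  note ps = tight_seminorm[OF p]
  show "\<exists>q. tight q \<and> (\<forall>t\<in>M. \<forall>x. p (S t x) \<le> q x)"
  proof (cases "M = {}")
    case False
    obtain C where C: "C \<ge> 0" "\<And>t x. t \<in> M \<Longrightarrow> norm (S t x) \<le> C * norm x"
      by (rule local_bound_if_bi_continuous[OF bc, of M]) (use M in auto)
    obtain B where B: "B \<ge> 0" "\<And>x. p x \<le> B * norm x" by (rule tight_bound[OF p]) blast
    define q where "q = (\<lambda>x. SUP t\<in>M. p (S t x))"
    have bdd: "bdd_above ((\<lambda>t. p (S t x)) ` M)" for x
    proof (rule bdd_aboveI2)
      fix t assume "t \<in> M"
      then show "p (S t x) \<le> B * (C * norm x)"
        using B(2)[of "S t x"] mult_left_mono[OF C(2)[of t x] B(1)] by simp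
    qed
    have qsn: "seminorm smul q" unfolding q_def
      by (rule seminorm_SUP[OF False _ bdd]) (use M S_linear seminorm_comp[OF ps] in auto)
    have up: "p (S t x) \<le> q x" if "t \<in> M" for t x unfolding q_def by (rule cSUP_upper[OF that bdd])
    have op: "openin \<gamma> {x. q x < e}" for e
    proof -
      have "convex {x. q x < e}"
      proof (rule convexI)
        fix x y and u v :: real assume *: "x \<in> {x. q x < e}" "y \<in> {x. q x < e}" "0 \<le> u" "0 \<le> v" "u + v = 1"
        have "q (u *\<^sub>R x + v *\<^sub>R y) \<le> u * q x + v * q y"
          using sn_add[OF qsn, of "u *\<^sub>R x" "v *\<^sub>R y"] * by (simp add: sn_scaleR[OF qsn])
        also have "\<dots> < e" using * convex_bound_lt[of "q x" e "q y" u v] by simp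
        finally show "u *\<^sub>R x + v *\<^sub>R y \<in> {x. q x < e}" by simp
      qed
      moreover have "sequentially_open \<gamma> {x. q x < e}"
        unfolding sequentially_open_def
      proof (intro allI impI)
        fix xs x assume x: "x \<in> {x. q x < e} \<and> limitin \<gamma> xs x sequentially"
        define d where "d = (e - q x) / 2"
        have d: "d > 0" using x by (simp add: d_def)
        have "\<forall>\<^sub>F n in sequentially. \<forall>t\<in>M. p (S t (xs n - x)) < d"
          using bi_continuous_uniform[OF bc _ _ _ p d] M x by blast
        then show "\<forall>\<^sub>F n in sequentially. xs n \<in> {x. q x < e}"
        proof eventually_elim
          case (elim n)
          then have "q (xs n - x) \<le> d" unfolding q_def by (intro cSUP_least[OF False]) auto
          then have "q (xs n) \<le> d + q x" using sn_add[OF qsn, of "xs n - x" x] by simp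
          then show ?case using d by (simp add: d_def field_simps)
        qed
      qed
      ultimately show ?thesis using cs by (simp add: C_sequential_def)
    qed
    have "tight q"
      by (rule tight_if_small_on_gamma_nbhds[OF qsn]) (use op sn_zero[OF qsn] in \<open>metis mem_Collect_eq\<close>)
    then show ?thesis using up by blast
  qed (use p in blast)
qed

lemma continuous_operators_if_equicontinuous:
  assumes eq: "locally_family (equicontinuous_family smul \<gamma>) S"
  shows "family_in (continuous_operators smul \<gamma>) {0..} S"
  unfolding family_in_def continuous_operator_gamma_iff
proof (intro ballI conjI allI impI)
  fix t :: real and p assume t: "t \<in> {0..}" and p: "tight p"
  then have "equicontinuous_family smul \<gamma> {t} S" using eq by (auto simp: locally_family_def)
  then obtain q where q: "tight q" "\<And>x. p (S t x) \<le> q x" using p unfolding equicontinuous_family_iff by blast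
  show "tight (\<lambda>x. p (S t x))"
    by (rule tight_le[OF q(1) seminorm_comp[OF tight_seminorm[OF p]] q(2)]) (use t S_linear in auto)
qed (use S_linear in auto)

lemma equicontinuous_if_strong_mackey:
  assumes sm: "strong_mackey_space smul \<gamma>" and sc: "strongly_continuous \<gamma> {0..} S"
    and co: "family_in (continuous_operators smul \<gamma>) {0..} S"
  shows "locally_family (equicontinuous_family smul \<gamma>) S"
  unfolding locally_family_def equicontinuous_family_iff
proof (intro allI impI)
  fix M :: "real set" and p assume M: "compact M \<and> M \<subseteq> {0..}" and p: "tight p"
  note ps = tight_seminorm[OF p]
  show "\<exists>q. tight q \<and> (\<forall>t\<in>M. \<forall>x. p (S t x) \<le> q x)"
  proof (cases "M = {}")
    case False
    define F where "F = (\<lambda>(t, f :: 'a \<Rightarrow> 'k) x. f (S t x))"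
    define H where "H = F ` (M \<times> polar p)"
    have "continuous_on (M \<times> polar p) F"
    proof (rule continuous_on_coordinatewise_then_product)
      fix x
      show "continuous_on (M \<times> polar p) (\<lambda>tf. F tf x)"
        unfolding continuous_on_def
      proof
        fix a assume a: "a \<in> M \<times> polar p"
        obtain t0 f0 where a0: "a = (t0, f0)" by (cases a)
        \<comment> \<open>Bounds \<open>f (S t x) - f0 (S t0 x)\<close>: moving \<open>t\<close> is
          controlled by \<open>p\<close> uniformly over its polar, and moving \<open>f\<close> is
          tested at the single vector \<open>S t0 x\<close>. This yields joint continuity of
          \<open>F\<close>, hence compactness of its image.\<close>
        define g where "g = (\<lambda>tf :: real \<times> ('a \<Rightarrow> 'k). p (S (fst tf) x - S t0 x) + norm (snd tf (S t0 x) - f0 (S t0 x)))"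
        have "continuous_on {0..} (\<lambda>t. p (S t x - S t0 x))"
          using sc p unfolding strongly_continuous_gamma_iff by blast
        then have "continuous_on (M \<times> polar p) (\<lambda>tf. p (S (fst tf) x - S t0 x))"
          by (rule continuous_on_compose2[OF _ continuous_on_fst[OF continuous_on_id]]) (use M in auto)
        moreover have "continuous_on (M \<times> polar p) (\<lambda>tf :: real \<times> ('a \<Rightarrow> 'k). snd tf (S t0 x))"
          by (rule continuous_on_compose2[OF continuous_on_product_coordinates continuous_on_snd[OF continuous_on_id]]) auto
        ultimately have "continuous_on (M \<times> polar p) g"
          unfolding g_def by (intro continuous_on_add continuous_on_norm continuous_on_diff continuous_on_const)
        then have "(g \<longlongrightarrow> g a) (at a within M \<times> polar p)" using a unfolding continuous_on_def by blast
        moreover have "g a = 0" by (simp add: g_def a0 sn_zero[OF ps])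
        ultimately have A: "(g \<longlongrightarrow> 0) (at a within M \<times> polar p)" by simp
        have B: "norm (F tf x - F a x) \<le> g tf" if "tf \<in> M \<times> polar p" for tf
        proof -
          obtain t f where tf: "tf = (t, f)" by (cases tf)
          have f: "Vector_Spaces.linear smul (*) f" "norm (f (S t x - S t0 x)) \<le> p (S t x - S t0 x)"
            using that by (auto simp: tf polar_def)
          have "F tf x - F a x = f (S t x - S t0 x) + (f (S t0 x) - f0 (S t0 x))"
            by (simp add: F_def tf a0 dual_linear(3)[OF f(1)])
          then show ?thesis
            using norm_triangle_ineq[of "f (S t x - S t0 x)" "f (S t0 x) - f0 (S t0 x)"] f(2)
            by (simp add: g_def tf)
        qed
        have "((\<lambda>tf. F tf x - F a x) \<longlongrightarrow> 0) (at a within M \<times> polar p)"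
          by (rule Lim_null_comparison[OF _ A]) (simp add: eventually_at_filter B)
        then show "((\<lambda>tf. F tf x) \<longlongrightarrow> F a x) (at a within M \<times> polar p)" by (rule LIM_zero_cancel)
      qed
    qed
    then have cH: "compact H"
      unfolding H_def using M compact_polar by (intro compact_continuous_image compact_Times) auto
    have HY: "H \<subseteq> Y"
    proof
      fix h assume "h \<in> H"
      then obtain t f where tf: "t \<in> M" "f \<in> polar p" "h = (\<lambda>x. f (S t x))" by (auto simp: H_def F_def)
      have f: "Vector_Spaces.linear smul (*) f" "\<And>x. norm (f x) \<le> p x" using tf(2) by (auto simp: polar_def)
      have t: "t \<ge> 0" using tf(1) M by auto
      have "tight (\<lambda>x. p (S t x))"
        using co t p unfolding family_in_def continuous_operator_gamma_iff by auto
      then show "h \<in> Y" unfolding tf(3)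
        by (rule dualI[rotated 2])
          (use f in \<open>auto simp: linear_functional_iff[OF ns] S_simps[OF t] dual_linear(1,2)[OF f(1)]\<close>)
    qed
    have ne: "H \<noteq> {}" using False zero_in_polar[OF p] by (auto simp: H_def)
    have "equicontinuous_functionals \<gamma> H"
      using sm cH HY by (simp add: strong_mackey_space_def compactin_weak_star_iff)
    then have t: "tight (\<lambda>x. SUP f\<in>H. norm (f x))"
      by (rule tight_if_equicontinuous_functionals[OF HY cH ne])
    have "p (S t x) \<le> (SUP f\<in>H. norm (f x))" if "t \<in> M" for t x
    proof -
      \<comment> \<open>A functional in the polar attaining \<open>p\<close> at \<open>S t x\<close>
        belongs, after composition with \<open>S t\<close>, to \<open>H\<close>; so the seminorm of
        \<open>H\<close> dominates \<open>p (S t x)\<close>.\<close>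
      obtain f where "f \<in> Y" "\<forall>x. norm (f x) \<le> p x" "norm (f (S t x)) = p (S t x)"
        using dual_Hahn_Banach[OF p, of "S t x"] by blast
      then have "F (t, f) \<in> H" "norm (F (t, f) x) = p (S t x)"
        using that dualD(1) by (auto simp: H_def F_def polar_def)
      then show ?thesis
        using cSUP_upper[of "F (t, f)" H "\<lambda>f. norm (f x)"] mackey_generator_seminorm(2)[OF HY cH ne, of x] by simp
    qed
    then show ?thesis using t by blast
  qed (use p in blast)
qed

text \<open>Bi-equicontinuity for the single time \<open>t\<close> makes \<open>f\<close> composed
  with \<open>S t\<close> sequentially continuous, so the Mazur property keeps it in the dual; in a
  Mackey space this suffices for continuity of \<open>S t\<close>.\<close>

lemma continuous_operators_if_bi_continuous_Mazur:
  assumes bc: "locally_bi_continuous smul \<tau> S" and maz: "mazur_space smul \<gamma>" and m: "mackey_space smul \<gamma>"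
  shows "family_in (continuous_operators smul \<gamma>) {0..} S"
  unfolding family_in_def
proof
  fix t :: real assume "t \<in> {0..}"
  then have t: "t \<ge> 0" by simp
  show "S t \<in> continuous_operators smul \<gamma>"
  proof (rule mackey_continuous_operator[OF m S_linear[OF t]])
    fix f assume f: "f \<in> Y"
    note fl = dualD(1)[OF f]
    have lin: "Vector_Spaces.linear smul (*) (\<lambda>x. f (S t x))"
      by (simp add: linear_functional_iff[OF ns] S_simps[OF t] dual_linear(1,2)[OF fl])
    have "(\<lambda>n. f (S t (xs n))) \<longlonglongrightarrow> f (S t x)" if xs: "limitin \<gamma> xs x sequentially" for xs x
    proof (rule tendstoI)
      fix e :: real assume e: "e > 0"
      have "compact {t}" "{t} \<subseteq> {0..}" using t by auto
      from bi_continuous_uniform[OF bc this xs dualD(3)[OF f] e]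
      show "\<forall>\<^sub>F n in sequentially. dist (f (S t (xs n))) (f (S t x)) < e"
        by (simp add: dist_norm S_simps(3)[OF t] dual_linear(3)[OF fl])
    qed
    then have "continuous_map \<gamma> euclidean (\<lambda>x. f (S t x))"
      using maz lin unfolding mazur_space_def by blast
    then show "(\<lambda>x. f (S t x)) \<in> Y" using lin by (simp add: top_dual_def)
  qed
qed

end


section \<open>Laplace transforms\<close>

lemma integrable_exp_decay:
  assumes "c > 0"
  shows "integrable lborel (\<lambda>t. indicator {0..} t * exp (- c * t) :: real)"
proof -
  have "(\<lambda>t. exp (- c * t)) absolutely_integrable_on {0..}"
    by (intro nonnegative_absolutely_integrable_1 integrable_on_exp_minus_to_infinity assms) auto
  then have "integrable (completion lborel) (\<lambda>t. indicator {0..} t * exp (- c * t) :: real)"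
    by (simp add: set_integrable_def)
  then show ?thesis by (subst (asm) integrable_completion) auto
qed

lemma integrable_decay:
  fixes u :: "real \<Rightarrow> 'b::{banach, second_countable_topology}"
  assumes cont: "continuous_on {0..} u" and c: "c > 0" and le: "\<And>t. t \<ge> 0 \<Longrightarrow> norm (u t) \<le> C * exp (- c * t)"
  shows "set_integrable lborel {0..} u"
    "norm (LINT t:{0..}|lborel. u t) \<le> C * (LINT t|lborel. indicator {0..} t * exp (- c * t))"
proof -
  let ?g = "\<lambda>t :: real. C * (indicator {0..} t * exp (- c * t)) :: real"
  have g: "integrable lborel ?g" using integrable_exp_decay[OF c] by simp
  have m: "(\<lambda>t. indicator {0..} t *\<^sub>R u t) \<in> borel_measurable lborel"
    using borel_measurable_continuous_on_indicator[OF _ cont] by simp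
  have b: "norm (indicator {0..} t *\<^sub>R u t) \<le> ?g t" for t :: real
    using le[of t] by (auto simp: indicator_def)
  have i: "integrable lborel (\<lambda>t. indicator {0..} t *\<^sub>R u t)"
    by (rule Bochner_Integration.integrable_bound[OF g m]) (use b in \<open>force intro: order_trans[OF _ abs_ge_self]\<close>)
  then show "set_integrable lborel {0..} u" by (simp add: set_integrable_def)
  have "norm (LINT t|lborel. indicator {0..} t *\<^sub>R u t) \<le> (LINT t|lborel. ?g t)"
    by (rule Bochner_Integration.integral_norm_bound_integral[OF i g b])
  then show "norm (LINT t:{0..}|lborel. u t) \<le> C * (LINT t|lborel. indicator {0..} t * exp (- c * t))"
    by (simp add: set_lebesgue_integral_def)
qed

text \<open>Half-open, so that for fixed \<open>n\<close> the cells are disjoint. The first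
  \<open>n * 2 ^ n\<close> of them tile \<open>[0, n)\<close>: mesh and truncation are governed by
  the same parameter.\<close>

definition dyadic_cell :: "nat \<Rightarrow> nat \<Rightarrow> real set" where
  "dyadic_cell n k = {real k / 2 ^ n ..< (real k + 1) / 2 ^ n}"

lemma mem_dyadic_cell: "t \<in> dyadic_cell n k \<longleftrightarrow> real k \<le> 2 ^ n * t \<and> 2 ^ n * t < real k + 1"
  by (auto simp: dyadic_cell_def field_simps)

lemma dyadic_cell_sum:
  fixes F :: "nat \<Rightarrow> 'b::real_vector"
  shows "0 \<le> t \<Longrightarrow> t < real n \<Longrightarrow>
      (\<Sum>k<n * 2 ^ n. indicator (dyadic_cell n k) t *\<^sub>R F k) = F (nat \<lfloor>2 ^ n * t\<rfloor>)"
    "t < 0 \<or> real n \<le> t \<Longrightarrow> (\<Sum>k<n * 2 ^ n. indicator (dyadic_cell n k) t *\<^sub>R F k) = 0"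
proof -
  assume t: "0 \<le> t" "t < real n"
  let ?k = "nat \<lfloor>2 ^ n * t\<rfloor>"
  have nn: "0 \<le> 2 ^ n * t" using t by simp
  have "2 ^ n * t < real (n * 2 ^ n)" using t by simp
  then have k: "?k < n * 2 ^ n" using nn by linarith
  have "indicator (dyadic_cell n k) t *\<^sub>R F k = (if k = ?k then F k else 0)" for k
  proof -
    have "t \<in> dyadic_cell n k \<longleftrightarrow> k = ?k" unfolding mem_dyadic_cell using nn by linarith
    then show ?thesis by (auto simp: indicator_def)
  qed
  then show "(\<Sum>k<n * 2 ^ n. indicator (dyadic_cell n k) t *\<^sub>R F k) = F ?k" using k by simp
next
  assume t: "t < 0 \<or> real n \<le> t"
  have "t \<notin> dyadic_cell n k" if k: "k < n * 2 ^ n" for k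
  proof
    assume "t \<in> dyadic_cell n k"
    then have c: "real k \<le> 2 ^ n * t" "2 ^ n * t < real k + 1" by (auto simp: mem_dyadic_cell)
    have t0: "t \<ge> 0" using c(1) by (metis of_nat_0_le_iff order_trans zero_le_mult_iff zero_less_numeral zero_less_power not_le)
    then have "2 ^ n * real n \<le> 2 ^ n * t" using t by (intro mult_left_mono) auto
    then have "2 ^ n * real n < real k + 1" using c(2) by linarith
    moreover have "real (Suc k) \<le> real (n * 2 ^ n)" using k by (intro of_nat_mono) simp
    ultimately show False by (simp add: mult.commute)
  qed
  then show "(\<Sum>k<n * 2 ^ n. indicator (dyadic_cell n k) t *\<^sub>R F k) = 0" by (intro sum.neutral) simp
qed

lemma dyadic_cell_integral:
  fixes w :: "nat \<Rightarrow> complex"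
  shows "integrable lborel (\<lambda>t. \<Sum>k<N. indicator (dyadic_cell n k) t *\<^sub>R w k)"
    "(LINT t|lborel. (\<Sum>k<N. indicator (dyadic_cell n k) t *\<^sub>R w k)) = (\<Sum>k<N. (1 / 2 ^ n) *\<^sub>R w k)"
proof -
  have m: "emeasure lborel (dyadic_cell n k) = ennreal (1 / 2 ^ n)" for k
    by (simp add: dyadic_cell_def divide_simps)
  have s: "dyadic_cell n k \<in> sets lborel" for k by (simp add: dyadic_cell_def)
  have i: "integrable lborel (\<lambda>t. indicator (dyadic_cell n k) t *\<^sub>R w k)" for k
    by (intro integrable_scaleR_left integrable_real_indicator s) (simp add: m)
  show "integrable lborel (\<lambda>t. \<Sum>k<N. indicator (dyadic_cell n k) t *\<^sub>R w k)"
    by (intro Bochner_Integration.integrable_sum i)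
  have "measure lborel (dyadic_cell n k) = 1 / 2 ^ n" for k by (simp add: measure_def m)
  then have "(LINT t|lborel. indicator (dyadic_cell n k) t *\<^sub>R w k) = (1 / 2 ^ n) *\<^sub>R w k" for k
    using s by (subst integral_scaleR_left) (auto simp: m intro!: integrable_real_indicator)
  then show "(LINT t|lborel. (\<Sum>k<N. indicator (dyadic_cell n k) t *\<^sub>R w k)) = (\<Sum>k<N. (1 / 2 ^ n) *\<^sub>R w k)"
    by (simp only: Bochner_Integration.integral_sum[OF i])
qed

section \<open>Integrals with values in the space\<close>

context mixed_space
begin

lemma dual_combination:
  assumes "f \<in> Y" "g \<in> Y"
  shows "(\<lambda>x. a * f x + b * g x) \<in> Y"
proof (rule dualI)
  show "Vector_Spaces.linear smul (*) (\<lambda>x. a * f x + b * g x)"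
    unfolding linear_functional_iff[OF ns]
    by (simp add: dual_linear(1,2)[OF dualD(1)[OF assms(1)]] dual_linear(1,2)[OF dualD(1)[OF assms(2)]] algebra_simps)
  show "norm (a * f x + b * g x) \<le> norm a * norm (f x) + norm b * norm (g x)" for x
    by (metis norm_mult norm_triangle_ineq)
  show "tight (\<lambda>x. norm a * norm (f x) + norm b * norm (g x))"
    using assms by (intro tight_add tight_scale dualD(3)) auto
qed

definition riemann_sum :: "(real \<Rightarrow> 'a) \<Rightarrow> nat \<Rightarrow> 'a" where
  "riemann_sum f n = (\<Sum>k<n * 2 ^ n. (1 / 2 ^ n) *\<^sub>R f (real k / 2 ^ n))"

lemma dual_continuous_on:
  assumes y: "y \<in> Y" and cont: "\<And>p z. tight p \<Longrightarrow> continuous_on J (\<lambda>t. p (f t - z))"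
  shows "continuous_on J (\<lambda>t. to_complex (y (f t)))"
  unfolding continuous_on_def
proof
  fix s assume s: "s \<in> J"
  let ?p = "\<lambda>x. norm (y x)"
  note yl = dual_linear[OF dualD(1)[OF y]]
  have "((\<lambda>t. ?p (f t - f s)) \<longlongrightarrow> ?p (f s - f s)) (at s within J)"
    using cont[OF dualD(3)[OF y], of "f s"] s unfolding continuous_on_def by blast
  then have A: "((\<lambda>t. ?p (f t - f s)) \<longlongrightarrow> 0) (at s within J)" by (simp add: yl)
  have "norm (to_complex (y (f t)) - to_complex (y (f s))) \<le> ?p (f t - f s)" for t
    by (simp add: to_complex_diff[symmetric] norm_to_complex yl)
  then have "((\<lambda>t. to_complex (y (f t)) - to_complex (y (f s))) \<longlongrightarrow> 0) (at s within J)"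
    by (intro Lim_null_comparison[OF always_eventually A]) blast
  then show "((\<lambda>t. to_complex (y (f t))) \<longlongrightarrow> to_complex (y (f s))) (at s within J)"
    by (rule LIM_zero_cancel)
qed

text \<open>The error bound is uniform over the polar of \<open>p\<close>; by Hahn--Banach this makes the Riemann
  sums Cauchy for \<open>p\<close>.\<close>

lemma riemann_sum_error:
  assumes p: "tight p" and cont: "\<And>p z. tight p \<Longrightarrow> continuous_on {0..} (\<lambda>t. p (f t - z))"
    and c: "c > 0" and decay: "\<And>t. t \<ge> 0 \<Longrightarrow> p (f t) \<le> C * exp (- c * t)"
  shows "\<exists>D :: nat \<Rightarrow> real. D \<longlonglongrightarrow> 0 \<and> (\<forall>y\<in>Y. \<forall>n. (\<forall>x. norm (y x) \<le> p x) \<longrightarrow>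
       norm (to_complex (y (riemann_sum f n)) - (LINT t:{0..}|lborel. to_complex (y (f t)))) \<le> D n)"
proof -
  note ps = tight_seminorm[OF p]
  \<comment> \<open>Dominates the error integrand for all admissible \<open>y\<close> at once:
    \<open>p (f t - f s)\<close> on \<open>[0, n)\<close>, with \<open>s\<close> the left endpoint
    of the cell of \<open>t\<close>, and \<open>p (f t)\<close> beyond. Written cell by cell, its
    measurability reduces to that of the scalar functions \<open>p (f t - z)\<close> with fixed
    \<open>z\<close>.\<close>
  define h where "h = (\<lambda>n t. (\<Sum>k<n * 2 ^ n. indicator (dyadic_cell n k) t *\<^sub>R
      (indicator {0..} t *\<^sub>R p (f t - f (real k / 2 ^ n)))) + indicator {real n..} t * (indicator {0..} t *\<^sub>R p (f t - 0)))"
  have C0: "C \<ge> 0" using decay[of 0] sn_nonneg[OF ps, of "f 0"] by simp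
  \<comment> \<open>The factor 2 stems from \<open>p (f t) + p (f s)\<close>, and
    \<open>exp c\<close> from the left endpoint \<open>s \<ge> t - 1\<close>, where the decay is
    weaker than at \<open>t\<close>.\<close>
  define w where "w = (\<lambda>t :: real. 2 * C * exp c * (indicator {0..} t * exp (- c * t)) :: real)"
  have wi: "integrable lborel w" unfolding w_def using integrable_exp_decay[OF c] by simp
  define gr where "gr = (\<lambda>n (t :: real). real (nat \<lfloor>2 ^ n * t\<rfloor>) / 2 ^ n)"
  have gr: "0 \<le> gr n t" "gr n t \<le> t" "t - gr n t \<le> 1 / 2 ^ n" if t: "t \<ge> 0" for n and t :: real
  proof -
    have nn: "0 \<le> 2 ^ n * t" using t by simp
    show "0 \<le> gr n t" by (simp add: gr_def)
    have "real (nat \<lfloor>2 ^ n * t\<rfloor>) \<le> 2 ^ n * t" "2 ^ n * t \<le> real (nat \<lfloor>2 ^ n * t\<rfloor>) + 1"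
      using nn by linarith+
    then have "real (nat \<lfloor>2 ^ n * t\<rfloor>) / 2 ^ n \<le> t" "t \<le> (real (nat \<lfloor>2 ^ n * t\<rfloor>) + 1) / 2 ^ n"
      by (simp_all only: pos_divide_le_eq pos_le_divide_eq zero_less_power zero_less_numeral mult.commute)
    then show "gr n t \<le> t" "t - gr n t \<le> 1 / 2 ^ n" by (simp_all add: gr_def add_divide_distrib)
  qed
  have h1: "h n t = p (f t - f (gr n t))" if "0 \<le> t" "t < real n" for n t
    unfolding h_def gr_def dyadic_cell_sum(1)[OF that] using that by simp
  have h2: "h n t = p (f t)" if "0 \<le> t" "real n \<le> t" for n t
    unfolding h_def dyadic_cell_sum(2)[OF disjI2[OF that(2)]] using that by simp
  have h3: "h n t = 0" if "t < 0" for n t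
    unfolding h_def dyadic_cell_sum(2)[OF disjI1[OF that]] using that by simp
  have hm: "h n \<in> borel_measurable lborel" for n
  proof -
    have m: "(\<lambda>t. indicator {0..} t *\<^sub>R p (f t - z)) \<in> borel_measurable lborel" for z
      using borel_measurable_continuous_on_indicator[OF _ cont[OF p]] by simp
    have i: "(indicator A :: real \<Rightarrow> real) \<in> borel_measurable lborel" if "A \<in> sets borel" for A using that by simp
    show ?thesis
      unfolding h_def
      by (intro borel_measurable_add borel_measurable_sum borel_measurable_scaleR borel_measurable_times m i)
        (auto simp: dyadic_cell_def)
  qed
  have hb: "norm (h n t) \<le> w t" for n t
  proof (cases "t < 0")
    case False
    then have t: "t \<ge> 0" by simp
    have e1: "exp (- c * t) \<le> exp c * exp (- c * t)" using c by simp
    have pt: "p (f t) \<le> C * (exp c * exp (- c * t))"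
      using decay[OF t] mult_left_mono[OF e1 C0] by simp
    show ?thesis
    proof (cases "t < real n")
      case True
      have "p (f (gr n t)) \<le> C * exp (- c * gr n t)" by (rule decay[OF gr(1)[OF t]])
      also have "\<dots> \<le> C * (exp c * exp (- c * t))"
      proof (rule mult_left_mono[OF _ C0])
        have "(1::real) / 2 ^ n \<le> 1" by simp
        then have "t - gr n t \<le> 1" using gr(3)[OF t, of n] by linarith
        then have "c * (t - gr n t) \<le> c * 1" using c by (intro mult_left_mono) auto
        then show "exp (- c * gr n t) \<le> exp c * exp (- c * t)" by (simp add: algebra_simps flip: exp_add)
      qed
      finally have "p (f t - f (gr n t)) \<le> 2 * (C * (exp c * exp (- c * t)))"
        using sn_diff[OF ps, of "f t" "f (gr n t)"] pt by linarith
      then show ?thesis using h1[OF t True] sn_nonneg[OF ps, of "f t - f (gr n t)"] t by (simp add: w_def)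
    next
      case False
      have "0 \<le> C * (exp c * exp (- c * t))" using C0 by simp
      then have "p (f t) \<le> 2 * (C * (exp c * exp (- c * t)))" using pt by linarith
      then show ?thesis using h2[OF t] False sn_nonneg[OF ps, of "f t"] t by (simp add: w_def)
    qed
  qed (simp add: h3 w_def)
  have hl: "(\<lambda>n. h n t) \<longlonglongrightarrow> 0" for t
  proof (cases "t < 0")
    case False
    then have t: "t \<ge> 0" by simp
    have "(\<lambda>n. gr n t) \<longlonglongrightarrow> t"
    proof -
      have "(\<lambda>n. 1 / 2 ^ n :: real) \<longlonglongrightarrow> 0"
        using LIMSEQ_realpow_zero[of "1/2 :: real"] by (simp add: power_divide)
      then have "(\<lambda>n. gr n t - t) \<longlonglongrightarrow> 0"
        by (rule Lim_null_comparison[OF always_eventually, rotated]) (use gr[OF t] in \<open>simp add: abs_minus_commute\<close>)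
      then show ?thesis by (rule LIM_zero_cancel)
    qed
    then have "(\<lambda>n. p (f (gr n t) - f t)) \<longlonglongrightarrow> p (f t - f t)"
      using continuous_on_tendsto_compose[OF cont[OF p, of "f t"], of "\<lambda>n. gr n t" t sequentially] t gr(1)[OF t] by simp
    then have l: "(\<lambda>n. p (f t - f (gr n t))) \<longlonglongrightarrow> 0"
      by (simp add: sn_zero[OF ps] sn_commute[OF ps, of "f t"])
    obtain N :: nat where "t < real N" using reals_Archimedean2 by blast
    then have "\<forall>\<^sub>F n in sequentially. h n t = p (f t - f (gr n t))"
      using h1[OF t] by (intro eventually_sequentiallyI[of N]) auto
    then show ?thesis using l by (simp add: tendsto_cong)
  qed (simp add: h3)
  have hi: "integrable lborel (h n)" for n
    by (rule Bochner_Integration.integrable_bound[OF wi hm]) (use hb in \<open>force intro: order_trans[OF _ abs_ge_self]\<close>)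
  define D where "D n = (LINT t|lborel. h n t)" for n
  have "(\<lambda>n. LINT t|lborel. h n t) \<longlonglongrightarrow> (LINT t|(lborel :: real measure). 0)"
    by (rule integral_dominated_convergence[where w = w]) (use hm wi hl hb in auto)
  then have D0: "D \<longlonglongrightarrow> 0" by (simp add: D_def[abs_def])
  moreover have "norm (to_complex (y (riemann_sum f n)) - (LINT t:{0..}|lborel. to_complex (y (f t)))) \<le> D n"
    if y: "y \<in> Y" and le: "\<And>x. norm (y x) \<le> p x" for y n
  proof -
    note yl = dual_linear[OF dualD(1)[OF y]]
    define u where "u = (\<lambda>t. to_complex (y (f t)))"
    have uc: "continuous_on {0..} u" unfolding u_def by (rule dual_continuous_on[where f = f, OF y cont])
    have ud: "norm (u t) \<le> C * exp (- c * t)" if "t \<ge> 0" for t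
      using le[of "f t"] decay[OF that] by (simp add: u_def norm_to_complex)
    have ui: "integrable lborel (\<lambda>t. indicator {0..} t *\<^sub>R u t)"
      using integrable_decay(1)[OF uc c ud] by (simp add: set_integrable_def)
    let ?s = "\<lambda>t. \<Sum>k<n * 2 ^ n. indicator (dyadic_cell n k) t *\<^sub>R u (real k / 2 ^ n)"
    have si: "integrable lborel ?s" by (rule dyadic_cell_integral(1))
    have "y (\<Sum>k<N. g k) = (\<Sum>k<N. y (g k))" for N :: nat and g
      by (induction N) (simp_all add: yl)
    then have "to_complex (y (riemann_sum f n)) = (\<Sum>k<n * 2 ^ n. to_complex (of_real (1 / 2 ^ n) * y (f (real k / 2 ^ n))))"
      by (simp only: riemann_sum_def yl(5) linear_sum[OF linear_to_complex])
    also have "\<dots> = (\<Sum>k<n * 2 ^ n. (1 / 2 ^ n) *\<^sub>R u (real k / 2 ^ n))"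
      by (simp only: u_def to_complex_mult to_complex_of_real scaleR_conv_of_real)
    also have "\<dots> = (LINT t|lborel. ?s t)" by (rule dyadic_cell_integral(2)[symmetric])
    finally have "to_complex (y (riemann_sum f n)) - (LINT t:{0..}|lborel. u t) =
        (LINT t|lborel. (?s t - indicator {0..} t *\<^sub>R u t))"
      by (simp only: set_lebesgue_integral_def Bochner_Integration.integral_diff[OF si ui])
    also have "norm \<dots> \<le> (LINT t|lborel. h n t)"
    proof (rule Bochner_Integration.integral_norm_bound_integral)
      show "integrable lborel (\<lambda>t. ?s t - indicator {0..} t *\<^sub>R u t)" using si ui by simp
      fix t :: real
      have nd: "norm (u s - u t) = norm (y (f t - f s))" for s
        by (simp add: u_def to_complex_diff[symmetric] norm_to_complex yl(3) norm_minus_commute)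
      show "norm (?s t - indicator {0..} t *\<^sub>R u t) \<le> h n t"
      proof (cases "t < 0")
        case False
        then have t: "t \<ge> 0" by simp
        show ?thesis
        proof (cases "t < real n")
          case True
          have "?s t = u (gr n t)" using dyadic_cell_sum(1)[OF t True, of "\<lambda>k. u (real k / 2 ^ n)"] by (simp add: gr_def)
          then show ?thesis using h1[OF t True] le nd t by simp
        next
          case False
          then have "?s t = 0" by (intro dyadic_cell_sum(2)) simp
          then show ?thesis using h2[OF t] False le[of "f t"] t by (simp add: u_def norm_to_complex)
        qed
      next
        case True
        then have "?s t = 0" by (intro dyadic_cell_sum(2)) simp
        then show ?thesis using h3[OF True] True by simp
      qed
    qed (rule hi)
    finally show ?thesis by (simp add: D_def u_def)
  qed
  ultimately show ?thesis by blast
qed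

text \<open>Sequential completeness turns the Riemann sums into a vector; pairing with one
  \<open>y\<close> and using the error bound for the seminorm \<open>norm (y x)\<close> identifies
  it with the scalar integral.\<close>

lemma gamma_integral_exists:
  assumes sc: "sequentially_complete \<gamma>" and cont: "\<And>p z. tight p \<Longrightarrow> continuous_on {0..} (\<lambda>t. p (f t - z))"
    and c: "c > 0" and decay: "\<And>p. tight p \<Longrightarrow> \<exists>C. \<forall>t\<ge>0. p (f t) \<le> C * exp (- c * t)"
  shows "\<exists>v. \<forall>y\<in>Y. set_integrable lborel {0..} (\<lambda>t. to_complex (y (f t))) \<and>
      (LINT t:{0..}|lborel. to_complex (y (f t))) = to_complex (y v)"
proof -
  define err where "err = (\<lambda>p (D :: nat \<Rightarrow> real). D \<longlonglongrightarrow> 0 \<and> (\<forall>y\<in>Y. \<forall>n. (\<forall>x. norm (y x) \<le> p x) \<longrightarrow>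
       norm (to_complex (y (riemann_sum f n)) - (LINT t:{0..}|lborel. to_complex (y (f t)))) \<le> D n))"
  have err: "\<exists>D. err p D" if p: "tight p" for p
  proof -
    obtain C where C: "\<And>t. t \<ge> 0 \<Longrightarrow> p (f t) \<le> C * exp (- c * t)" using decay[OF p] by blast
    show ?thesis unfolding err_def by (rule riemann_sum_error[of p f c C, OF p cont c C])
  qed
  have "\<exists>N::nat. \<forall>m\<ge>N. \<forall>n\<ge>N. riemann_sum f m - riemann_sum f n \<in> U" if U: "openin \<gamma> U \<and> 0 \<in> U" for U
  proof -
    obtain p where p: "tight p" "{y. p (y - 0) < 1} \<subseteq> U"
      by (rule gamma_locally_convex[of U 0]) (use U in auto)
    obtain D where D: "err p D" using err[OF p(1)] by blast
    \<comment> \<open>Half of the radius 1 for each of the two Riemann sums, which are compared with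
      the same scalar integral.\<close>
    then have "\<forall>\<^sub>F n in sequentially. D n < 1 / 2" unfolding err_def by (intro order_tendstoD(2)[of D 0]) auto
    then obtain N where N: "\<And>n. n \<ge> N \<Longrightarrow> D n < 1 / 2" by (auto simp: eventually_sequentially)
    have "riemann_sum f m - riemann_sum f n \<in> U" if "m \<ge> N" "n \<ge> N" for m n
    proof -
      let ?z = "riemann_sum f m - riemann_sum f n"
      obtain y where y: "y \<in> Y" "\<forall>x. norm (y x) \<le> p x" "norm (y ?z) = p ?z"
        using dual_Hahn_Banach[OF p(1), of ?z] by blast
      let ?I = "LINT t:{0..}|lborel. to_complex (y (f t))"
      have "norm (to_complex (y (riemann_sum f m)) - ?I) \<le> D m" "norm (to_complex (y (riemann_sum f n)) - ?I) \<le> D n"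
        using D y unfolding err_def by blast+
      then have "norm (to_complex (y (riemann_sum f m)) - to_complex (y (riemann_sum f n))) < 1"
        using N[OF that(1)] N[OF that(2)]
          norm_triangle_ineq4[of "to_complex (y (riemann_sum f m)) - ?I" "to_complex (y (riemann_sum f n)) - ?I"]
        by simp
      then have "norm (to_complex (y ?z)) < 1"
        by (simp only: dual_linear(3)[OF dualD(1)[OF y(1)]] to_complex_diff)
      then have "norm (y ?z) < 1" by (simp only: norm_to_complex)
      then show ?thesis using y(3) p(2) by auto
    qed
    then show ?thesis by blast
  qed
  then obtain v where v: "limitin \<gamma> (riemann_sum f) v sequentially" using sc unfolding sequentially_complete_def by blast
  show ?thesis
  proof (intro exI[of _ v] ballI conjI)
    fix y assume y: "y \<in> Y"
    note yl = dual_linear[OF dualD(1)[OF y]]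
    let ?p = "\<lambda>x. norm (y x)"
    have p: "tight ?p" by (rule dualD(3)[OF y])
    obtain C where C: "\<And>t. t \<ge> 0 \<Longrightarrow> ?p (f t) \<le> C * exp (- c * t)" using decay[OF p] by blast
    show "set_integrable lborel {0..} (\<lambda>t. to_complex (y (f t)))"
      by (rule integrable_decay(1)[OF dual_continuous_on[where f = f, OF y cont] c]) (use C in \<open>simp_all add: norm_to_complex\<close>)
    let ?I = "LINT t:{0..}|lborel. to_complex (y (f t))"
    obtain D where D: "err ?p D" using err[OF p] by blast
    then have D0: "D \<longlonglongrightarrow> 0" and "\<And>n. norm (to_complex (y (riemann_sum f n)) - ?I) \<le> D n"
      using y unfolding err_def by blast+
    then have "(\<lambda>n. to_complex (y (riemann_sum f n)) - ?I) \<longlonglongrightarrow> 0"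
      by (intro Lim_null_comparison[OF always_eventually D0]) blast
    then have 1: "(\<lambda>n. to_complex (y (riemann_sum f n))) \<longlonglongrightarrow> ?I" by (rule LIM_zero_cancel)
    have "(\<lambda>n. ?p (riemann_sum f n - v)) \<longlonglongrightarrow> 0" using v p unfolding limitin_gamma_iff by blast
    then have "(\<lambda>n. to_complex (y (riemann_sum f n)) - to_complex (y v)) \<longlonglongrightarrow> 0"
      by (rule Lim_null_comparison[OF always_eventually, rotated])
        (simp add: yl(3) to_complex_diff[symmetric] norm_to_complex)
    then have "(\<lambda>n. to_complex (y (riemann_sum f n))) \<longlonglongrightarrow> to_complex (y v)" by (rule LIM_zero_cancel)
    with 1 show "?I = to_complex (y v)" by (rule LIMSEQ_unique)
  qed
qed

end

section \<open>Laplace transforms of operator families\<close>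

context mixed_family
begin

text \<open>The weight is real so that it acts on the space over either field; the complex
  exponential is treated later through its real and imaginary parts. The growth of the family is
  offset by the weight since \<open>a + \<alpha> > 0\<close>.\<close>

lemma weighted_integral_operator:
  assumes sc: "sequentially_complete \<gamma>" and st: "strongly_continuous \<gamma> {0..} S"
    and eq: "equicontinuous_family smul \<gamma> {0..} (\<lambda>t x. exp (\<alpha> * t) *\<^sub>R S t x)"
    and \<phi>: "continuous_on {0..} \<phi>" "\<And>t. t \<ge> 0 \<Longrightarrow> \<bar>\<phi> t\<bar> \<le> exp (- a * t)" and c: "a + \<alpha> > 0"
  obtains A where "Vector_Spaces.linear smul smul A" "\<And>y. y \<in> Y \<Longrightarrow> (\<lambda>x. y (A x)) \<in> Y"
    "\<And>x y. y \<in> Y \<Longrightarrow> set_integrable lborel {0..} (\<lambda>t. \<phi> t *\<^sub>R to_complex (y (S t x)))"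
    "\<And>x y. y \<in> Y \<Longrightarrow> (LINT t:{0..}|lborel. \<phi> t *\<^sub>R to_complex (y (S t x))) = to_complex (y (A x))"
proof -
  define c where "c = a + \<alpha>"
  have c0: "c > 0" using c by (simp add: c_def)
  have decay: "p (\<phi> t *\<^sub>R S t x) \<le> q x * exp (- c * t)"
    if p: "tight p" and q: "\<forall>t\<in>{0..}. \<forall>x. p (exp (\<alpha> * t) *\<^sub>R S t x) \<le> q x" and t: "t \<ge> 0" for p q t x
  proof -
    note ps = tight_seminorm[OF p]
    have "exp (\<alpha> * t) * p (S t x) \<le> q x" using q[rule_format, of t x] t by (simp add: sn_scaleR[OF ps])
    then have 1: "p (S t x) \<le> exp (- (\<alpha> * t)) * q x" by (simp add: exp_minus field_simps)
    have "p (\<phi> t *\<^sub>R S t x) = \<bar>\<phi> t\<bar> * p (S t x)" by (rule sn_scaleR[OF ps])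
    also have "\<dots> \<le> exp (- a * t) * (exp (- (\<alpha> * t)) * q x)"
      using \<phi>(2)[OF t] 1 sn_nonneg[OF ps] by (intro mult_mono) auto
    also have "\<dots> = q x * (exp (- a * t) * exp (- (\<alpha> * t)))" by (simp only: mult_ac)
    also have "exp (- a * t) * exp (- (\<alpha> * t)) = exp (- c * t)"
      by (simp add: c_def algebra_simps flip: exp_add)
    finally show ?thesis .
  qed
  have eqD: "\<exists>q. tight q \<and> (\<forall>t\<in>{0..}. \<forall>x. p (exp (\<alpha> * t) *\<^sub>R S t x) \<le> q x)" if "tight p" for p
    using eq that unfolding equicontinuous_family_iff by blast
  have cont: "continuous_on {0..} (\<lambda>t. p (\<phi> t *\<^sub>R S t x - z))" if p: "tight p" for p x z
    unfolding continuous_on_def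
  proof
    fix s :: real assume s: "s \<in> {0..}"
    note ps = tight_seminorm[OF p]
    have c1: "continuous_on {0..} (\<lambda>t. p (S t x - z))" for z
      using st p unfolding strongly_continuous_gamma_iff by blast
    \<comment> \<open>Product-rule estimate: one term for the change of the weight and one for the
      change of the orbit, both vanishing at \<open>s\<close>.\<close>
    define g where "g = (\<lambda>t. \<bar>\<phi> t - \<phi> s\<bar> * p (S t x - 0) + \<bar>\<phi> s\<bar> * p (S t x - S s x))"
    have "continuous_on {0..} g"
      unfolding g_def by (intro continuous_on_add continuous_on_mult continuous_on_rabs continuous_on_diff
          continuous_on_const \<phi>(1) c1)
    then have "(g \<longlongrightarrow> g s) (at s within {0..})" using s unfolding continuous_on_def by blast
    then have A: "(g \<longlongrightarrow> 0) (at s within {0..})" by (simp add: g_def sn_zero[OF ps])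
    have B: "norm (p (\<phi> t *\<^sub>R S t x - z) - p (\<phi> s *\<^sub>R S s x - z)) \<le> g t" for t
    proof -
      have "\<bar>p (\<phi> t *\<^sub>R S t x - z) - p (\<phi> s *\<^sub>R S s x - z)\<bar> \<le> p ((\<phi> t *\<^sub>R S t x - z) - (\<phi> s *\<^sub>R S s x - z))"
        by (rule sn_abs[OF ps])
      also have "(\<phi> t *\<^sub>R S t x - z) - (\<phi> s *\<^sub>R S s x - z) = (\<phi> t - \<phi> s) *\<^sub>R S t x + \<phi> s *\<^sub>R (S t x - S s x)"
        by (simp add: algebra_simps)
      also have "p \<dots> \<le> g t"
        using sn_add[OF ps, of "(\<phi> t - \<phi> s) *\<^sub>R S t x" "\<phi> s *\<^sub>R (S t x - S s x)"]
        by (simp add: g_def sn_scaleR[OF ps])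
      finally show ?thesis by simp
    qed
    have "((\<lambda>t. p (\<phi> t *\<^sub>R S t x - z) - p (\<phi> s *\<^sub>R S s x - z)) \<longlongrightarrow> 0) (at s within {0..})"
      by (rule Lim_null_comparison[OF always_eventually A]) (use B in blast)
    then show "((\<lambda>t. p (\<phi> t *\<^sub>R S t x - z)) \<longlongrightarrow> p (\<phi> s *\<^sub>R S s x - z)) (at s within {0..})"
      by (rule LIM_zero_cancel)
  qed
  have tc: "to_complex (y (\<phi> t *\<^sub>R S t x)) = \<phi> t *\<^sub>R to_complex (y (S t x))" if "y \<in> Y" for y t x
    by (simp add: dual_linear(5)[OF dualD(1)[OF that]] to_complex_mult scaleR_conv_of_real)
  have "\<exists>v. \<forall>y\<in>Y. set_integrable lborel {0..} (\<lambda>t. to_complex (y (\<phi> t *\<^sub>R S t x))) \<and>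
      (LINT t:{0..}|lborel. to_complex (y (\<phi> t *\<^sub>R S t x))) = to_complex (y v)" for x
  proof (rule gamma_integral_exists[where f = "\<lambda>t. \<phi> t *\<^sub>R S t x", OF sc cont c0])
    fix p assume p: "tight p"
    obtain q where "\<forall>t\<in>{0..}. \<forall>x. p (exp (\<alpha> * t) *\<^sub>R S t x) \<le> q x" using eqD[OF p] by blast
    then show "\<exists>C. \<forall>t\<ge>0. p (\<phi> t *\<^sub>R S t x) \<le> C * exp (- c * t)"
      using decay[OF p] by (intro exI[of _ "q x"]) blast
  qed
  then obtain A where A': "\<forall>x. \<forall>y\<in>Y. set_integrable lborel {0..} (\<lambda>t. to_complex (y (\<phi> t *\<^sub>R S t x))) \<and>
      (LINT t:{0..}|lborel. to_complex (y (\<phi> t *\<^sub>R S t x))) = to_complex (y (A x))" by metis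
  have A: "set_integrable lborel {0..} (\<lambda>t. \<phi> t *\<^sub>R to_complex (y (S t x)))"
    "(LINT t:{0..}|lborel. \<phi> t *\<^sub>R to_complex (y (S t x))) = to_complex (y (A x))" if "y \<in> Y" for x y
    using A'[rule_format, OF that, of x] by (simp_all only: tc[OF that])
  have lin: "Vector_Spaces.linear smul smul A"
    unfolding linear_operator_iff[OF ns]
  proof (intro conjI allI)
    fix x x'
    \<comment> \<open>\<open>A x\<close> is known only through its pairings with the dual, so
      linearity is checked after applying each \<open>y\<close>; the dual separates points.\<close>
    have "A (x + x') - (A x + A x') = 0"
    proof (rule dual_separates)
      fix y assume y: "y \<in> Y"
      note yl = dual_linear[OF dualD(1)[OF y]]
      have "to_complex (y (A (x + x'))) = (LINT t:{0..}|lborel. \<phi> t *\<^sub>R to_complex (y (S t (x + x'))))"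
        by (simp only: A(2)[OF y])
      also have "\<dots> = (LINT t:{0..}|lborel. \<phi> t *\<^sub>R to_complex (y (S t x)) + \<phi> t *\<^sub>R to_complex (y (S t x')))"
        by (intro set_lebesgue_integral_cong) (auto simp: S_simps yl to_complex_add scaleR_add_right)
      also have "\<dots> = to_complex (y (A x)) + to_complex (y (A x'))"
        using set_integral_add(2)[OF A(1)[OF y] A(1)[OF y]] by (simp only: A(2)[OF y])
      finally have "to_complex (y (A (x + x'))) = to_complex (y (A x + A x'))" by (simp only: yl to_complex_add)
      then have "y (A (x + x')) = y (A x + A x')" by (rule injD[OF inj_to_complex])
      then show "y (A (x + x') - (A x + A x')) = 0" by (simp add: yl(3))
    qed
    then show "A (x + x') = A x + A x'" by simp
  next
    fix k x
    have "A (smul k x) - smul k (A x) = 0"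
    proof (rule dual_separates)
      fix y assume y: "y \<in> Y"
      note yl = dual_linear[OF dualD(1)[OF y]]
      have "to_complex (y (A (smul k x))) = (LINT t:{0..}|lborel. \<phi> t *\<^sub>R to_complex (y (S t (smul k x))))"
        by (simp only: A(2)[OF y])
      also have "\<dots> = (LINT t:{0..}|lborel. to_complex k * (\<phi> t *\<^sub>R to_complex (y (S t x))))"
        by (intro set_lebesgue_integral_cong) (auto simp: S_simps yl to_complex_mult)
      also have "\<dots> = to_complex k * to_complex (y (A x))"
        by (simp only: set_integral_mult_right A(2)[OF y])
      finally have "to_complex (y (A (smul k x))) = to_complex (y (smul k (A x)))" by (simp only: yl to_complex_mult)
      then have "y (A (smul k x)) = y (smul k (A x))" by (rule injD[OF inj_to_complex])
      then show "y (A (smul k x) - smul k (A x)) = 0" by (simp add: yl(3))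
    qed
    then show "A (smul k x) = smul k (A x)" by simp
  qed
  have dual: "(\<lambda>x. y (A x)) \<in> Y" if y: "y \<in> Y" for y
  proof -
    note yl = dual_linear[OF dualD(1)[OF y]]
    have p: "tight (\<lambda>x. norm (y x))" by (rule dualD(3)[OF y])
    \<comment> \<open>Equicontinuity bounds the integrand by \<open>q x * exp (- c * t)\<close>, so
      the composed functional is dominated by \<open>L\<close> times \<open>q\<close>, with
      \<open>L\<close> the integral of the exponential.\<close>
    obtain q where q: "tight q" "\<forall>t\<in>{0..}. \<forall>x. norm (y (exp (\<alpha> * t) *\<^sub>R S t x)) \<le> q x" using eqD[OF p] by blast
    define L where "L = (LINT t|lborel. indicator {0..} t * exp (- c * t))"
    have L0: "L \<ge> 0" unfolding L_def by (intro Bochner_Integration.integral_nonneg) auto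
    have "norm (y (A x)) \<le> L * q x" for x
    proof -
      have "norm (LINT t:{0..}|lborel. to_complex (y (\<phi> t *\<^sub>R S t x))) \<le> q x * L"
        unfolding L_def
        by (rule integrable_decay(2)[OF dual_continuous_on[where f = "\<lambda>t. \<phi> t *\<^sub>R S t x", OF y cont] c0])
          (use decay[OF p q(2)] in \<open>simp_all add: norm_to_complex\<close>)
      then show ?thesis using A'[rule_format, OF y, of x] by (simp add: norm_to_complex mult.commute)
    qed
    moreover have "Vector_Spaces.linear smul (*) (\<lambda>x. y (A x))"
      unfolding linear_functional_iff[OF ns] by (simp add: linear_operatorD(1,2)[OF lin] yl(1,2))
    ultimately show ?thesis using tight_scale[OF q(1) L0] by (intro dualI[where p = "\<lambda>x. L * q x"])
  qed
  show ?thesis by (rule that[OF lin dual A])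
qed

lemma laplace_operator_exists_if_equicontinuous:
  assumes sc: "sequentially_complete \<gamma>" and st: "strongly_continuous \<gamma> {0..} S"
    and eq: "equicontinuous_family smul \<gamma> {0..} (\<lambda>t x. exp (\<alpha> * t) *\<^sub>R S t x)"
    and z: "Re z > - \<alpha>" and c: "c \<noteq> 0"
  shows "laplace_operator_exists smul Y S z c"
proof -
  define \<phi> where "\<phi> = (\<lambda>t. exp (- Re z * t) * cos (Im z * t))"
  define \<psi> where "\<psi> = (\<lambda>t. - (exp (- Re z * t) * sin (Im z * t)))"
  have pos: "Re z + \<alpha> > 0" using z by simp
  have b: "\<bar>\<phi> t\<bar> \<le> exp (- Re z * t)" "\<bar>\<psi> t\<bar> \<le> exp (- Re z * t)" for t
    unfolding \<phi>_def \<psi>_def by (simp_all add: abs_mult mult_left_le)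
  have k: "continuous_on {0..} \<phi>" "continuous_on {0..} \<psi>"
    unfolding \<phi>_def \<psi>_def by (intro continuous_intros)+
  obtain A where A: "Vector_Spaces.linear smul smul A" "\<And>y. y \<in> Y \<Longrightarrow> (\<lambda>x. y (A x)) \<in> Y"
    "\<And>x y. y \<in> Y \<Longrightarrow> set_integrable lborel {0..} (\<lambda>t. \<phi> t *\<^sub>R to_complex (y (S t x)))"
    "\<And>x y. y \<in> Y \<Longrightarrow> (LINT t:{0..}|lborel. \<phi> t *\<^sub>R to_complex (y (S t x))) = to_complex (y (A x))"
    by (rule weighted_integral_operator[OF sc st eq k(1) b(1) pos]) (rule that; assumption)
  obtain B where B: "Vector_Spaces.linear smul smul B" "\<And>y. y \<in> Y \<Longrightarrow> (\<lambda>x. y (B x)) \<in> Y"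
    "\<And>x y. y \<in> Y \<Longrightarrow> set_integrable lborel {0..} (\<lambda>t. \<psi> t *\<^sub>R to_complex (y (S t x)))"
    "\<And>x y. y \<in> Y \<Longrightarrow> (LINT t:{0..}|lborel. \<psi> t *\<^sub>R to_complex (y (S t x))) = to_complex (y (B x))"
    by (rule weighted_integral_operator[OF sc st eq k(2) b(2) pos]) (rule that; assumption)
  have ex: "exp (- z * of_real t) = of_real (\<phi> t) + \<i> * of_real (\<psi> t)" for t
    by (simp add: \<phi>_def \<psi>_def complex_eq_iff Re_exp Im_exp)
  have lap: "has_laplace_transform (\<lambda>t. to_complex (y (S t x))) z (to_complex (y (A x)) + \<i> * to_complex (y (B x)))"
    if y: "y \<in> Y" for x y
  proof -
    have e: "exp (- z * of_real t) * to_complex (y (S t x)) =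
        \<phi> t *\<^sub>R to_complex (y (S t x)) + \<i> * (\<psi> t *\<^sub>R to_complex (y (S t x)))" for t
      unfolding ex by (simp add: scaleR_conv_of_real algebra_simps)
    have i: "set_integrable lborel {0..} (\<lambda>t. \<i> * (\<psi> t *\<^sub>R to_complex (y (S t x))))"
      using set_integrable_mult_right[of \<i>, OF B(3)[OF y]] by simp
    show ?thesis
      unfolding has_laplace_transform_def e
      using set_integral_add[OF A(3)[OF y] i] by (simp only: set_integral_mult_right A(4)[OF y] B(4)[OF y])
  qed
  have ll: "Vector_Spaces.linear smul smul (\<lambda>x. smul k1 (A x) + smul k2 (B x))" for k1 k2
    unfolding linear_operator_iff[OF ns]
    by (simp add: linear_operatorD(1,2)[OF A(1)] linear_operatorD(1,2)[OF B(1)] smul_simps algebra_simps)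
  have co: "(\<lambda>x. smul k1 (A x) + smul k2 (B x)) \<in> continuous_operators smul (weak_topology Y)" for k1 k2
  proof (rule weak_continuous_operatorI[OF ll])
    fix y assume y: "y \<in> Y"
    show "(\<lambda>x. y (smul k1 (A x) + smul k2 (B x))) \<in> Y"
      using dual_combination[OF A(2)[OF y] B(2)[OF y], of k1 k2] by (simp add: dual_linear(1,2)[OF dualD(1)[OF y]])
  qed
  show ?thesis
  proof (cases "surj (to_complex :: 'k \<Rightarrow> complex)")
    case True
    \<comment> \<open>The operator is \<open>(A + i B) / c\<close>; both complex coefficients are
      realised by scalars of the field.\<close>
    then obtain j k :: 'k where jk: "to_complex j = \<i> / c" "to_complex k = 1 / c" by (metis surjD)
    have "\<exists>R\<in>continuous_operators smul (weak_topology Y). \<forall>x. \<forall>y\<in>Y.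
             has_laplace_transform (\<lambda>t. to_complex (y (S t x))) z (c * to_complex (y (R x)))"
    proof (intro bexI[OF _ co[of k j]] allI ballI)
      fix x y assume y: "y \<in> Y"
      have "c * to_complex (y (smul k (A x) + smul j (B x))) = to_complex (y (A x)) + \<i> * to_complex (y (B x))"
        using c by (simp add: dual_linear(1,2)[OF dualD(1)[OF y]] to_complex_add to_complex_mult jk field_simps)
      then show "has_laplace_transform (\<lambda>t. to_complex (y (S t x))) z (c * to_complex (y (smul k (A x) + smul j (B x))))"
        using lap[OF y] by simp
    qed
    then show ?thesis using True by (simp add: laplace_operator_exists_def)
  next
    case False
    \<comment> \<open>Real scalars cannot absorb \<open>1 / c = u + i v\<close>. Expanding
      \<open>(u + i v) (A + i B)\<close> gives the real part \<open>u A - v B\<close> and the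
      imaginary part \<open>v A + u B\<close>.\<close>
    define u v where "u = Re (1 / c)" and "v = Im (1 / c)"
    have uv: "complex_of_real u + \<i> * complex_of_real v = 1 / c" by (simp add: u_def v_def complex_eq_iff)
    have "\<exists>A'\<in>continuous_operators smul (weak_topology Y).
           \<exists>B'\<in>continuous_operators smul (weak_topology Y). \<forall>x. \<forall>y\<in>Y.
             has_laplace_transform (\<lambda>t. to_complex (y (S t x))) z
               (c * (to_complex (y (A' x)) + \<i> * to_complex (y (B' x))))"
    proof (rule bexI[OF _ co[of "of_real u" "of_real (- v)"]], rule bexI[OF _ co[of "of_real v" "of_real u"]],
        intro allI ballI)
      fix x y assume y: "y \<in> Y"
      let ?a = "to_complex (y (A x))" and ?b = "to_complex (y (B x))"
      have "to_complex (y (smul (of_real u) (A x) + smul (of_real (- v)) (B x))) = of_real u * ?a - of_real v * ?b"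
        "to_complex (y (smul (of_real v) (A x) + smul (of_real u) (B x))) = of_real v * ?a + of_real u * ?b"
        by (simp_all add: dual_linear(1,2)[OF dualD(1)[OF y]] to_complex_add to_complex_mult to_complex_diff
            to_complex_minus)
      moreover have "c * ((of_real u * ?a - of_real v * ?b) + \<i> * (of_real v * ?a + of_real u * ?b)) = ?a + \<i> * ?b"
      proof -
        have "(of_real u * ?a - of_real v * ?b) + \<i> * (of_real v * ?a + of_real u * ?b) =
            (of_real u + \<i> * of_real v) * (?a + \<i> * ?b)" by (simp add: algebra_simps)
        then show ?thesis using c by (simp add: uv)
      qed
      ultimately show "has_laplace_transform (\<lambda>t. to_complex (y (S t x))) z
          (c * (to_complex (y (smul (of_real u) (A x) + smul (of_real (- v)) (B x))) +
             \<i> * to_complex (y (smul (of_real v) (A x) + smul (of_real u) (B x)))))"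
        using lap[OF y, of x] by (simp only:)
    qed
    then show ?thesis using False by (simp add: laplace_operator_exists_def)
  qed
qed

lemma integrable_family_if_exponentially_equicontinuous:
  assumes sc: "sequentially_complete \<gamma>" and st: "strongly_continuous \<gamma> {0..} S"
    and eq: "exponentially_family (equicontinuous_family smul \<gamma>) S"
  shows "integrable_family smul Y S"
proof -
  obtain \<alpha> where \<alpha>: "equicontinuous_family smul \<gamma> {0..} (\<lambda>t x. exp (\<alpha> * t) *\<^sub>R S t x)"
    using eq by (auto simp: exponentially_family_def)
  note loc = locally_equicontinuous_if_exponentially[OF eq]
  have b: "exponentially_family (bounded_family smul) S"
    by (rule exponentially_bounded_if_locally[OF locally_bounded_if_locally_equicontinuous[OF loc]])
  have f: "family_in (continuous_operators smul (weak_topology Y)) {0..} S"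
    unfolding family_in_def
  proof
    fix t :: real assume "t \<in> {0..}"
    then have t: "t \<ge> 0" and co: "S t \<in> continuous_operators smul \<gamma>"
      using continuous_operators_if_equicontinuous[OF loc] by (auto simp: family_in_def)
    show "S t \<in> continuous_operators smul (weak_topology Y)"
    proof (rule weak_continuous_operatorI[OF S_linear[OF t]])
      fix y assume y: "y \<in> Y"
      have "tight (\<lambda>x. norm (y (S t x)))"
        using co dualD(3)[OF y] unfolding continuous_operator_gamma_iff by blast
      then show "(\<lambda>x. y (S t x)) \<in> Y"
        by (rule dualI[rotated 2])
          (simp_all add: linear_functional_iff[OF ns] S_simps[OF t] dual_linear(1,2)[OF dualD(1)[OF y]])
    qed
  qed
  \<comment> \<open>The maximum with 0 guarantees \<open>z \<noteq> 0\<close>, so that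
    \<open>c = z\<close> is permitted for cosine families, and supplies the nonnegative abscissa
    they require.\<close>
  have l: "laplace_operator_exists smul Y S z c" if "Re z > max 0 (- \<alpha>)" "c \<noteq> 0" for z c
    by (rule laplace_operator_exists_if_equicontinuous[OF sc st \<alpha>]) (use that in auto)
  from S show ?thesis
  proof
    assume "semigroup_on smul S"
    then have "integrable_semigroup smul Y S"
      unfolding integrable_semigroup_def using b f l by (intro conjI exI[of _ "max 0 (- \<alpha>)"]) auto
    then show ?thesis by (simp add: integrable_family_def)
  next
    assume "cosine_family_on smul S"
    moreover have "laplace_operator_exists smul Y S z z" if "Re z > max 0 (- \<alpha>)" for z
      using that by (intro l) auto
    ultimately have "integrable_cosine_family smul Y S"
      unfolding integrable_cosine_family_def using b f by (intro conjI exI[of _ "max 0 (- \<alpha>)"]) auto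
    then show ?thesis by (simp add: integrable_family_def)
  qed
qed

end


section \<open>Mackey spaces that are Mazur spaces\<close>

context mixed_space
begin

text \<open>Summable weights form a null sequence, which makes the weighted supremum tight; being at
  most 1, they keep it below the norm.\<close>

lemma countably_quasi_convex_mixed_seminorms:
  "countably_quasi_convex (mixed_seminorms smul \<gamma>)"
  unfolding countably_quasi_convex_def
proof (intro allI impI)
  fix p :: "nat \<Rightarrow> 'a \<Rightarrow> real" and a :: "nat \<Rightarrow> real"
  assume *: "(\<forall>n. p n \<in> mixed_seminorms smul \<gamma>) \<and> (\<forall>n. 0 \<le> a n) \<and> a sums 1"
  then have p: "tight (p n)" "p n x \<le> norm x" and a: "0 \<le> a n" for n x
    by (simp_all add: mixed_seminorms_def continuous_seminorm_iff_tight)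
  have s: "summable a" "suminf a = 1" using * by (auto simp: sums_iff)
  then have a0: "a \<longlonglongrightarrow> 0" by (simp add: summable_LIMSEQ_zero)
  have a1: "a n \<le> 1" for n using sum_le_suminf[OF s(1), of "{n}"] a s(2) by simp
  let ?q = "\<lambda>x. SUP n. p n x * a n"
  have "?q x \<le> norm x" for x
  proof (rule cSUP_least)
    fix n
    have "p n x * a n \<le> norm x * 1" using p(2) a a1 by (intro mult_mono) auto
    then show "p n x * a n \<le> norm x" by simp
  qed simp
  moreover have "tight ?q" by (rule tight_SUP_null_sequence(1)[OF p a a0])
  ultimately have "?q \<in> mixed_seminorms smul \<gamma>"
    by (simp add: mixed_seminorms_def continuous_seminorm_iff_tight)
  moreover have "a n * p n x \<le> ?q x" for n x
    using tight_SUP_null_sequence(2)[where p = p and a = a, OF p a a0] by (simp add: mult.commute)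
  ultimately show "\<exists>q\<in>mixed_seminorms smul \<gamma>. \<forall>n x. a n * p n x \<le> q x"
    by (intro bexI[of _ ?q]) auto
qed

text \<open>A substitute for the closed absolutely convex hull of \<open>H\<close> that avoids representing
  its elements by measures.\<close>

definition finitely_additive_hull :: "('a \<Rightarrow> 'k) set \<Rightarrow> (('a \<Rightarrow> 'k) set \<Rightarrow> real) \<Rightarrow> ('a \<Rightarrow> 'k) \<Rightarrow> bool" where
  "finitely_additive_hull H m g \<longleftrightarrow>
     (\<forall>A. 0 \<le> m A) \<and> (\<forall>A. m A \<le> 1) \<and> (\<forall>A B. A \<inter> B = {} \<longrightarrow> m (A \<union> B) = m A + m B) \<and>
     (\<forall>x y. g (x + y) = g x + g y) \<and> (\<forall>c x. g (smul c x) = c * g x) \<and>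
     (\<forall>x \<delta>. \<delta> > 0 \<longrightarrow> norm (g x) \<le> \<delta> + (SUP h\<in>H. norm (h x)) * m {h \<in> H. \<delta> \<le> norm (h x)})"

text \<open>The measure is the point mass at \<open>h\<close>: either
  \<open>norm (h x) \<ge> \<delta>\<close> and the set in question has mass 1, or \<delta> alone
  suffices.\<close>

lemma finitely_additive_hull_superset:
  assumes H: "H \<subseteq> Y" "compact H" and h: "h \<in> H"
  shows "finitely_additive_hull H (\<lambda>A. if h \<in> A then 1 else 0) h"
proof -
  have ne: "H \<noteq> {}" using h by blast
  have "norm (h x) \<le> (SUP h\<in>H. norm (h x))" for x
    by (rule cSUP_upper[OF h mackey_generator_seminorm(2)[OF H ne]])
  then show ?thesis
    using h H(1) dual_linear(1,2)[OF dualD(1)] by (auto simp: finitely_additive_hull_def add_increasing)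
qed

text \<open>The measures are combined with the coefficients \<open>norm a\<close> and
  \<open>norm b\<close>, which keeps them nonnegative; \<open>norm a + norm b \<le> 1\<close> keeps
  the mass at most 1 and the level term at most \<delta>.\<close>

lemma finitely_additive_hull_absolutely_convex:
  "absolutely_convex_functionals {g. \<exists>m. finitely_additive_hull H m g}"
  unfolding absolutely_convex_functionals_def
proof (intro ballI allI impI)
  fix f g and a b :: 'k
  assume "f \<in> {g. \<exists>m. finitely_additive_hull H m g}" "g \<in> {g. \<exists>m. finitely_additive_hull H m g}"
    and ab: "norm a + norm b \<le> 1"
  then obtain m n where m: "finitely_additive_hull H m f" and n: "finitely_additive_hull H n g" by blast
  let ?l = "\<lambda>A. norm a * m A + norm b * n A" and ?f = "\<lambda>x. a * f x + b * g x"
  have m': "0 \<le> m A" "m A \<le> 1" "A \<inter> B = {} \<Longrightarrow> m (A \<union> B) = m A + m B"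
    "f (x + y) = f x + f y" "f (smul c x) = c * f x"
    "\<delta> > 0 \<Longrightarrow> norm (f x) \<le> \<delta> + (SUP h\<in>H. norm (h x)) * m {h \<in> H. \<delta> \<le> norm (h x)}" for A B x y c \<delta>
    using m unfolding finitely_additive_hull_def by blast+
  have n': "0 \<le> n A" "n A \<le> 1" "A \<inter> B = {} \<Longrightarrow> n (A \<union> B) = n A + n B"
    "g (x + y) = g x + g y" "g (smul c x) = c * g x"
    "\<delta> > 0 \<Longrightarrow> norm (g x) \<le> \<delta> + (SUP h\<in>H. norm (h x)) * n {h \<in> H. \<delta> \<le> norm (h x)}" for A B x y c \<delta>
    using n unfolding finitely_additive_hull_def by blast+
  have "finitely_additive_hull H ?l ?f"
    unfolding finitely_additive_hull_def
  proof (intro conjI allI impI)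
    show "0 \<le> ?l A" for A using m'(1) n'(1) by simp
    show "?l A \<le> 1" for A
      using mult_left_mono[OF m'(2), of "norm a" A] mult_left_mono[OF n'(2), of "norm b" A] ab by simp
    show "?l (A \<union> B) = ?l A + ?l B" if "A \<inter> B = {}" for A B
      using m'(3)[OF that] n'(3)[OF that] by (simp add: algebra_simps)
    show "?f (x + y) = ?f x + ?f y" for x y by (simp add: m'(4) n'(4) algebra_simps)
    show "?f (smul c x) = c * ?f x" for c x by (simp add: m'(5) n'(5) algebra_simps)
    fix x and \<delta> :: real assume d: "\<delta> > 0"
    let ?C = "SUP h\<in>H. norm (h x)" and ?A = "{h \<in> H. \<delta> \<le> norm (h x)}"
    have "norm (?f x) \<le> norm a * norm (f x) + norm b * norm (g x)"
      by (metis norm_mult norm_triangle_ineq)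
    also have "\<dots> \<le> norm a * (\<delta> + ?C * m ?A) + norm b * (\<delta> + ?C * n ?A)"
      using m'(6)[OF d] n'(6)[OF d] by (intro add_mono mult_left_mono) auto
    also have "\<dots> = (norm a + norm b) * \<delta> + ?C * ?l ?A" by (simp add: algebra_simps)
    also have "(norm a + norm b) * \<delta> \<le> 1 * \<delta>" using ab d by (intro mult_right_mono) auto
    finally show "norm (?f x) \<le> \<delta> + ?C * ?l ?A" by simp
  qed
  then show "?f \<in> {g. \<exists>m. finitely_additive_hull H m g}" by blast
qed

text \<open>For pairs \<open>(m, g)\<close>, every defining condition involves finitely many
  evaluations and is closed. The values of \<open>m\<close> lie in \<open>[0, 1]\<close>, and
  \<delta> = 1 bounds \<open>norm (g x)\<close> by 1 plus the supremum over \<open>H\<close>. The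
  set of pairs is thus compact, and so is its projection, which removes the existential quantifier
  over \<open>m\<close>.\<close>

lemma finitely_additive_hull_compact:
  assumes H: "H \<subseteq> Y" "compact H" "H \<noteq> {}"
  shows "compact {g. \<exists>m. finitely_additive_hull H m g}"
proof -
  let ?c = "\<lambda>x. SUP h\<in>H. norm (h x)"
  let ?E = "{(m, g). finitely_additive_hull H m g}"
  have *: "continuous_on UNIV (\<lambda>z :: (('a \<Rightarrow> 'k) set \<Rightarrow> real) \<times> ('a \<Rightarrow> 'k). fst z A)"
    "continuous_on UNIV (\<lambda>z :: (('a \<Rightarrow> 'k) set \<Rightarrow> real) \<times> ('a \<Rightarrow> 'k). snd z x)" for A x
    by (rule continuous_on_compose2[OF continuous_on_product_coordinates continuous_on_fst[OF continuous_on_id]], simp)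
      (rule continuous_on_compose2[OF continuous_on_product_coordinates continuous_on_snd[OF continuous_on_id]], simp)
  have cl: "closed ?E"
    unfolding finitely_additive_hull_def case_prod_unfold
    by (intro closed_Collect_conj closed_Collect_all closed_Collect_imp closed_Collect_eq closed_Collect_le
        open_Collect_const continuous_on_add continuous_on_mult continuous_on_norm continuous_on_const *)
  have "compactin (product_topology (\<lambda>_. euclidean) UNIV) (PiE UNIV (\<lambda>A :: ('a \<Rightarrow> 'k) set. {0..1::real}))"
    by (simp add: compactin_PiE)
  moreover have "PiE UNIV (\<lambda>A :: ('a \<Rightarrow> 'k) set. {0..1::real}) = {m. \<forall>A. 0 \<le> m A \<and> m A \<le> 1}"
    by (auto simp: PiE_def)
  ultimately have "compact {m :: ('a \<Rightarrow> 'k) set \<Rightarrow> real. \<forall>A. 0 \<le> m A \<and> m A \<le> 1}"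
    unfolding euclidean_product_topology by simp
  then have "compact ({m :: ('a \<Rightarrow> 'k) set \<Rightarrow> real. \<forall>A. 0 \<le> m A \<and> m A \<le> 1} \<times> {g :: 'a \<Rightarrow> 'k. \<forall>x. norm (g x) \<le> 1 + ?c x})"
    (is "compact ?K") by (intro compact_Times compact_pointwise_bounded)
  moreover have "?E \<subseteq> ?K"
  proof safe
    fix m g x assume m: "finitely_additive_hull H m g"
    show "0 \<le> m A" "m A \<le> 1" for A using m unfolding finitely_additive_hull_def by blast+
    have c0: "0 \<le> ?c x" by (rule sn_nonneg[OF mackey_generator_seminorm(1)[OF H]])
    have "norm (g x) \<le> 1 + ?c x * m {h \<in> H. 1 \<le> norm (h x)}"
      using m unfolding finitely_additive_hull_def by (meson zero_less_one)
    also have "\<dots> \<le> 1 + ?c x * 1" using c0 m unfolding finitely_additive_hull_def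
      by (intro add_left_mono mult_left_mono) auto
    finally show "norm (g x) \<le> 1 + ?c x" by simp
  qed
  ultimately have "compact ?E" using closed_Int_compact[OF cl, of ?K] by (simp add: Int_absorb2)
  then have "compact (snd ` ?E)" by (intro compact_continuous_image continuous_on_snd continuous_on_id)
  moreover have "snd ` ?E = {g. \<exists>m. finitely_additive_hull H m g}" by force
  ultimately show ?thesis by simp
qed

text \<open>If the values stayed at least \<open>e\<close> in norm along a subsequence, the estimate
  with \<delta> = \<open>e / 2\<close> would give the sets of \<open>h\<close> with
  \<open>norm (h (z n)) \<ge> e / 2\<close> mass at least \<open>e / (2 * K)\<close>, where
  \<open>K\<close> bounds the suprema over \<open>H\<close> by Banach--Steinhaus. A further
  subsequence has the finite intersection property, and compactness produces one \<open>h\<close>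
  that is large along all of it, although \<open>h (z n)\<close> tends to 0.\<close>

lemma finitely_additive_hull_null_sequence:
  assumes ban: "complete (UNIV :: 'a set)" and H: "H \<subseteq> Y" "compact H" "H \<noteq> {}"
    and g: "finitely_additive_hull H m g" and z: "limitin \<gamma> z 0 sequentially"
  shows "(\<lambda>n. g (z n)) \<longlonglongrightarrow> 0"
proof (rule ccontr)
  assume "\<not> (\<lambda>n. g (z n)) \<longlonglongrightarrow> 0"
  then obtain e where e: "e > 0" "\<forall>N. \<exists>n\<ge>N. norm (g (z n)) \<ge> e"
    unfolding LIMSEQ_iff by (auto simp: not_less)
  define s where "s = enumerate {n. norm (g (z n)) \<ge> e}"
  have inf: "infinite {n. norm (g (z n)) \<ge> e}" using e(2) by (simp add: infinite_nat_iff_unbounded_le)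
  have s: "strict_mono s" "norm (g (z (s n))) \<ge> e" for n
    using strict_mono_enumerate[OF inf] enumerate_in_set[OF inf, of n] by (auto simp: s_def)
  have bl: "bounded_linear h" if "h \<in> H" for h
  proof -
    have hY: "h \<in> Y" using H(1) that by blast
    obtain C where "\<And>x. norm (h x) \<le> C * norm x" by (rule tight_bound[OF dualD(3)[OF hY]]) blast
    then show ?thesis
      by (intro bounded_linear_intro[where K = C])
        (simp_all add: dual_linear[OF dualD(1)[OF hY]] scaleR_conv_of_real mult.commute)
  qed
  have pw: "\<exists>C. \<forall>h\<in>H. norm (h x) \<le> C" for x
    using mackey_generator_seminorm(2)[OF H, of x] by (auto simp: bdd_above_def)
  obtain C where C: "C \<ge> 0" "\<And>h x. h \<in> H \<Longrightarrow> norm (h x) \<le> C * norm x"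
    by (rule Banach_Steinhaus[OF ban bl pw]) (assumption, (rule that; assumption))
  have "bounded (range z)" using z limitin_gamma_iff_tau by blast
  then obtain B where B: "\<And>n. norm (z n) \<le> B" by (auto simp: bounded_iff)
  define K where "K = C * B + 1"
  have "0 \<le> B" using B[of 0] norm_ge_zero order_trans by blast
  then have K: "K > 0" using C(1) by (simp add: K_def add_nonneg_pos)
  have cK: "(SUP h\<in>H. norm (h (z n))) \<le> K" for n
  proof (rule cSUP_least[OF H(3)])
    fix h assume "h \<in> H"
    then have "norm (h (z n)) \<le> C * norm (z n)" by (rule C(2))
    also have "\<dots> \<le> C * B" using C(1) B by (intro mult_left_mono) auto
    finally show "norm (h (z n)) \<le> K" by (simp add: K_def)
  qed
  define A where "A n = {h \<in> H. e / 2 \<le> norm (h (z (s n)))}" for n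
  have m: "0 \<le> m U" "m U \<le> 1" "U \<inter> V = {} \<Longrightarrow> m (U \<union> V) = m U + m V" for U V
    using g unfolding finitely_additive_hull_def by blast+
  have low: "m (A n) \<ge> e / (2 * K)" for n
  proof -
    have "norm (g (z (s n))) \<le> e / 2 + (SUP h\<in>H. norm (h (z (s n)))) * m (A n)"
      unfolding A_def using g e(1) unfolding finitely_additive_hull_def by (meson half_gt_zero)
    also have "\<dots> \<le> e / 2 + K * m (A n)" using cK m(1) by (intro add_left_mono mult_right_mono) auto
    finally show ?thesis using s(2)[of n] K by (simp add: field_simps)
  qed
  have "e / (2 * K) > 0" using e K by simp
  then obtain r :: "nat \<Rightarrow> nat" where r: "strict_mono r" "\<And>k. (\<Inter>l\<in>{..<k}. A (r l)) \<noteq> {}"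
    using finitely_additive_subsequence[of m "e / (2 * K)" A thesis] m low by blast
  define T where "T l = {h :: 'a \<Rightarrow> 'k. e / 2 \<le> norm (h (z (s (r l))))}" for l
  \<comment> \<open>Dropping the membership in \<open>H\<close> leaves closed sets
    \<open>T l\<close>, so compactness of \<open>H\<close> passes from finite intersections to the
    full one.\<close>
  have "H \<inter> \<Inter>(range T) \<noteq> {}"
  proof (rule compact_imp_fip[OF H(2)])
    fix U assume "U \<in> range T"
    then obtain l where "U = T l" by blast
    then show "closed U" unfolding T_def
      by (simp only:) (intro closed_Collect_le continuous_on_norm continuous_on_const continuous_on_product_coordinates)
  next
    fix F' assume F': "finite F'" "F' \<subseteq> range T"
    obtain L where L: "finite L" "F' = T ` L" using finite_subset_image[OF F'] by blast
    obtain k where k: "L \<subseteq> {..<k}" using L(1) finite_nat_iff_bounded by blast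
    \<comment> \<open>\<open>Suc k\<close> instead of \<open>k\<close> ensures that index 0 occurs,
      so that \<open>h\<close> lies in \<open>H\<close> even if \<open>L\<close> is empty.\<close>
    obtain h where "h \<in> (\<Inter>l\<in>{..<Suc k}. A (r l))" using r(2)[of "Suc k"] by blast
    then have h: "h \<in> A (r l)" if "l < Suc k" for l using that by blast
    have "h \<in> H" using h[of 0] by (simp add: A_def)
    moreover have "h \<in> T l" if "l \<in> L" for l
    proof -
      have "l < Suc k" using that k by auto
      then show ?thesis using h[of l] by (simp add: A_def T_def)
    qed
    ultimately show "H \<inter> \<Inter>F' \<noteq> {}" unfolding L(2) by blast
  qed
  then obtain h where h: "h \<in> H" "\<And>l. e / 2 \<le> norm (h (z (s (r l))))" by (auto simp: T_def)
  have "h \<in> Y" using h(1) H(1) by blast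
  then have "(\<lambda>n. norm (h (z n - 0))) \<longlonglongrightarrow> 0" using z dualD(3) unfolding limitin_gamma_iff by blast
  then have "((\<lambda>n. norm (h (z n - 0))) \<circ> (s \<circ> r)) \<longlonglongrightarrow> 0"
    by (rule LIMSEQ_subseq_LIMSEQ) (rule strict_mono_o[OF s(1) r(1)])
  then have "(\<lambda>l. norm (h (z (s (r l))))) \<longlonglongrightarrow> 0" by (simp add: o_def)
  then have "e / 2 \<le> 0" using h(2) by (intro LIMSEQ_le_const) auto
  then show False using e(1) by simp
qed

lemma strong_mackey_if_Mazur:
  assumes ban: "complete (UNIV :: 'a set)" and m: "mackey_space smul \<gamma>" and maz: "mazur_space smul \<gamma>"
  shows "strong_mackey_space smul \<gamma>"
  unfolding strong_mackey_space_def compactin_weak_star_iff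
proof (intro allI impI)
  fix H assume "compact H \<and> H \<subseteq> Y"
  then have H: "H \<subseteq> Y" "compact H" by auto
  show "equicontinuous_functionals \<gamma> H"
  proof (cases "H = {}")
    case True
    then show ?thesis unfolding equicontinuous_functionals_def
      using openin_topspace[of \<gamma>] by (intro allI impI exI[of _ UNIV]) simp
  next
    case False
    let ?D = "{g. \<exists>m. finitely_additive_hull H m g}"
    have HD: "H \<subseteq> ?D" using finitely_additive_hull_superset[OF H] by blast
    have cD: "compact ?D" by (rule finitely_additive_hull_compact[OF H False])
    have DY: "?D \<subseteq> Y"
    proof
      fix g assume "g \<in> ?D"
      then obtain m where g: "finitely_additive_hull H m g" by blast
      then have lin: "Vector_Spaces.linear smul (*) g"
        unfolding linear_functional_iff[OF ns] finitely_additive_hull_def by blast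
      have "(\<lambda>n. g (xs n)) \<longlonglongrightarrow> g x" if xs: "limitin \<gamma> xs x sequentially" for xs x
      proof -
        have "limitin \<gamma> (\<lambda>n. xs n - x) 0 sequentially" using xs by (simp add: limitin_gamma_iff)
        then have "(\<lambda>n. g (xs n - x)) \<longlonglongrightarrow> 0"
          by (rule finitely_additive_hull_null_sequence[OF ban H False g])
        then have "(\<lambda>n. g (xs n) - g x) \<longlonglongrightarrow> 0" by (simp add: dual_linear(3)[OF lin])
        then show ?thesis by (rule LIM_zero_cancel)
      qed
      then have "continuous_map \<gamma> euclidean g" using maz lin unfolding mazur_space_def by blast
      then show "g \<in> Y" using lin by (simp add: top_dual_def)
    qed
    have ne: "?D \<noteq> {}" using False HD by blast
    have t: "tight (\<lambda>x. SUP f\<in>?D. norm (f x))"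
      by (rule mackey_tight[OF m DY cD ne finitely_additive_hull_absolutely_convex])
    show ?thesis
      unfolding equicontinuous_functionals_def
    proof (intro allI impI)
      fix \<epsilon> :: real assume e: "\<epsilon> > 0"
      let ?U = "{y. (SUP f\<in>?D. norm (f (y - 0))) < \<epsilon>}"
      have "norm (f x) < \<epsilon>" if "f \<in> H" "x \<in> ?U" for f x
      proof -
        have "norm (f x) \<le> (SUP f\<in>?D. norm (f x))"
          using HD that(1) mackey_generator_seminorm(2)[OF DY cD ne] by (intro cSUP_upper) auto
        then show ?thesis using that(2) by simp
      qed
      moreover have "openin \<gamma> ?U" by (rule openin_gamma_ball[OF t e])
      moreover have "0 \<in> ?U" using e sn_zero[OF tight_seminorm[OF t]] by simp
      ultimately show "\<exists>U. openin \<gamma> U \<and> 0 \<in> U \<and> (\<forall>f\<in>H. \<forall>x\<in>U. norm (f x) < \<epsilon>)" by blast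
    qed
  qed
qed

end

section \<open>Remaining implications and the conclusion\<close>

context mixed_family
begin

lemma continuous_operators_if_integrable:
  assumes m: "mackey_space smul \<gamma>" and int: "integrable_family smul Y S"
  shows "family_in (continuous_operators smul \<gamma>) {0..} S"
proof -
  have f: "family_in (continuous_operators smul (weak_topology Y)) {0..} S"
    using int by (auto simp: integrable_family_def integrable_semigroup_def integrable_cosine_family_def)
  show ?thesis
    unfolding family_in_def
  proof
    fix t :: real assume t: "t \<in> {0..}"
    show "S t \<in> continuous_operators smul \<gamma>"
      by (rule mackey_continuous_operator[OF m])
        (use t f S_linear weak_continuous_operatorD[of "S t"] in \<open>auto simp: family_in_def\<close>)
  qed
qed

lemma exponentially_equitight_if_equicontinuous:
  "exponentially_family (equicontinuous_family smul \<gamma>) S \<Longrightarrow> exponentially_family (equitight_family P) S"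
  unfolding exponentially_family_def using equitight_if_equicontinuous by blast

lemma locally_equitight_if_equicontinuous:
  "locally_family (equicontinuous_family smul \<gamma>) S \<Longrightarrow> locally_family (equitight_family P) S"
  unfolding locally_family_def using equitight_if_equicontinuous by blast

lemma bounded_operators_if_locally_equicontinuous:
  "locally_family (equicontinuous_family smul \<gamma>) S \<Longrightarrow> family_in (bounded_operators smul) {0..} S"
  by (intro bounded_operators_if_locally_bounded locally_bounded_if_locally_equicontinuous)

end

theorem corollary5p5:
  fixes smul :: "'k::real_or_complex \<Rightarrow> 'a::real_normed_vector \<Rightarrow> 'a"
    and \<tau> \<gamma> :: "'a topology"
    and P :: "('a \<Rightarrow> real) set"
    and S :: "real \<Rightarrow> 'a \<Rightarrow> 'a"
  assumes saks: "saks_space smul \<tau> P"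
    and mixed: "is_mixed_topology smul \<tau> \<gamma>"
    and S: "semigroup_on smul S \<or> cosine_family_on smul S"
  shows "let
      banach = complete (UNIV :: 'a set);
      a = locally_bi_continuous smul \<tau> S;
      b = (locally_bi_continuous smul \<tau> S \<and> exponentially_family (bounded_family smul) S);
      c = (strongly_continuous \<gamma> {0..} S \<and>
           locally_family (equicontinuous_family smul \<gamma>) S);
      d = (strongly_continuous \<gamma> {0..} S \<and>
           exponentially_family (equicontinuous_family smul \<gamma>) S);
      e = (strongly_continuous \<gamma> {0..} S \<and>
           locally_family (equitight_family P) S \<and>
           family_in (bounded_operators smul) {0..} S);
      f = (strongly_continuous \<gamma> {0..} S \<and>
           exponentially_family (equitight_family P) S \<and>
           family_in (bounded_operators smul) {0..} S);
      g = (strongly_continuous \<gamma> {0..} S \<and>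
           family_in (continuous_operators smul \<gamma>) {0..} S);
      h = (strongly_continuous \<gamma> {0..} S \<and>
           integrable_family smul (top_dual smul \<gamma>) S)
    in
      \<comment> \<open>(i)\<close>
      (banach \<and> C_sequential \<gamma> \<longrightarrow> (a \<longleftrightarrow> b) \<and> (b \<longleftrightarrow> c) \<and> (c \<longleftrightarrow> d)) \<and>
      \<comment> \<open>(ii)\<close>
      (countably_quasi_convex (mixed_seminorms smul \<gamma>) \<longrightarrow> (c \<longleftrightarrow> d)) \<and>
      (mackey_space smul \<gamma> \<longrightarrow>
         countably_quasi_convex (mixed_seminorms smul \<gamma>) \<and> (c \<longleftrightarrow> d)) \<and>
      \<comment> \<open>(iii)\<close>
      (\<gamma> = submixed_topology P \<longrightarrow> (c \<longrightarrow> e) \<and> (d \<longrightarrow> f)) \<and>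
      (banach \<longrightarrow> (e \<longrightarrow> c) \<and> (f \<longrightarrow> d)) \<and>
      \<comment> \<open>(iv)\<close>
      (sequentially_complete \<gamma> \<longrightarrow> (d \<longrightarrow> h)) \<and>
      \<comment> \<open>(v)\<close>
      (banach \<and> mackey_space smul \<gamma> \<longrightarrow> (h \<longrightarrow> g)) \<and>
      \<comment> \<open>(vi)\<close>
      (strong_mackey_space smul \<gamma> \<longrightarrow> (c \<longleftrightarrow> d) \<and> (d \<longleftrightarrow> g)) \<and>
      (strong_mackey_space smul \<gamma> \<and> sequentially_complete \<gamma> \<longrightarrow>
         (c \<longleftrightarrow> d) \<and> (d \<longleftrightarrow> g) \<and> (g \<longleftrightarrow> h)) \<and>
      \<comment> \<open>(vii)\<close>
      (banach \<and> strong_mackey_space smul \<gamma> \<and> mazur_space smul \<gamma> \<longrightarrow>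
         (a \<longleftrightarrow> b) \<and> (b \<longleftrightarrow> c) \<and> (c \<longleftrightarrow> d) \<and> (d \<longleftrightarrow> g)) \<and>
      (sequentially_complete \<gamma> \<and> mackey_space smul \<gamma> \<and> mazur_space smul \<gamma> \<longrightarrow>
         (a \<longleftrightarrow> b) \<and> (b \<longleftrightarrow> c) \<and> (c \<longleftrightarrow> d) \<and> (d \<longleftrightarrow> g) \<and> (g \<longleftrightarrow> h))"
proof -
  interpret mixed_family smul \<tau> \<gamma> P S
    by unfold_locales (rule saks mixed S)+
  define a where "a \<longleftrightarrow> locally_bi_continuous smul \<tau> S"
  define b where "b \<longleftrightarrow> a \<and> exponentially_family (bounded_family smul) S"
  define c where "c \<longleftrightarrow> strongly_continuous \<gamma> {0..} S \<and> locally_family (equicontinuous_family smul \<gamma>) S"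
  define d where "d \<longleftrightarrow> strongly_continuous \<gamma> {0..} S \<and> exponentially_family (equicontinuous_family smul \<gamma>) S"
  define e where "e \<longleftrightarrow> strongly_continuous \<gamma> {0..} S \<and> locally_family (equitight_family P) S \<and>
           family_in (bounded_operators smul) {0..} S"
  define f where "f \<longleftrightarrow> strongly_continuous \<gamma> {0..} S \<and> exponentially_family (equitight_family P) S \<and>
           family_in (bounded_operators smul) {0..} S"
  define g where "g \<longleftrightarrow> strongly_continuous \<gamma> {0..} S \<and> family_in (continuous_operators smul \<gamma>) {0..} S"
  define h where "h \<longleftrightarrow> strongly_continuous \<gamma> {0..} S \<and> integrable_family smul (top_dual smul \<gamma>) S"
  have ab: "a \<longleftrightarrow> b"
    unfolding b_def unfolding a_def using exponentially_bounded_if_locally by (auto simp: locally_bi_continuous_def)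
  have cd: "c \<longleftrightarrow> d" unfolding c_def d_def exponentially_iff_locally ..
  have ca: "c \<Longrightarrow> a" unfolding c_def a_def using bi_continuous_if_equicontinuous by blast
  have ac: "C_sequential \<gamma> \<Longrightarrow> a \<Longrightarrow> c"
    unfolding c_def a_def
    using gamma_strongly_continuous_if_bi_continuous equicontinuous_if_bi_continuous_C_sequential by blast
  have ce: "c \<Longrightarrow> e"
    unfolding c_def e_def
    using locally_equitight_if_equicontinuous bounded_operators_if_locally_equicontinuous by blast
  have df: "d \<Longrightarrow> f"
    using exponentially_equitight_if_equicontinuous bounded_operators_if_locally_equicontinuous cd
    unfolding c_def d_def f_def by blast
  have ec: "complete (UNIV :: 'a set) \<Longrightarrow> e \<Longrightarrow> c"
    unfolding c_def e_def using locally_equicontinuous_if_equitight by blast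
  have fe: "f \<Longrightarrow> e" unfolding f_def e_def using locally_equitight_if_exponentially by blast
  have dh: "sequentially_complete \<gamma> \<Longrightarrow> d \<Longrightarrow> h"
    unfolding d_def h_def using integrable_family_if_exponentially_equicontinuous by blast
  have hg: "mackey_space smul \<gamma> \<Longrightarrow> h \<Longrightarrow> g"
    unfolding h_def g_def using continuous_operators_if_integrable by blast
  have cg: "c \<Longrightarrow> g" unfolding c_def g_def using continuous_operators_if_equicontinuous by blast
  have gc: "strong_mackey_space smul \<gamma> \<Longrightarrow> g \<Longrightarrow> c"
    unfolding c_def g_def using equicontinuous_if_strong_mackey by blast
  \<comment> \<open>With \<open>gc\<close> and \<open>ca\<close> this closes the cycle from
    \<open>a\<close> through \<open>g\<close> and \<open>c\<close> back to \<open>a\<close>. Where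
    only the Mackey and Mazur properties are given, \<open>complete_if_sequentially_complete\<close>
    and \<open>strong_mackey_if_Mazur\<close> supply what \<open>gc\<close> requires.\<close>
  have ag: "mackey_space smul \<gamma> \<Longrightarrow> mazur_space smul \<gamma> \<Longrightarrow> a \<Longrightarrow> g"
    unfolding a_def g_def
    using continuous_operators_if_bi_continuous_Mazur gamma_strongly_continuous_if_bi_continuous by blast
  note sm = mackey_if_strong_mackey strong_mackey_if_Mazur complete_if_sequentially_complete
  note all = ab cd ca ac ce df ec fe dh hg cg gc ag sm countably_quasi_convex_mixed_seminorms
  show ?thesis
    unfolding Let_def a_def[symmetric] b_def[symmetric] c_def[symmetric] d_def[symmetric] e_def[symmetric]
      f_def[symmetric] g_def[symmetric] h_def[symmetric]
    using all by blast
qed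

end
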